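(* Let $A=R/I$, $R=K[[x,y,z]]$, be a local ring of type $(2,2)$ and multiplicity $e$, and let $n\ge 3$ be an integer. The following conditions are equivalent: (i) $n\le e-3$ and $HF_A=H(n,e)$, where $H(n,e)(t)=1$ for $t=0$, $H(n,e)(t)=t+2$ for $t=1,\dots,n$, $H(n,e)(t)=t+1$ for $t=n+1,\dots,e-2$, and $H(n,e)(t)=e$ for $t\ge e-1$. (ii) Up to analytic isomorphism (i.e. after replacing $I$ by $\phi(I)$ for some $K$-algebra automorphism $\phi$ of $R$), $I$ is generated by $$f=x^2+a z^p(x+H)-H^2+L,\qquad g=xy+\alpha z^n+yH,$$ where - $a\in\{0,1\}$, $p\ge 2$, and $\alpha$ is a unit of $K[[z]]$; - $H,L\in K[[y,z]]$ with $\operatorname{order}(L)\ge n+1$ and $\operatorname{order}(H)\ge 2$; - $n+3\le e\le 2n$; - $\operatorname{order}(2\alpha z^nH-a\alpha z^{n+p}+yL)\ge e-1$, and equality holds whenever $e<2n$.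
   Context: $K$ is an algebraically closed field of characteristic zero, $R=K[[x,y,z]]$ with maximal ideal $\mathcal M=(x,y,z)$, $P=K[x,y,z]$. For nonzero $f\in R$, $\operatorname{order}(f)$ is the least degree $v$ of a monomial appearing in $f$, with $\operatorname{order}(0)=\infty$, and $f^*\in P$ is the homogeneous component of degree $v$ of $f$ (its initial form). $A=R/I$ is of type $(2,2)$ if $I$ is generated by a regular sequence $\{f,g\}$ with $\operatorname{order}(f)=\operatorname{order}(g)=2$ and $g^*\notin(f^* )$. With $\mathfrak m=\mathcal M/I$, $HF_A(t)=\dim_K(\mathfrak m^t/\mathfrak m^{t+1})$. Such $A$ is one-dimensional Cohen-Macaulay; its multiplicity $e$ is the value of $HF_A(t)$ for all large $t$. *)

theory Defs
  imports
    "HOL-Computational_Algebra.Polynomial"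
    "HOL-Computational_Algebra.Formal_Power_Series"
    "HOL-Algebra.QuotRing"
    "HOL-Algebra.Ideal_Product"
    "HOL-Algebra.Embedded_Algebras"
    "HOL-Library.Extended_Nat"
begin

text \<open>
  \<open>K[[x,y,z]]\<close> is modelled as the iterated power series ring \<open>K[[z]][[y]][[x]]\<close>: the coefficient
  of \<open>x^i y^j z^k\<close> in \<open>F\<close> is \<open>F $ i $ j $ k\<close>. Accordingly \<open>K[[z]]\<close> is \<^typ>\<open>'a fps\<close>,
  \<open>K[[y,z]]\<close> is \<^typ>\<open>'a fps fps\<close>, and \<open>K[x,y,z]\<close> is \<^typ>\<open>'a poly poly poly\<close>
  with the same nesting of the variables.
\<close>

unbundle fps_syntax

type_synonym 'a ps3 = "'a fps fps fps"

definition emb_yz :: "'a::comm_ring_1 fps fps \<Rightarrow> 'a ps3" where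
  "emb_yz F = fps_const F"

definition emb_z :: "'a::comm_ring_1 fps \<Rightarrow> 'a ps3" where
  "emb_z F = fps_const (fps_const F)"

definition emb_K :: "'a::comm_ring_1 \<Rightarrow> 'a ps3" where
  "emb_K c = fps_const (fps_const (fps_const c))"

definition var_x :: "'a::comm_ring_1 ps3" where "var_x = fps_X"
definition var_y :: "'a::comm_ring_1 ps3" where "var_y = emb_yz fps_X"
definition var_z :: "'a::comm_ring_1 ps3" where "var_z = emb_z fps_X"

definition ps_order :: "'a::comm_ring_1 ps3 \<Rightarrow> enat" where
  "ps_order F = (if F = 0 then \<infinity>
     else enat (LEAST v. \<exists>i j k. i + j + k = v \<and> F $ i $ j $ k \<noteq> 0))"

text \<open>Only meaningful for nonzero series (the order of \<open>0\<close> is infinite).\<close>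

definition initial_form :: "'a::comm_ring_1 ps3 \<Rightarrow> 'a poly poly poly" where
  "initial_form F = (let v = the_enat (ps_order F) in
     \<Sum>i\<le>v. \<Sum>j\<le>v - i. Polynomial.monom (Polynomial.monom (Polynomial.monom (F $ i $ j $ (v - i - j)) (v - i - j)) j) i)"

definition type_ring :: "'b::comm_ring_1 ring" where
  "type_ring = \<lparr>carrier = UNIV, mult = (*), one = 1, zero = 0, add = (+)\<rparr>"

lemma cring_type_ring: "cring (type_ring :: 'b::comm_ring_1 ring)"
  by (unfold_locales)
     (auto simp: type_ring_def algebra_simps Units_def
       intro: exI[of _ "- x" for x])

abbreviation ideal_gen :: "'b::comm_ring_1 set \<Rightarrow> 'b set" where
  "ideal_gen S \<equiv> Idl\<^bsub>type_ring\<^esub> S"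

text \<open>
  Each \<open>fs ! i\<close> is a nonzerodivisor modulo the ideal generated by its predecessors, and the
  whole sequence generates a proper ideal.
\<close>

definition regular_sequence :: "'b::comm_ring_1 list \<Rightarrow> bool" where
  "regular_sequence fs \<longleftrightarrow>
     (\<forall>i<length fs. \<forall>h. fs ! i * h \<in> ideal_gen (set (take i fs)) \<longrightarrow>
                          h \<in> ideal_gen (set (take i fs))) \<and>
     ideal_gen (set fs) \<noteq> UNIV"

definition type_2_2 :: "'a::field ps3 set \<Rightarrow> bool" where
  "type_2_2 I \<longleftrightarrow> (\<exists>f g. I = ideal_gen {f, g} \<and> regular_sequence [f, g] \<and>
     ps_order f = 2 \<and> ps_order g = 2 \<and> initial_form g \<notin> ideal_gen {initial_form f})"

definition quot_ring :: "'a::field ps3 set \<Rightarrow> 'a ps3 set ring" where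
  "quot_ring I = type_ring Quot I"

definition quot_maximal :: "'a::field ps3 set \<Rightarrow> 'a ps3 set set" where
  "quot_maximal I = (\<lambda>r. I +>\<^bsub>type_ring\<^esub> r) ` ideal_gen {var_x, var_y, var_z}"

definition quot_maximal_pow :: "'a::field ps3 set \<Rightarrow> nat \<Rightarrow> 'a ps3 set set" where
  "quot_maximal_pow I t = quot_maximal I [^]\<^bsub>ideals_set (quot_ring I)\<^esub> t"

text \<open>
  With \<open>A = R/I\<close>, the \<open>K\<close>-vector space \<open>\<mm>^t/\<mm>^(t+1)\<close> is the image of \<open>\<mm>^t\<close> in the ring
  \<open>B = A/\<mm>^(t+1)\<close>, on which \<open>K\<close> acts through its image in \<open>B\<close>. For proper \<open>I\<close> that image is a
  subfield of \<open>B\<close> isomorphic to \<open>K\<close>, as the dimension of HOL-Algebra requires.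
\<close>

definition hilbert_function :: "'a::field ps3 set \<Rightarrow> nat \<Rightarrow> nat" where
  "hilbert_function I t =
     (let A = quot_ring I;
          B = A Quot quot_maximal_pow I (Suc t);
          to_B = (\<lambda>u. quot_maximal_pow I (Suc t) +>\<^bsub>A\<^esub> u);
          K = range (\<lambda>c. to_B (I +>\<^bsub>type_ring\<^esub> emb_K c))
      in ring.dim B K (to_B ` quot_maximal_pow I t))"

definition has_multiplicity :: "'a::field ps3 set \<Rightarrow> nat \<Rightarrow> bool" where
  "has_multiplicity I e \<longleftrightarrow> (\<forall>\<^sub>F t in sequentially. hilbert_function I t = e)"

text \<open>The cases are exhaustive and disjoint in the intended range \<open>n + 3 \<le> e\<close>.\<close>

definition H_fun :: "nat \<Rightarrow> nat \<Rightarrow> nat \<Rightarrow> nat" where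
  "H_fun n e t = (if t = 0 then 1 else if t \<le> n then t + 2
                  else if t \<le> e - 2 then t + 1 else e)"

definition K_algebra_automorphism :: "('a::field ps3 \<Rightarrow> 'a ps3) \<Rightarrow> bool" where
  "K_algebra_automorphism \<phi> \<longleftrightarrow>
     \<phi> \<in> ring_iso type_ring type_ring \<and> (\<forall>c. \<phi> (emb_K c) = emb_K c)"

end

theory Submission
  imports Defs
begin

text \<open>
  After a linear change of coordinates the initial forms are \<open>x^2 + \<epsilon> x z\<close> and \<open>x y\<close>: the value
  \<open>HF(3) = 5\<close> forces a linear syzygy between them. Weierstrass division by the first generator and
  shifts of \<open>y\<close> and \<open>x\<close> then bring the ideal to the form \<open>f = x^2 + b x + L\<close>, \<open>g = x y + \<gamma>(z)\<close> with
  \<open>b, L \<in> S = K[[y,z]]\<close>. Modulo \<open>f\<close> every element of the ideal is \<open>A x + B\<close> with \<open>A = y s + \<tau> \<gamma>\<close>,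
  \<open>B = s \<gamma> - \<tau> D\<close>, \<open>D = y L - \<gamma> b\<close>, so the initial ideal can be read off: when \<open>\<gamma>\<close> has order \<open>n\<close> and
  \<open>D\<close> has order at least \<open>n + 2\<close> it is \<open>(x^2, x y, x z^n, q*)\<close> with \<open>q = \<gamma>^2 + y D\<close>, and the Hilbert
  function is \<open>H(n, order q)\<close>. Conversely the values of \<open>H(n, e)\<close> up to degree \<open>n + 2\<close> force these orders
  and \<open>\<epsilon> = 0\<close>. The shift \<open>x \<mapsto> x + H\<close> with \<open>b = a z^p - 2 H\<close> turns \<open>f, g\<close> into the generators
  of the theorem; one may even take \<open>a = 0\<close>.
\<close>

section \<open>Power series and their filtrations\<close>

text \<open>The writing \<open>w f + A x + B\<close> of an element of the ideal replaces a standard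
  basis algorithm. Its summands cannot cancel in low order, because the initial form of
  \<open>f\<close> is monic of degree 2 in \<open>x\<close> and the other two summands have smaller
  degree in \<open>x\<close>. So initial forms are read off from \<open>A\<close> and
  \<open>B\<close>, which depend linearly on two free series \<open>s\<close>, \<open>\<tau>\<close>
  in \<open>y\<close> and \<open>z\<close>. The determinant of this linear map is
  \<open>- q\<close>, which is why the order of \<open>q\<close> becomes the multiplicity; and the
  term \<open>z^(2n)\<close> of \<open>\<gamma>^2\<close>, which \<open>y D\<close> cannot cancel,
  is why \<open>e \<le> 2 n\<close>. The converse has to recover orders from numbers alone. The drop
  of the Hilbert function in degree \<open>n + 1\<close> gives a relation among \<open>x z^n\<close>
  and the monomials in \<open>y\<close>, \<open>z\<close>, while the value in degree
  \<open>n + 2\<close> leaves room for only one relation there. A relation containing a monomial in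
  \<open>y\<close>, \<open>z\<close> would produce two, through multiplication by \<open>y\<close>
  and by \<open>z\<close>. Hence the relation is \<open>x z^n\<close>, and such an initial form
  occurs only if \<open>\<tau>\<close> is a unit.\<close>

lemma emb_yz_nth [simp]: "emb_yz A $ i = (if i = 0 then A else 0)"
  by (simp add: emb_yz_def)

lemma emb_z_nth [simp]: "emb_z a $ i = (if i = 0 then fps_const a else 0)"
  by (simp add: emb_z_def)

lemma emb_K_nth [simp]: "emb_K c $ i = (if i = 0 then fps_const (fps_const c) else 0)"
  by (simp add: emb_K_def)

lemma emb_yz_mult_nth [simp]: "(emb_yz A * F) $ i = A * F $ i"
  by (simp add: emb_yz_def)

lemma emb_z_mult_nth [simp]: "(emb_z a * F) $ i = fps_const a * F $ i"
  by (simp add: emb_z_def)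

lemma emb_K_mult_nth [simp]: "(emb_K c * F) $ i = fps_const (fps_const c) * F $ i"
  by (simp add: emb_K_def)

lemma var_x_nth [simp]: "var_x $ i = (if i = 1 then 1 else 0)"
  by (simp add: var_x_def fps_X_nth)

lemma var_y_nth [simp]: "var_y $ i = (if i = 0 then fps_X else 0)"
  by (simp add: var_y_def)

lemma var_z_nth [simp]: "var_z $ i = (if i = 0 then fps_const fps_X else 0)"
  by (simp add: var_z_def)

lemma var_x_mult_nth [simp]: "(var_x * F) $ i = (if i = 0 then 0 else F $ (i - 1))"
  by (simp add: var_x_def fps_X_mult_nth)

lemma var_y_mult_nth [simp]: "(var_y * F) $ i = fps_X * F $ i"
  by (simp add: var_y_def)

lemma var_z_mult_nth [simp]: "(var_z * F) $ i = fps_const fps_X * F $ i"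
  by (simp add: var_z_def)

lemma emb_yz_hom:
  "emb_yz (A + B) = emb_yz A + emb_yz B" "emb_yz (A - B) = emb_yz A - emb_yz B"
  "emb_yz (- A) = - emb_yz A" "emb_yz (A * B) = emb_yz A * emb_yz B"
  "emb_yz 0 = 0" "emb_yz 1 = 1" "emb_yz (A ^ m) = emb_yz A ^ m"
  by (simp_all add: emb_yz_def fps_const_power flip: fps_const_add fps_const_sub fps_const_neg fps_const_mult)

lemma emb_K_hom:
  "emb_K (a + b) = emb_K a + emb_K b" "emb_K (a - b) = emb_K a - emb_K b"
  "emb_K (- a) = - emb_K a" "emb_K (a * b) = emb_K a * emb_K b"
  "emb_K 0 = 0" "emb_K 1 = 1"
  by (simp_all add: emb_K_def flip: fps_const_add fps_const_sub fps_const_neg fps_const_mult)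

lemma emb_z_eq_emb_yz: "emb_z a = emb_yz (fps_const a)"
  by (simp add: emb_z_def emb_yz_def)

lemma emb_K_eq_emb_z: "emb_K a = emb_z (fps_const a)"
  by (simp add: emb_z_def emb_K_def)

lemma var_z_eq_emb_z: "var_z = emb_z fps_X"
  by (simp add: var_z_def)

lemma ps3_eq_iff: "F = G \<longleftrightarrow> (\<forall>i j k. F $ i $ j $ k = G $ i $ j $ k)"
  by (auto simp: fps_eq_iff)

lemma ps3_mult_nth:
  "(F * G) $ i $ j $ k = (\<Sum>a=0..i. \<Sum>b=0..j. \<Sum>c=0..k. F $ a $ b $ c * G $ (i - a) $ (j - b) $ (k - c))"
  by (simp add: fps_mult_nth fps_sum_nth)

text \<open>The weight \<open>r\<close> of \<open>y\<close> and \<open>z\<close> is \<open>1\<close> for the adic filtration; \<open>r = 2\<close> makes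
  Weierstrass division by series with a term \<open>x^2\<close> contracting.\<close>

definition fil :: "nat \<Rightarrow> nat \<Rightarrow> 'a::comm_ring_1 ps3 set" where
  "fil r N = {F. \<forall>i j k. i + r * (j + k) < N \<longrightarrow> F $ i $ j $ k = 0}"

abbreviation \<MM> :: "nat \<Rightarrow> 'a::comm_ring_1 ps3 set" where "\<MM> \<equiv> fil (Suc 0)"

lemma filI: "(\<And>i j k. i + r * (j + k) < N \<Longrightarrow> F $ i $ j $ k = 0) \<Longrightarrow> F \<in> fil r N"
  by (simp add: fil_def)

lemma filD: "F \<in> fil r N \<Longrightarrow> i + r * (j + k) < N \<Longrightarrow> F $ i $ j $ k = 0"
  by (simp add: fil_def)

lemma MMI: "(\<And>i j k. i + j + k < N \<Longrightarrow> F $ i $ j $ k = 0) \<Longrightarrow> F \<in> \<MM> N"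
  by (simp add: fil_def)

lemma MMD: "F \<in> \<MM> N \<Longrightarrow> i + j + k < N \<Longrightarrow> F $ i $ j $ k = 0"
  by (simp add: fil_def)

lemma fil_0 [simp]: "fil r 0 = UNIV"
  by (simp add: fil_def)

lemma zero_fil [simp]: "0 \<in> fil r N"
  by (simp add: fil_def)

lemma fil_mono: "F \<in> fil r N \<Longrightarrow> K \<le> N \<Longrightarrow> F \<in> fil r K"
  by (auto simp: fil_def)

lemma fil_add: "F \<in> fil r N \<Longrightarrow> G \<in> fil r N \<Longrightarrow> F + G \<in> fil r N"
  by (simp add: fil_def)

lemma fil_diff: "F \<in> fil r N \<Longrightarrow> G \<in> fil r N \<Longrightarrow> F - G \<in> fil r N"
  by (simp add: fil_def)

lemma fil_uminus: "F \<in> fil r N \<Longrightarrow> - F \<in> fil r N"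
  by (simp add: fil_def)

lemma fil_uminus_iff [simp]: "- F \<in> fil r N \<longleftrightarrow> F \<in> fil r N"
  using fil_uminus[of F r N] fil_uminus[of "- F" r N] by auto

lemma fil_diff_commute: "F - G \<in> fil r N \<Longrightarrow> G - F \<in> fil r N"
  using fil_uminus[of "F - G"] by simp

lemma fil_trans: "F - G \<in> fil r N \<Longrightarrow> G - H \<in> fil r N \<Longrightarrow> F - H \<in> fil r N"
  using fil_add[of "F - G" r N "G - H"] by simp

lemma fil_cong: "F - G \<in> fil r N \<Longrightarrow> F \<in> fil r N \<longleftrightarrow> G \<in> fil r N"
  using fil_add[of "F - G" r N G] fil_diff[of F r N "F - G"] by auto

lemma fil_mult:
  assumes "F \<in> fil r s" "G \<in> fil r t"
  shows "F * G \<in> fil r (s + t)"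
proof (rule filI)
  fix i j k assume *: "i + r * (j + k) < s + t"
  have "F $ a $ b $ c * G $ (i - a) $ (j - b) $ (k - c) = 0" if "a \<le> i" "b \<le> j" "c \<le> k" for a b c
  proof -
    have "r * (j + k) = r * (b + c) + r * ((j - b) + (k - c))"
      using that by (simp flip: add_mult_distrib2)
    then have "a + r * (b + c) < s \<or> (i - a) + r * ((j - b) + (k - c)) < t"
      using * that by linarith
    then show ?thesis
      using assms by (auto simp: filD)
  qed
  then show "(F * G) $ i $ j $ k = 0"
    by (simp add: ps3_mult_nth)
qed

lemma fil_mult_left: "G \<in> fil r t \<Longrightarrow> F * G \<in> fil r t"
  using fil_mult[of F r 0 G t] by simp

lemma fil_mult_right: "F \<in> fil r t \<Longrightarrow> F * G \<in> fil r t"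
  using fil_mult[of F r t G 0] by simp

lemma fil_mult_le: "F \<in> fil r s \<Longrightarrow> G \<in> fil r t \<Longrightarrow> N \<le> s + t \<Longrightarrow> F * G \<in> fil r N"
  using fil_mult fil_mono by blast

lemma fil_power: "F \<in> fil r s \<Longrightarrow> F ^ m \<in> fil r (m * s)"
  by (induction m) (auto intro: fil_mult)

lemma ps3_eqI_fil:
  assumes "\<And>N. F - G \<in> fil r N"
  shows "F = G"
proof -
  have "(F - G) $ i $ j $ k = 0" for i j k
    using assms[of "Suc (i + r * (j + k))"] filD by blast
  then show ?thesis
    by (simp add: ps3_eq_iff)
qed

lemma var_x_MM [simp]: "var_x \<in> \<MM> (Suc 0)" and var_y_MM [simp]: "var_y \<in> \<MM> (Suc 0)"
  and var_z_MM [simp]: "var_z \<in> \<MM> (Suc 0)"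
  by (auto simp: fil_def)

lemma var_z_power_MM [simp]: "var_z ^ m \<in> \<MM> m"
  using fil_power[OF var_z_MM, of m] by simp

lemma emb_yz_MM: "emb_yz A \<in> \<MM> N \<longleftrightarrow> (\<forall>j k. j + k < N \<longrightarrow> A $ j $ k = 0)"
  by (auto simp: fil_def)

lemma emb_z_MM: "emb_z a \<in> \<MM> N \<longleftrightarrow> (\<forall>k < N. a $ k = 0)"
proof -
  have "(\<forall>j k. j + k < N \<longrightarrow> fps_const a $ j $ k = 0) \<longleftrightarrow> (\<forall>k<N. a $ k = 0)"
    by (metis add.commute add_lessD1 add_cancel_right_right fps_nth_fps_const fps_zero_nth)
  then show ?thesis
    by (simp add: emb_z_eq_emb_yz emb_yz_MM)
qed

lemma var_x_mult_MM [simp]: "var_x * F \<in> \<MM> (Suc N) \<longleftrightarrow> F \<in> \<MM> N"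
proof
  assume *: "var_x * F \<in> \<MM> (Suc N)"
  show "F \<in> \<MM> N"
  proof (rule MMI)
    fix i j k assume "i + j + k < N"
    then have "(var_x * F) $ (Suc i) $ j $ k = 0"
      using * by (intro MMD) auto
    then show "F $ i $ j $ k = 0"
      by simp
  qed
qed (use fil_mult[OF var_x_MM, of F N] in simp)

lemma var_y_mult_MM [simp]: "var_y * F \<in> \<MM> (Suc N) \<longleftrightarrow> F \<in> \<MM> N"
proof
  assume *: "var_y * F \<in> \<MM> (Suc N)"
  show "F \<in> \<MM> N"
  proof (rule MMI)
    fix i j k assume "i + j + k < N"
    then have "(var_y * F) $ i $ (Suc j) $ k = 0"
      using * by (intro MMD) auto
    then show "F $ i $ j $ k = 0"
      by simp
  qed
qed (use fil_mult[OF var_y_MM, of F N] in simp)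

text \<open>Each monomial of positive degree is charged to the first of \<open>x\<close>,
  \<open>y\<close>, \<open>z\<close> that divides it, so \<open>B\<close> is free of
  \<open>x\<close> and \<open>c\<close> is free of \<open>x\<close> and \<open>y\<close>. Inductions
  along the adic filtration peel off one degree in this way.\<close>

lemma MM_Suc_decomp:
  assumes "F \<in> \<MM> (Suc N)"
  obtains A B c where "F = var_x * A + var_y * emb_yz B + var_z * emb_z c"
    "A \<in> \<MM> N" "emb_yz B \<in> \<MM> N" "emb_z c \<in> \<MM> N"
proof
  show "F = var_x * fps_shift 1 F + var_y * emb_yz (fps_shift 1 (F $ 0)) + var_z * emb_z (fps_shift 1 (F $ 0 $ 0))"
    using MMD[OF assms, of 0 0 0] by (auto simp: ps3_eq_iff fps_X_mult_nth not_less_eq)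
  show "fps_shift 1 F \<in> \<MM> N" "emb_yz (fps_shift 1 (F $ 0)) \<in> \<MM> N" "emb_z (fps_shift 1 (F $ 0 $ 0)) \<in> \<MM> N"
    using assms by (auto simp: fil_def)
qed

section \<open>Homogeneous components and orders of products\<close>

definition hpart :: "nat \<Rightarrow> 'a::comm_ring_1 ps3 \<Rightarrow> 'a ps3" where
  "hpart d F = Abs_fps (\<lambda>i. Abs_fps (\<lambda>j. Abs_fps (\<lambda>k. if i + j + k = d then F $ i $ j $ k else 0)))"

lemma hpart_nth [simp]: "hpart d F $ i $ j $ k = (if i + j + k = d then F $ i $ j $ k else 0)"
  by (simp add: hpart_def)

lemma hpart_add: "hpart d (F + G) = hpart d F + hpart d G"
  and hpart_diff: "hpart d (F - G) = hpart d F - hpart d G"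
  and hpart_uminus: "hpart d (- F) = - hpart d F"
  by (auto simp: ps3_eq_iff)

lemma hpart_0 [simp]: "hpart d 0 = 0"
  by (simp add: ps3_eq_iff)

lemma hpart_MM [simp]: "hpart d F \<in> \<MM> d"
  by (auto simp: fil_def)

lemma MM_Suc_iff: "F \<in> \<MM> (Suc d) \<longleftrightarrow> F \<in> \<MM> d \<and> hpart d F = 0"
  by (auto simp: fil_def ps3_eq_iff less_Suc_eq)

lemma diff_hpart_MM: "F \<in> \<MM> d \<Longrightarrow> F - hpart d F \<in> \<MM> (Suc d)"
  by (auto simp: fil_def less_Suc_eq)

lemma hpart_eqI: "F - G \<in> \<MM> (Suc d) \<Longrightarrow> hpart d F = hpart d G"
  by (auto simp: fil_def ps3_eq_iff)

text \<open>In total degree \<open>s + t\<close>, a pair of monomials not of degrees exactly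
  \<open>s\<close> and \<open>t\<close> has one member below the order of its factor, hence
  contributes nothing.\<close>

lemma hpart_mult:
  assumes "F \<in> \<MM> s" "G \<in> \<MM> t"
  shows "hpart (s + t) (F * G) = hpart s F * hpart t G"
proof -
  have "hpart (s + t) (F * G) $ i $ j $ k = (hpart s F * hpart t G) $ i $ j $ k" for i j k
  proof -
    have *: "(if i + j + k = s + t then F $ a $ b $ c * G $ (i - a) $ (j - b) $ (k - c) else 0) =
      hpart s F $ a $ b $ c * hpart t G $ (i - a) $ (j - b) $ (k - c)" (is "?l = ?r")
      if "a \<le> i" "b \<le> j" "c \<le> k" for a b c
    proof (cases "a + b + c = s \<and> (i - a) + (j - b) + (k - c) = t")
      case True
      then show ?thesis using that by auto
    next
      case False
      then have "a + b + c < s \<or> (i - a) + (j - b) + (k - c) < t" if "i + j + k = s + t"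
        using that \<open>a \<le> i\<close> \<open>b \<le> j\<close> \<open>c \<le> k\<close> by linarith
      then show ?thesis using False assms by (auto simp: MMD)
    qed
    have "hpart (s + t) (F * G) $ i $ j $ k = (\<Sum>a=0..i. \<Sum>b=0..j. \<Sum>c=0..k.
       (if i + j + k = s + t then F $ a $ b $ c * G $ (i - a) $ (j - b) $ (k - c) else 0))"
      by (simp add: ps3_mult_nth)
    also have "\<dots> = (hpart s F * hpart t G) $ i $ j $ k"
      unfolding ps3_mult_nth by (intro sum.cong refl *) auto
    finally show ?thesis .
  qed
  then show ?thesis by (simp add: ps3_eq_iff)
qed

lemma hpart_mult_nonzero:
  fixes F G :: "'a::idom ps3"
  assumes "F \<in> \<MM> s" "G \<in> \<MM> t" "F \<notin> \<MM> (Suc s)" "G \<notin> \<MM> (Suc t)"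
  shows "F * G \<notin> \<MM> (Suc (s + t))"
  using assms by (auto simp: MM_Suc_iff hpart_mult)

text \<open>Initial forms over a domain have a nonzero product, so orders add. The order of
  \<open>G\<close> is raised one degree at a time because \<open>hpart_mult_nonzero\<close> compares
  exact degrees.\<close>

lemma mult_MM_cancel:
  fixes F G :: "'a::idom ps3"
  assumes "F \<in> \<MM> s" "F \<notin> \<MM> (Suc s)" "F * G \<in> \<MM> (s + t)"
  shows "G \<in> \<MM> t"
  using assms(3)
proof (induction t)
  case (Suc t)
  have "F * G \<in> \<MM> (s + t)"
    using Suc.prems by (rule fil_mono) simp
  with Suc.IH have "G \<in> \<MM> t" by simp
  with hpart_mult_nonzero[OF assms(1) this assms(2)] Suc.prems show ?case by auto
qed simp

lemma unit_mult_MM: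
  fixes U G :: "'a::idom ps3"
  assumes "U $ 0 $ 0 $ 0 \<noteq> 0" "U * G \<in> \<MM> t"
  shows "G \<in> \<MM> t"
  using mult_MM_cancel[of U 0 G t] assms by (auto simp: fil_def)

section \<open>Completeness: fixed points, units and Weierstrass division\<close>

lemma contraction_fixpoint:
  fixes T :: "'a::comm_ring_1 ps3 \<Rightarrow> 'a ps3"
  assumes T: "\<And>N F G. F - G \<in> fil r N \<Longrightarrow> T F - T G \<in> fil r (Suc N)"
  obtains F where "T F = F"
proof -
  define s where "s n = (T ^^ n) 0" for n
  have s_Suc: "s (Suc n) = T (s n)" for n by (simp add: s_def)
  have step: "s (Suc n) - s n \<in> fil r n" for n
    by (induction n) (auto simp: s_Suc intro: T)
  have later: "s (n + m) - s n \<in> fil r n" for n m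
  proof (induction m)
    case (Suc m)
    then show ?case
      using fil_trans[OF fil_mono[OF step[of "n + m"], of n] Suc] by simp
  qed simp
  \<comment> \<open>Iterates from number \<open>N\<close> on agree in all weights below
    \<open>N\<close>, so the coefficient of weight \<open>i + r * (j + k)\<close> is final in the
    iterate with the next number.\<close>
  define F where "F = Abs_fps (\<lambda>i. Abs_fps (\<lambda>j. Abs_fps (\<lambda>k. s (Suc (i + r * (j + k))) $ i $ j $ k)))"
  have F: "F - s n \<in> fil r n" for n
  proof (rule filI)
    fix i j k assume *: "i + r * (j + k) < n"
    define m where "m = Suc (i + r * (j + k))"
    have "s (m + (n - m)) - s m \<in> fil r m" by (rule later)
    then have "(s n - s m) $ i $ j $ k = 0"
      using * by (intro filD[where N = m]) (auto simp: m_def)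
    then show "(F - s n) $ i $ j $ k = 0"
      by (simp add: F_def m_def)
  qed
  have "T F - F \<in> fil r N" for N
  proof -
    have "T F - s (Suc N) \<in> fil r N"
      using fil_mono[OF T[OF F[of N]], of N] by (simp add: s_Suc)
    moreover have "s (Suc N) - F \<in> fil r N"
      using fil_mono[OF fil_diff_commute[OF F[of "Suc N"]], of N] by simp
    ultimately show ?thesis by (rule fil_trans)
  qed
  then have "T F = F" by (rule ps3_eqI_fil)
  then show ?thesis by (rule that)
qed

text \<open>The inverse of \<open>c + U'\<close>, with \<open>c\<close> a nonzero constant, solves
  \<open>V = (1 - U' V) / c\<close>, and multiplication by \<open>U'\<close> is contracting.\<close>

lemma ps3_unit:
  fixes U :: "'a::field ps3"
  assumes "U $ 0 $ 0 $ 0 \<noteq> 0"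
  obtains V where "U * V = 1"
proof -
  define c where "c = U $ 0 $ 0 $ 0"
  define U' where "U' = U - emb_K c"
  have U': "U' \<in> \<MM> (Suc 0)" by (auto simp: fil_def U'_def c_def)
  define T where "T V = emb_K (inverse c) * (1 - U' * V)" for V
  have "T F - T G \<in> \<MM> (Suc N)" if "F - G \<in> \<MM> N" for F G N
  proof -
    have "T F - T G = emb_K (inverse c) * - (U' * (F - G))"
      by (simp add: T_def algebra_simps)
    then show ?thesis
      using fil_mult[OF U' that] by (auto intro: fil_mult_left)
  qed
  then obtain V where "T V = V" by (rule contraction_fixpoint)
  then have "emb_K c * V = emb_K c * emb_K (inverse c) * (1 - U' * V)"
    by (metis T_def mult.assoc)
  also have "emb_K c * emb_K (inverse c) = 1"
    using assms by (simp add: c_def emb_K_hom flip: emb_K_hom(4))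
  finally have "U * V = 1" by (simp add: U'_def algebra_simps)
  then show ?thesis by (rule that)
qed

text \<open>The quotient is the fixed point of \<open>w \<mapsto> (F - w f') / x^2\<close>, where
  the division drops the part of degree below 2 in \<open>x\<close>. A term \<open>x z\<close> of
  \<open>f'\<close> has ordinary degree 2, which the shift by \<open>x^2\<close> would use up; with
  weights 1, 2, 2 it has weight 3 and one unit is gained.\<close>

lemma weierstrass_division:
  assumes "f - var_x ^ 2 \<in> fil 2 3"
  obtains w A B where "F = w * f + emb_yz A * var_x + emb_yz B"
proof -
  define f' where "f' = f - var_x ^ 2"
  define T where "T w = fps_shift 2 (F - w * f')" for w
  have "T F - T G \<in> fil 2 (Suc N)" if "F - G \<in> fil 2 N" for F G N
  proof (rule filI)
    fix i j k :: nat assume *: "i + 2 * (j + k) < Suc N"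
    have "(F - G) * f' \<in> fil 2 (N + 3)"
      using that assms by (auto intro: fil_mult simp: f'_def)
    then have "((F - G) * f') $ (i + 2) $ j $ k = 0"
      using * by (intro filD) auto
    then show "(T F - T G) $ i $ j $ k = 0"
      by (simp add: T_def algebra_simps)
  qed
  then obtain w where w: "T w = w" by (rule contraction_fixpoint)
  define G where "G = F - w * f'"
  have "G = fps_shift 2 G * fps_X ^ 2 + emb_yz (G $ 1) * fps_X + emb_yz (G $ 0)"
  proof (rule fps_ext)
    fix m show "G $ m = (fps_shift 2 G * fps_X ^ 2 + emb_yz (G $ 1) * fps_X + emb_yz (G $ 0)) $ m"
      using less_2_cases[of m] le_add_diff_inverse2[of 2 m]
      by (cases "m < 2") (auto simp: fps_X_power_mult_right_nth not_less)
  qed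
  moreover have "fps_shift 2 G = w" using w by (simp add: T_def G_def)
  ultimately have "F = w * f + emb_yz (G $ 1) * var_x + emb_yz (G $ 0)"
    by (simp add: G_def f'_def var_x_def algebra_simps)
  then show ?thesis by (rule that)
qed

section \<open>Substitution automorphisms\<close>

definition K_hom :: "('a::comm_ring_1 ps3 \<Rightarrow> 'a ps3) \<Rightarrow> bool" where
  "K_hom \<phi> \<longleftrightarrow> (\<forall>F G. \<phi> (F + G) = \<phi> F + \<phi> G) \<and> (\<forall>F G. \<phi> (F * G) = \<phi> F * \<phi> G) \<and>
     (\<forall>c. \<phi> (emb_K c) = emb_K c)"

lemma K_hom_simps:
  assumes "K_hom \<phi>"
  shows "\<phi> (F + G) = \<phi> F + \<phi> G" "\<phi> (F * G) = \<phi> F * \<phi> G" "\<phi> (emb_K c) = emb_K c"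
    "\<phi> 0 = 0" "\<phi> 1 = 1" "\<phi> (- F) = - \<phi> F" "\<phi> (F - G) = \<phi> F - \<phi> G" "\<phi> (F ^ m) = \<phi> F ^ m"
proof -
  show *: "\<phi> (F + G) = \<phi> F + \<phi> G" "\<phi> (F * G) = \<phi> F * \<phi> G" "\<phi> (emb_K c) = emb_K c" for F G c
    using assms by (auto simp: K_hom_def)
  show 0: "\<phi> 0 = 0" "\<phi> 1 = 1"
    using *(3)[of 0] *(3)[of 1] by (simp_all add: emb_K_hom)
  show m: "\<phi> (- F) = - \<phi> F" for F
    using *(1)[of F "- F"] 0 by (metis add.right_inverse add_eq_0_iff)
  show "\<phi> (F - G) = \<phi> F - \<phi> G"
    using *(1)[of F "- G"] m by simp
  show "\<phi> (F ^ m) = \<phi> F ^ m"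
    by (induction m) (simp_all add: * 0)
qed

lemma K_hom_comp: "K_hom \<phi> \<Longrightarrow> K_hom \<psi> \<Longrightarrow> K_hom (\<phi> \<circ> \<psi>)"
  by (simp add: K_hom_def)

lemma K_hom_inv:
  assumes "K_hom \<phi>" "bij \<phi>"
  shows "K_hom (inv_into UNIV \<phi>)"
proof -
  have 1: "inv_into UNIV \<phi> (\<phi> F) = F" and 2: "\<phi> (inv_into UNIV \<phi> F) = F" for F
    using assms(2) by (simp_all add: bij_is_inj bij_is_surj surj_f_inv_f)
  show ?thesis
    unfolding K_hom_def
  proof (intro conjI allI)
    fix F G :: "'a ps3"
    show "inv_into UNIV \<phi> (F + G) = inv_into UNIV \<phi> F + inv_into UNIV \<phi> G"
      using 1[of "inv_into UNIV \<phi> F + inv_into UNIV \<phi> G"] by (simp add: K_hom_simps[OF assms(1)] 2)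
    show "inv_into UNIV \<phi> (F * G) = inv_into UNIV \<phi> F * inv_into UNIV \<phi> G"
      using 1[of "inv_into UNIV \<phi> F * inv_into UNIV \<phi> G"] by (simp add: K_hom_simps[OF assms(1)] 2)
    show "inv_into UNIV \<phi> (emb_K c) = emb_K c" for c
      using 1[of "emb_K c"] by (simp add: K_hom_simps[OF assms(1)])
  qed
qed

lemma K_algebra_automorphism_iff: "K_algebra_automorphism \<phi> \<longleftrightarrow> K_hom \<phi> \<and> bij \<phi>"
proof
  assume "K_algebra_automorphism \<phi>"
  then show "K_hom \<phi> \<and> bij \<phi>"
    by (simp add: K_algebra_automorphism_def K_hom_def ring_iso_def ring_hom_def type_ring_def)
next
  assume *: "K_hom \<phi> \<and> bij \<phi>"
  then show "K_algebra_automorphism \<phi>"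
    by (simp add: K_algebra_automorphism_def ring_iso_def ring_hom_def type_ring_def K_hom_simps)
qed

lemma K_algebra_automorphism_comp:
  "K_algebra_automorphism \<phi> \<Longrightarrow> K_algebra_automorphism \<psi> \<Longrightarrow> K_algebra_automorphism (\<phi> \<circ> \<psi>)"
  by (simp add: K_algebra_automorphism_iff K_hom_comp bij_comp)

lemma K_algebra_automorphism_inv:
  "K_algebra_automorphism \<phi> \<Longrightarrow> K_algebra_automorphism (inv_into UNIV \<phi>)"
  by (simp add: K_algebra_automorphism_iff K_hom_inv bij_imp_bij_inv)

lemma ps3_decomp:
  obtains A B C where "F = emb_K (F $ 0 $ 0 $ 0) + var_x * A + var_y * B + var_z * C"
proof -
  have "F - emb_K (F $ 0 $ 0 $ 0) \<in> \<MM> (Suc 0)"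
    by (auto simp: fil_def)
  then obtain A B C where "F - emb_K (F $ 0 $ 0 $ 0) = var_x * A + var_y * B + var_z * C"
    by (metis MM_Suc_decomp)
  then show ?thesis
    by (intro that[of A B C]) (simp add: algebra_simps)
qed

text \<open>Continuity is automatic: splitting off one variable writes \<open>\<phi> F - F\<close>
  as a combination of \<open>x\<close>, \<open>y\<close>, \<open>z\<close> with coefficients of the
  same shape, so it lies in every power of the maximal ideal.\<close>

lemma K_hom_eq_id:
  assumes "K_hom \<phi>" "\<phi> var_x = var_x" "\<phi> var_y = var_y" "\<phi> var_z = var_z"
  shows "\<phi> F = F"
proof (rule ps3_eqI_fil)
  show "\<phi> F - F \<in> \<MM> N" for N
  proof (induction N arbitrary: F)
    case (Suc N)
    obtain A B C where F: "F = emb_K (F $ 0 $ 0 $ 0) + var_x * A + var_y * B + var_z * C"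
      by (rule ps3_decomp)
    have "\<phi> F - F = var_x * (\<phi> A - A) + var_y * (\<phi> B - B) + var_z * (\<phi> C - C)"
      by (subst (1 2) F) (simp add: K_hom_simps[OF assms(1)] assms(2-) algebra_simps)
    also have "\<dots> \<in> \<MM> (Suc N)"
      using fil_mult[OF var_x_MM Suc.IH] fil_mult[OF var_y_MM Suc.IH] fil_mult[OF var_z_MM Suc.IH]
      by (auto intro!: fil_add)
    finally show ?case .
  qed simp
qed

text \<open>\<open>\<phi>\<close> acts as the identity on the associated graded ring, because
  \<open>\<phi> v * \<phi> G - v * G\<close> is
  \<open>(\<phi> v - v) * \<phi> G + v * (\<phi> G - G)\<close> and both summands gain a
  degree.\<close>

lemma K_hom_near_id:
  assumes \<phi>: "K_hom \<phi>" and "\<phi> var_x - var_x \<in> \<MM> 2" "\<phi> var_y - var_y \<in> \<MM> 2" "\<phi> var_z - var_z \<in> \<MM> 2"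
    and "F \<in> \<MM> N"
  shows "\<phi> F - F \<in> \<MM> (Suc N)"
  using assms(5)
proof (induction N arbitrary: F)
  case 0
  have 1: "\<phi> var_x \<in> \<MM> (Suc 0)" "\<phi> var_y \<in> \<MM> (Suc 0)" "\<phi> var_z \<in> \<MM> (Suc 0)"
    using assms(2-4)[THEN fil_mono, THEN fil_cong, of "Suc 0"] by simp_all
  obtain A B C where F: "F = emb_K (F $ 0 $ 0 $ 0) + var_x * A + var_y * B + var_z * C"
    by (rule ps3_decomp)
  have "\<phi> F - F = (\<phi> var_x * \<phi> A - var_x * A) + (\<phi> var_y * \<phi> B - var_y * B) + (\<phi> var_z * \<phi> C - var_z * C)"
    by (subst (1 2) F) (simp add: K_hom_simps[OF \<phi>] algebra_simps)
  also have "\<dots> \<in> \<MM> (Suc 0)"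
    by (intro fil_add fil_diff fil_mult_right 1 var_x_MM var_y_MM var_z_MM)
  finally show ?case .
next
  case (Suc N)
  obtain A B C where F: "F = var_x * A + var_y * B + var_z * C" and
    ABC: "A \<in> \<MM> N" "B \<in> \<MM> N" "C \<in> \<MM> N"
    using MM_Suc_decomp[OF Suc.prems] by metis
  have ph: "\<phi> v * \<phi> G - v * G \<in> \<MM> (Suc (Suc N))"
    if "\<phi> v - v \<in> \<MM> 2" "v \<in> \<MM> (Suc 0)" "G \<in> \<MM> N" for v G
  proof -
    have "\<phi> G \<in> \<MM> N"
      using fil_cong[OF fil_mono[OF Suc.IH[OF that(3)]], of N] that(3) by simp
    then have "(\<phi> v - v) * \<phi> G \<in> \<MM> (2 + N)"
      using that(1) by (intro fil_mult)
    moreover have "v * (\<phi> G - G) \<in> \<MM> (Suc 0 + Suc N)"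
      by (intro fil_mult that(2) Suc.IH that(3))
    ultimately have "(\<phi> v - v) * \<phi> G + v * (\<phi> G - G) \<in> \<MM> (Suc (Suc N))"
      by (intro fil_add) auto
    then show ?thesis by (simp add: algebra_simps)
  qed
  have "\<phi> F - F = (\<phi> var_x * \<phi> A - var_x * A) + (\<phi> var_y * \<phi> B - var_y * B) + (\<phi> var_z * \<phi> C - var_z * C)"
    by (simp add: F K_hom_simps[OF \<phi>] algebra_simps)
  also have "\<dots> \<in> \<MM> (Suc (Suc N))"
    by (intro fil_add ph assms ABC var_x_MM var_y_MM var_z_MM)
  finally show ?case .
qed

text \<open>An element of the kernel gains one degree after another and so vanishes; a preimage of
  \<open>G\<close> is a fixed point of the contraction
  \<open>F \<mapsto> G - (\<phi> F - F)\<close>.\<close>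

lemma near_id_automorphism:
  assumes \<phi>: "K_hom \<phi>" and n: "\<phi> var_x - var_x \<in> \<MM> 2" "\<phi> var_y - var_y \<in> \<MM> 2" "\<phi> var_z - var_z \<in> \<MM> 2"
  shows "K_algebra_automorphism \<phi>"
proof -
  note near = K_hom_near_id[OF \<phi> n]
  have "inj \<phi>"
  proof (rule injI)
    fix F G assume "\<phi> F = \<phi> G"
    then have 0: "\<phi> (F - G) = 0" by (simp add: K_hom_simps[OF \<phi>])
    have "F - G \<in> \<MM> N" for N
    proof (induction N)
      case (Suc N)
      have "- (F - G) \<in> \<MM> (Suc N)"
        using near[OF Suc] by (simp only: 0 diff_0)
      then show ?case by (simp only: fil_uminus_iff)
    qed simp
    then show "F = G" by (rule ps3_eqI_fil)
  qed
  moreover have "surj \<phi>"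
  proof -
    have "\<exists>F. G = \<phi> F" for G
    proof -
      define T where "T F = G - (\<phi> F - F)" for F
      have "T F - T F' \<in> \<MM> (Suc N)" if "F - F' \<in> \<MM> N" for F F' N
      proof -
        have "T F - T F' = - (\<phi> (F - F') - (F - F'))"
          by (simp add: T_def K_hom_simps[OF \<phi>])
        then show ?thesis using near[OF that] by (simp only: fil_uminus_iff)
      qed
      then obtain F where "T F = F" by (rule contraction_fixpoint)
      then have "G = \<phi> F" by (simp add: T_def algebra_simps)
      then show ?thesis ..
    qed
    then show ?thesis by (simp add: surj_def)
  qed
  ultimately show ?thesis
    using \<phi> by (simp add: K_algebra_automorphism_iff bij_def)
qed

text \<open>For \<open>u\<close>, \<open>v\<close>, \<open>w\<close> without constant term,
  monomials of degree above \<open>a + b + c\<close> contribute nothing to this coefficient, so a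
  finite box of exponents gives the full substitution.\<close>

definition subst :: "'a::comm_ring_1 ps3 \<Rightarrow> 'a ps3 \<Rightarrow> 'a ps3 \<Rightarrow> 'a ps3 \<Rightarrow> 'a ps3" where
  "subst u v w F = Abs_fps (\<lambda>a. Abs_fps (\<lambda>b. Abs_fps (\<lambda>c.
     \<Sum>i\<le>a+b+c. \<Sum>j\<le>a+b+c. \<Sum>k\<le>a+b+c. F $ i $ j $ k * (u ^ i * v ^ j * w ^ k) $ a $ b $ c)))"

lemma box_sum:
  fixes g :: "nat \<Rightarrow> nat \<Rightarrow> nat \<Rightarrow> 'b::comm_monoid_add"
  assumes "\<And>i j k. d < i + j + k \<Longrightarrow> g i j k = 0" "d \<le> A" "d \<le> B" "d \<le> C"
  shows "(\<Sum>i\<le>A. \<Sum>j\<le>B. \<Sum>k\<le>C. g i j k) = (\<Sum>i\<le>d. \<Sum>j\<le>d. \<Sum>k\<le>d. g i j k)"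
proof -
  have "(\<Sum>k\<le>C. g i j k) = (\<Sum>k\<le>d. g i j k)" for i j
    using assms by (intro sum.mono_neutral_right) auto
  moreover have "(\<Sum>j\<le>B. \<Sum>k\<le>d. g i j k) = (\<Sum>j\<le>d. \<Sum>k\<le>d. g i j k)" for i
    using assms by (intro sum.mono_neutral_right) (auto intro!: sum.neutral)
  moreover have "(\<Sum>i\<le>A. \<Sum>j\<le>d. \<Sum>k\<le>d. g i j k) = (\<Sum>i\<le>d. \<Sum>j\<le>d. \<Sum>k\<le>d. g i j k)"
    using assms by (intro sum.mono_neutral_right) (auto intro!: sum.neutral)
  ultimately show ?thesis by simp
qed

context
  fixes u v w :: "'a::comm_ring_1 ps3"
  assumes uvw: "u \<in> \<MM> (Suc 0)" "v \<in> \<MM> (Suc 0)" "w \<in> \<MM> (Suc 0)"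
begin

lemma subst_monomial_MM: "u ^ i * v ^ j * w ^ k \<in> \<MM> (i + j + k)"
  using fil_mult[OF fil_mult[OF uvw(1,2)[THEN fil_power]] uvw(3)[THEN fil_power]] by simp

text \<open>Unequal sides are allowed because multiplying \<open>F\<close> by one variable lengthens
  the box in that direction only.\<close>

lemma subst_approx:
  assumes "N \<le> A" "N \<le> B" "N \<le> C"
  shows "subst u v w F - (\<Sum>i\<le>A. \<Sum>j\<le>B. \<Sum>k\<le>C. emb_K (F $ i $ j $ k) * (u ^ i * v ^ j * w ^ k)) \<in> \<MM> (Suc N)"
proof (rule MMI)
  fix a b c assume *: "a + b + c < Suc N"
  have "(\<Sum>i\<le>A. \<Sum>j\<le>B. \<Sum>k\<le>C. F $ i $ j $ k * (u ^ i * v ^ j * w ^ k) $ a $ b $ c) =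
    subst u v w F $ a $ b $ c"
    unfolding subst_def fps_nth_Abs_fps
    using * assms by (intro box_sum) (auto simp: MMD[OF subst_monomial_MM])
  then show "(subst u v w F - (\<Sum>i\<le>A. \<Sum>j\<le>B. \<Sum>k\<le>C.
      emb_K (F $ i $ j $ k) * (u ^ i * v ^ j * w ^ k))) $ a $ b $ c = 0"
    by (simp add: fps_sum_nth)
qed

lemma subst_add: "subst u v w (F + G) = subst u v w F + subst u v w G"
  by (simp add: ps3_eq_iff subst_def sum.distrib algebra_simps)

lemma subst_emb_K_mult: "subst u v w (emb_K c * F) = emb_K c * subst u v w F"
  by (simp add: ps3_eq_iff subst_def sum_distrib_left mult.assoc)

lemma subst_1: "subst u v w 1 = 1"
proof (rule ps3_eqI_fil)
  fix N
  have "(\<Sum>i\<le>N. \<Sum>j\<le>N. \<Sum>k\<le>N. emb_K ((1::'a ps3) $ i $ j $ k) * (u ^ i * v ^ j * w ^ k)) = 1"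
    by (subst box_sum[of 0]) (auto simp: emb_K_hom)
  then show "subst u v w 1 - 1 \<in> \<MM> N"
    using subst_approx[of N N N N 1] by (auto intro: fil_mono)
qed

lemma subst_var_x_mult: "subst u v w (var_x * F) = u * subst u v w F"
proof (rule ps3_eqI_fil)
  fix N
  let ?S = "\<Sum>i\<le>N. \<Sum>j\<le>N. \<Sum>k\<le>N. emb_K (F $ i $ j $ k) * (u ^ i * v ^ j * w ^ k)"
  have "(\<Sum>i\<le>Suc N. \<Sum>j\<le>N. \<Sum>k\<le>N. emb_K ((var_x * F) $ i $ j $ k) * (u ^ i * v ^ j * w ^ k)) = u * ?S"
    by (subst sum.atMost_Suc_shift) (simp add: sum_distrib_left emb_K_hom algebra_simps)
  then have "subst u v w (var_x * F) - u * ?S \<in> \<MM> (Suc N)"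
    using subst_approx[of N "Suc N" N N "var_x * F"] by simp
  moreover have "u * ?S - u * subst u v w F \<in> \<MM> (Suc N)"
    using fil_mult_left[OF fil_diff_commute[OF subst_approx[of N N N N F]], of u]
    by (simp add: right_diff_distrib)
  ultimately show "subst u v w (var_x * F) - u * subst u v w F \<in> \<MM> N"
    by (meson fil_mono fil_trans le_SucI order_refl)
qed

lemma subst_var_y_mult: "subst u v w (var_y * F) = v * subst u v w F"
proof (rule ps3_eqI_fil)
  fix N
  let ?S = "\<Sum>i\<le>N. \<Sum>j\<le>N. \<Sum>k\<le>N. emb_K (F $ i $ j $ k) * (u ^ i * v ^ j * w ^ k)"
  have "(\<Sum>j\<le>Suc N. \<Sum>k\<le>N. emb_K ((var_y * F) $ i $ j $ k) * (u ^ i * v ^ j * w ^ k)) =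
      (\<Sum>j\<le>N. \<Sum>k\<le>N. v * (emb_K (F $ i $ j $ k) * (u ^ i * v ^ j * w ^ k)))" for i
    by (subst sum.atMost_Suc_shift) (simp add: emb_K_hom algebra_simps)
  then have "(\<Sum>i\<le>N. \<Sum>j\<le>Suc N. \<Sum>k\<le>N. emb_K ((var_y * F) $ i $ j $ k) * (u ^ i * v ^ j * w ^ k)) = v * ?S"
    by (simp only: sum_distrib_left)
  then have "subst u v w (var_y * F) - v * ?S \<in> \<MM> (Suc N)"
    using subst_approx[of N N "Suc N" N "var_y * F"] by simp
  moreover have "v * ?S - v * subst u v w F \<in> \<MM> (Suc N)"
    using fil_mult_left[OF fil_diff_commute[OF subst_approx[of N N N N F]], of v]
    by (simp add: right_diff_distrib)
  ultimately show "subst u v w (var_y * F) - v * subst u v w F \<in> \<MM> N"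
    by (meson fil_mono fil_trans le_SucI order_refl)
qed

lemma subst_var_z_mult: "subst u v w (var_z * F) = w * subst u v w F"
proof (rule ps3_eqI_fil)
  fix N
  let ?S = "\<Sum>i\<le>N. \<Sum>j\<le>N. \<Sum>k\<le>N. emb_K (F $ i $ j $ k) * (u ^ i * v ^ j * w ^ k)"
  have "(\<Sum>k\<le>Suc N. emb_K ((var_z * F) $ i $ j $ k) * (u ^ i * v ^ j * w ^ k)) =
      (\<Sum>k\<le>N. w * (emb_K (F $ i $ j $ k) * (u ^ i * v ^ j * w ^ k)))" for i j
    by (subst sum.atMost_Suc_shift) (simp add: emb_K_hom algebra_simps)
  then have "(\<Sum>i\<le>N. \<Sum>j\<le>N. \<Sum>k\<le>Suc N. emb_K ((var_z * F) $ i $ j $ k) * (u ^ i * v ^ j * w ^ k)) = w * ?S"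
    by (simp only: sum_distrib_left)
  then have "subst u v w (var_z * F) - w * ?S \<in> \<MM> (Suc N)"
    using subst_approx[of N N N "Suc N" "var_z * F"] by simp
  moreover have "w * ?S - w * subst u v w F \<in> \<MM> (Suc N)"
    using fil_mult_left[OF fil_diff_commute[OF subst_approx[of N N N N F]], of w]
    by (simp add: right_diff_distrib)
  ultimately show "subst u v w (var_z * F) - w * subst u v w F \<in> \<MM> N"
    by (meson fil_mono fil_trans le_SucI order_refl)
qed

lemma subst_emb_K: "subst u v w (emb_K c) = emb_K c"
  using subst_emb_K_mult[of c 1] by (simp add: subst_1)

text \<open>No Cauchy product has to be rearranged: the defect of multiplicativity at
  \<open>F\<close> is a combination of \<open>u\<close>, \<open>v\<close>, \<open>w\<close> with the
  defects of the parts of \<open>F\<close> as coefficients, hence lies in every power of the maximal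
  ideal.\<close>

lemma subst_mult: "subst u v w (F * G) = subst u v w F * subst u v w G"
proof (rule ps3_eqI_fil)
  show "subst u v w (F * G) - subst u v w F * subst u v w G \<in> \<MM> N" for N
  proof (induction N arbitrary: F)
    case (Suc N)
    obtain A B C where F: "F = emb_K (F $ 0 $ 0 $ 0) + var_x * A + var_y * B + var_z * C"
      by (rule ps3_decomp)
    let ?d = "\<lambda>A. subst u v w (A * G) - subst u v w A * subst u v w G"
    have "?d F = u * ?d A + v * ?d B + w * ?d C"
      by (subst (1 2) F) (simp add: subst_add subst_emb_K subst_emb_K_mult subst_var_x_mult
          subst_var_y_mult subst_var_z_mult distrib_right mult.assoc, simp add: algebra_simps)
    also have "\<dots> \<in> \<MM> (Suc N)"
      using fil_mult[OF uvw(1) Suc.IH] fil_mult[OF uvw(2) Suc.IH] fil_mult[OF uvw(3) Suc.IH]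
      by (auto intro!: fil_add)
    finally show ?case .
  qed simp
qed

lemma K_hom_subst: "K_hom (subst u v w)"
  by (simp add: K_hom_def subst_add subst_mult subst_emb_K)

lemma subst_vars: "subst u v w var_x = u" "subst u v w var_y = v" "subst u v w var_z = w"
  using subst_var_x_mult[of 1] subst_var_y_mult[of 1] subst_var_z_mult[of 1] by (simp_all add: subst_1)

end

lemma K_hom_emb_yz:
  assumes \<phi>: "K_hom \<phi>" and "\<phi> var_y = var_y" "\<phi> var_z = var_z"
  shows "\<phi> (emb_yz A) = emb_yz A"
proof -
  have "\<phi> F - F \<in> \<MM> N" if "F \<in> range emb_yz" for F N
    using that
  proof (induction N arbitrary: F)
    case (Suc N)
    then obtain A where F: "F = emb_yz A" by auto
    have "F = emb_K (A $ 0 $ 0) + var_y * emb_yz (fps_shift 1 A) + var_z * emb_z (fps_shift 1 (A $ 0))"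
      by (auto simp: F ps3_eq_iff fps_X_mult_nth)
    then obtain B C where F: "F = emb_K (A $ 0 $ 0) + var_y * B + var_z * C"
      and BC: "B \<in> range emb_yz" "C \<in> range emb_yz"
      by (metis emb_z_eq_emb_yz rangeI)
    have "\<phi> F - F = var_y * (\<phi> B - B) + var_z * (\<phi> C - C)"
      by (subst (1 2) F) (simp add: K_hom_simps[OF \<phi>] assms(2-) algebra_simps)
    also have "\<dots> \<in> \<MM> (Suc N)"
      using fil_mult[OF var_y_MM Suc.IH[OF BC(1)]] fil_mult[OF var_z_MM Suc.IH[OF BC(2)]]
      by (auto intro!: fil_add)
    finally show ?case .
  qed simp
  then show ?thesis
    by (intro ps3_eqI_fil[of _ _ "Suc 0"]) auto
qed

lemma shift_x_automorphism:
  assumes "emb_yz H \<in> \<MM> 2"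
  obtains \<phi> where "K_algebra_automorphism \<phi>" "\<phi> var_x = var_x + emb_yz H"
    "\<And>A. \<phi> (emb_yz A) = emb_yz A" "\<And>N F. F \<in> \<MM> N \<Longrightarrow> \<phi> F - F \<in> \<MM> (Suc N)"
proof -
  let ?u = "var_x + emb_yz H"
  have u: "?u \<in> \<MM> (Suc 0)"
    using assms by (auto intro!: fil_add intro: fil_mono)
  note h = K_hom_subst[OF u var_y_MM var_z_MM] and v = subst_vars[OF u var_y_MM var_z_MM]
  show ?thesis
  proof
    show "K_algebra_automorphism (subst ?u var_y var_z)"
      using h by (rule near_id_automorphism) (simp_all add: v assms)
    show "subst ?u var_y var_z var_x = ?u" by (rule v)
    show "subst ?u var_y var_z (emb_yz A) = emb_yz A" for A
      using h v(2,3) by (rule K_hom_emb_yz)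
    show "subst ?u var_y var_z F - F \<in> \<MM> (Suc N)" if "F \<in> \<MM> N" for N F
      using h _ _ _ that by (rule K_hom_near_id) (simp_all add: v assms)
  qed
qed

section \<open>Linear changes of coordinates\<close>

definition lin :: "'a::comm_ring_1 \<Rightarrow> 'a \<Rightarrow> 'a \<Rightarrow> 'a ps3" where
  "lin p q r = emb_K p * var_x + emb_K q * var_y + emb_K r * var_z"

lemma lin_MM [simp]: "lin p q r \<in> \<MM> (Suc 0)"
  by (simp add: lin_def fil_add fil_mult_left)

lemma lin_linear: "emb_K c * lin p q r = lin (c * p) (c * q) (c * r)"
  "lin p q r + lin p' q' r' = lin (p + p') (q + q') (r + r')"
  by (simp_all add: lin_def emb_K_hom algebra_simps)

lemma linear_automorphism:
  fixes a1 a2 a3 b1 b2 b3 c1 c2 c3 :: "'a::field"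
  assumes "a1 * (b2 * c3 - b3 * c2) - a2 * (b1 * c3 - b3 * c1) + a3 * (b1 * c2 - b2 * c1) \<noteq> 0" (is "?d \<noteq> 0")
  obtains \<phi> where "K_algebra_automorphism \<phi>" "\<phi> var_x = lin a1 a2 a3" "\<phi> var_y = lin b1 b2 b3"
    "\<phi> var_z = lin c1 c2 c3"
proof -
  define i where "i = inverse ?d"
  have i: "?d * i = 1" using assms by (simp add: i_def)
  define \<phi> where "\<phi> = subst (lin a1 a2 a3) (lin b1 b2 b3) (lin c1 c2 c3)"
  \<comment> \<open>\<open>u\<close>, \<open>v\<close>, \<open>w\<close> are the rows of the
    adjugate matrix divided by the determinant.\<close>
  define u where "u = lin (i * (b2 * c3 - b3 * c2)) (i * (a3 * c2 - a2 * c3)) (i * (a2 * b3 - a3 * b2))"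
  define v where "v = lin (i * (b3 * c1 - b1 * c3)) (i * (a1 * c3 - a3 * c1)) (i * (a3 * b1 - a1 * b3))"
  define w where "w = lin (i * (b1 * c2 - b2 * c1)) (i * (a2 * c1 - a1 * c2)) (i * (a1 * b2 - a2 * b1))"
  define \<psi> where "\<psi> = subst u v w"
  have uvw: "u \<in> \<MM> (Suc 0)" "v \<in> \<MM> (Suc 0)" "w \<in> \<MM> (Suc 0)"
    by (simp_all add: u_def v_def w_def)
  have h: "K_hom \<phi>" "K_hom \<psi>"
    using K_hom_subst[OF lin_MM lin_MM lin_MM] K_hom_subst[OF uvw] by (simp_all add: \<phi>_def \<psi>_def)
  have p: "\<phi> var_x = lin a1 a2 a3" "\<phi> var_y = lin b1 b2 b3" "\<phi> var_z = lin c1 c2 c3"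
    by (simp_all add: \<phi>_def subst_vars)
  have q: "\<psi> var_x = u" "\<psi> var_y = v" "\<psi> var_z = w"
    by (simp_all add: \<psi>_def subst_vars uvw)
  have l: "\<phi> (lin r s t) = emb_K r * \<phi> var_x + emb_K s * \<phi> var_y + emb_K t * \<phi> var_z" 
    "\<psi> (lin r s t) = emb_K r * \<psi> var_x + emb_K s * \<psi> var_y + emb_K t * \<psi> var_z" for r s t
    by (simp_all add: lin_def K_hom_simps[OF h(1)] K_hom_simps[OF h(2)])
  \<comment> \<open>With 1 written as \<open>?d * i\<close>, the comparisons of coefficients below
    are polynomial identities.\<close>
  have e: "var_x = lin (?d * i) 0 0" "var_y = lin 0 (?d * i) 0" "var_z = lin 0 0 (?d * i)"
    unfolding i by (simp_all add: lin_def emb_K_hom)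
  have cong: "lin r s t = lin r' s' t'" if "r = r'" "s = s'" "t = t'" for r s t r' s' t' :: 'a
    using that by simp
  have "(\<phi> \<circ> \<psi>) var_x = var_x" "(\<phi> \<circ> \<psi>) var_y = var_y" "(\<phi> \<circ> \<psi>) var_z = var_z"
    unfolding o_apply q u_def v_def w_def l p lin_linear unfolding e
    by (rule cong; simp add: algebra_simps)+
  then have 1: "\<phi> (\<psi> F) = F" for F
    using K_hom_eq_id[OF K_hom_comp[OF h]] by simp
  have "(\<psi> \<circ> \<phi>) var_x = var_x" "(\<psi> \<circ> \<phi>) var_y = var_y" "(\<psi> \<circ> \<phi>) var_z = var_z"
    unfolding o_apply p l q u_def v_def w_def lin_linear unfolding e
    by (rule cong; simp add: algebra_simps)+
  then have 2: "\<psi> (\<phi> F) = F" for F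
    using K_hom_eq_id[OF K_hom_comp[OF h(2,1)]] by simp
  have "bij \<phi>"
    using 1 2 by (metis bijI')
  then show ?thesis
    using h p by (intro that[of \<phi>]) (simp_all add: K_algebra_automorphism_iff)
qed

section \<open>The Hilbert function as a dimension\<close>

lemma type_ring_simps [simp]:
  "carrier type_ring = UNIV" "mult type_ring = (*)" "one type_ring = 1" "zero type_ring = 0"
  "add type_ring = (+)"
  by (simp_all add: type_ring_def)

lemma ring_type_ring: "ring (type_ring :: 'b::comm_ring_1 ring)"
  using cring_type_ring by (rule cring.axioms)

lemma ideal_type_ring_iff:
  "ideal J (type_ring :: 'b::comm_ring_1 ring) \<longleftrightarrow>
     0 \<in> J \<and> (\<forall>a\<in>J. \<forall>b\<in>J. a + b \<in> J) \<and> (\<forall>a\<in>J. \<forall>r. r * a \<in> J)" (is "_ \<longleftrightarrow> ?r")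
proof
  assume "ideal J (type_ring :: 'b ring)"
  then interpret ideal J "type_ring :: 'b ring" .
  show ?r
    using additive_subgroup.a_closed[OF is_additive_subgroup] I_l_closed
      additive_subgroup.zero_closed[OF is_additive_subgroup] by simp
next
  assume *: ?r
  interpret cring "type_ring :: 'b ring" by (rule cring_type_ring)
  have "- a \<in> J" if "a \<in> J" for a
    using * that by (metis mult_minus1)
  moreover have "\<ominus>\<^bsub>type_ring\<^esub> a = - a" for a :: 'b
    by (rule minus_equality) simp_all
  ultimately have "subgroup J (add_monoid (type_ring :: 'b ring))"
    using * by (intro add.subgroupI) (auto simp: a_inv_def[symmetric])
  then show "ideal J (type_ring :: 'b ring)"
    using * by (intro idealI ring_type_ring) (auto simp: mult.commute)
qed

lemma ideal_gen_ideal: "ideal (ideal_gen S) (type_ring :: 'b::comm_ring_1 ring)"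
  by (rule ring.genideal_ideal[OF ring_type_ring]) simp

lemma ideal_gen_minimal: "ideal J type_ring \<Longrightarrow> S \<subseteq> J \<Longrightarrow> ideal_gen S \<subseteq> J"
  by (rule ring.genideal_minimal[OF ring_type_ring])

lemma ideal_gen_superset: "S \<subseteq> ideal_gen S"
  by (rule ring.genideal_self[OF ring_type_ring]) simp

lemma ideal_gen_pair: "ideal_gen {f, g} = {u * f + v * g | u v. True}"
proof
  let ?J = "{u * f + v * g | u v. True}"
  have "ideal ?J type_ring"
    unfolding ideal_type_ring_iff
  proof (intro conjI ballI allI)
    show "0 \<in> ?J"
      by (intro CollectI exI[of _ 0]) simp
    show "a + b \<in> ?J" if ab: "a \<in> ?J" "b \<in> ?J" for a b
    proof -
      obtain u v u' v' where "a = u * f + v * g" "b = u' * f + v' * g"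
        using ab by blast
      then have "a + b = (u + u') * f + (v + v') * g"
        by (simp add: algebra_simps)
      then show ?thesis by blast
    qed
    show "r * a \<in> ?J" if a: "a \<in> ?J" for a r
    proof -
      obtain u v where "a = u * f + v * g"
        using a by blast
      then have "r * a = (r * u) * f + (r * v) * g"
        by (simp add: algebra_simps)
      then show ?thesis by blast
    qed
  qed
  moreover have "f = 1 * f + 0 * g" "g = 0 * f + 1 * g"
    by simp_all
  then have "{f, g} \<subseteq> ?J" by blast
  ultimately show "ideal_gen {f, g} \<subseteq> ?J"
    by (rule ideal_gen_minimal)
  show "?J \<subseteq> ideal_gen {f, g}"
    using ideal_gen_ideal[of "{f, g}"] ideal_gen_superset[of "{f, g}"] by (auto simp: ideal_type_ring_iff)
qed

lemma ideal_gen_single: "ideal_gen {f} = {u * f | u. True}"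
proof -
  have "ideal_gen {f} = {u * f + v * f | u v. True}"
    using ideal_gen_pair[of f f] by simp
  also have "\<dots> = {u * f | u. True}"
    by (auto simp flip: distrib_right) (metis add.right_neutral)
  finally show ?thesis .
qed

lemma MM_ideal: "ideal (\<MM> N) type_ring"
  by (auto simp: ideal_type_ring_iff intro: fil_add fil_mult_left)

lemma ideal_gen_vars: "ideal_gen {var_x, var_y, var_z} = (\<MM> (Suc 0) :: 'a::comm_ring_1 ps3 set)"
proof
  show "ideal_gen {var_x, var_y, var_z} \<subseteq> \<MM> (Suc 0)"
    by (intro ideal_gen_minimal MM_ideal) simp
  show "(\<MM> (Suc 0) :: 'a ps3 set) \<subseteq> ideal_gen {var_x, var_y, var_z}"
  proof
    fix F :: "'a ps3" assume "F \<in> \<MM> (Suc 0)"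
    then obtain A B C where "F = A * var_x + B * var_y + C * var_z"
      using MM_Suc_decomp by (metis mult.commute)
    then show "F \<in> ideal_gen {var_x, var_y, var_z}"
      using ideal_gen_ideal[of "{var_x, var_y, var_z :: 'a ps3}"]
        ideal_gen_superset[of "{var_x, var_y, var_z :: 'a ps3}"]
      by (simp add: ideal_type_ring_iff)
  qed
qed

primrec lspan :: "'a::comm_ring_1 ps3 list \<Rightarrow> 'a ps3 set" where
  "lspan [] = {0}"
| "lspan (m # ms) = {emb_K c * m + G | c G. G \<in> lspan ms}"

text \<open>The recursion mirrors the dimension of HOL-Algebra, where a space grows by a line
  through a vector outside it. Over a field the coefficient of the new vector may be taken to be
  1.\<close>

primrec lindep_mod :: "'a::comm_ring_1 ps3 set \<Rightarrow> 'a ps3 list \<Rightarrow> bool" where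
  "lindep_mod N [] \<longleftrightarrow> True"
| "lindep_mod N (m # ms) \<longleftrightarrow> lindep_mod N ms \<and> (\<forall>G\<in>lspan ms. m - G \<notin> N)"

text \<open>For an ideal \<open>I\<close> this is the sum of \<open>I\<close> and the
  \<open>N\<close>-th power of the maximal ideal, that is, the kernel of the map from
  \<open>R\<close> to the quotient of \<open>A\<close> by the \<open>N\<close>-th power of its
  maximal ideal.\<close>

definition ideal_mod :: "'a::comm_ring_1 ps3 set \<Rightarrow> nat \<Rightarrow> 'a ps3 set" where
  "ideal_mod I N = {F. \<exists>G\<in>I. F - G \<in> \<MM> N}"

context
  fixes I :: "'a::field ps3 set"
  assumes I: "ideal I type_ring"
begin

abbreviation (input) coset where "coset F \<equiv> I +>\<^bsub>type_ring\<^esub> F"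

lemma coset_hom:
  "coset (F + G) = coset F \<oplus>\<^bsub>quot_ring I\<^esub> coset G"
  "coset (F * G) = coset F \<otimes>\<^bsub>quot_ring I\<^esub> coset G"
  "coset 1 = \<one>\<^bsub>quot_ring I\<^esub>"
  using ring_hom_memE[OF ideal.rcos_ring_hom[OF I]] by (simp_all add: quot_ring_def)

lemma carrier_quot_ring: "carrier (quot_ring I) = range coset"
  by (auto simp: quot_ring_def FactRing_def A_RCOSETS_def')

text \<open>A series of order at least \<open>t + 1\<close> is a combination of \<open>x\<close>,
  \<open>y\<close>, \<open>z\<close> with coefficients of order at least \<open>t\<close>; so the
  order filtration consists of the powers of the maximal ideal, and this passes to
  \<open>A\<close>.\<close>

lemma quot_maximal_pow_eq: "quot_maximal_pow I t = coset ` \<MM> t"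
proof (induction t)
  case 0
  then show ?case
    by (simp add: quot_maximal_pow_def ideals_set_def nat_pow_def carrier_quot_ring)
next
  case (Suc t)
  have "quot_maximal_pow I (Suc t) = ideal_prod (quot_ring I) (coset ` \<MM> t) (coset ` \<MM> (Suc 0))"
    using Suc by (simp add: quot_maximal_pow_def ideals_set_def nat_pow_def quot_maximal_def ideal_gen_vars)
  also have "\<dots> = coset ` \<MM> (Suc t)"
  proof
    show "ideal_prod (quot_ring I) (coset ` \<MM> t) (coset ` \<MM> (Suc 0)) \<subseteq> coset ` \<MM> (Suc t)"
    proof
      fix X assume "X \<in> ideal_prod (quot_ring I) (coset ` \<MM> t) (coset ` \<MM> (Suc 0))"
      then show "X \<in> coset ` \<MM> (Suc t)"
      proof induction
        case (prod i j)
        then obtain F G where "i = coset F" "j = coset G" "F \<in> \<MM> t" "G \<in> \<MM> (Suc 0)" by auto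
        then show ?case
          using fil_mult[of F _ t G "Suc 0"] by (auto simp flip: coset_hom)
      next
        case (sum s1 s2)
        then show ?case
          by (auto simp flip: coset_hom intro: fil_add)
      qed
    qed
    show "coset ` \<MM> (Suc t) \<subseteq> ideal_prod (quot_ring I) (coset ` \<MM> t) (coset ` \<MM> (Suc 0))"
    proof
      fix X assume "X \<in> coset ` \<MM> (Suc t)"
      then obtain F where X: "X = coset F" "F \<in> \<MM> (Suc t)" by auto
      then obtain A B C where F: "F = A * var_x + B * var_y + C * var_z" "A \<in> \<MM> t" "B \<in> \<MM> t" "C \<in> \<MM> t"
        using MM_Suc_decomp by (metis mult.commute)
      show "X \<in> ideal_prod (quot_ring I) (coset ` \<MM> t) (coset ` \<MM> (Suc 0))"
        unfolding X F(1) coset_hom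
        by (intro ideal_prod.intros imageI F var_x_MM var_y_MM var_z_MM)
    qed
  qed
  finally show ?case .
qed

lemma coset_eq_iff: "coset F = coset G \<longleftrightarrow> F - G \<in> I"
proof -
  interpret cring "type_ring :: 'a ps3 ring" by (rule cring_type_ring)
  have "\<ominus>\<^bsub>type_ring\<^esub> G = - G"
    by (rule minus_equality) simp_all
  then have "F \<ominus>\<^bsub>type_ring\<^esub> G = F - G"
    by (simp add: a_minus_def)
  then show ?thesis
    using quotient_eq_iff_same_a_r_cos[OF I, of F G] by simp
qed

lemma dimension_quotient:
  assumes "ring B"
    and \<pi>: "\<pi> \<in> ring_hom type_ring B" "\<And>F. \<pi> F = \<zero>\<^bsub>B\<^esub> \<longleftrightarrow> F \<in> J"
    and ms: "lindep_mod J ms"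
  shows "ring.dimension B (length ms) (range (\<lambda>c. \<pi> (emb_K c))) (\<pi> ` lspan ms)"
  using ms
proof (induction ms)
  case Nil
  have "\<pi> 0 = \<zero>\<^bsub>B\<^esub>"
    using ring_hom_zero[OF \<pi>(1) ring_type_ring assms(1)] by simp
  then show ?case
    using ring.zero_dim[OF assms(1)] by simp
next
  case (Cons m ms)
  note hom = ring_hom_memE[OF \<pi>(1), simplified]
  interpret B: ring B by fact
  have diff: "\<pi> F = \<pi> G \<Longrightarrow> F - G \<in> J" for F G
  proof -
    assume *: "\<pi> F = \<pi> G"
    have "\<pi> (F - G) \<oplus>\<^bsub>B\<^esub> \<pi> G = \<zero>\<^bsub>B\<^esub> \<oplus>\<^bsub>B\<^esub> \<pi> G"
      using * hom(1) by (simp flip: hom(3))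
    then have "\<pi> (F - G) = \<zero>\<^bsub>B\<^esub>"
      using hom(1) using B.add.right_cancel[of "\<pi> G" "\<pi> (F - G)" "\<zero>\<^bsub>B\<^esub>"] by simp
    then show ?thesis by (simp add: \<pi>(2))
  qed
  have "\<pi> m \<notin> \<pi> ` lspan ms"
    using Cons.prems diff by auto
  moreover have "B.line_extension (range (\<lambda>c. \<pi> (emb_K c))) (\<pi> m) (\<pi> ` lspan ms) = \<pi> ` lspan (m # ms)"
  proof
    show "\<pi> ` lspan (m # ms) \<subseteq> B.line_extension (range (\<lambda>c. \<pi> (emb_K c))) (\<pi> m) (\<pi> ` lspan ms)"
    proof
      fix X assume "X \<in> \<pi> ` lspan (m # ms)"
      then obtain c G where "X = \<pi> (emb_K c) \<otimes>\<^bsub>B\<^esub> \<pi> m \<oplus>\<^bsub>B\<^esub> \<pi> G" "G \<in> lspan ms"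
        by (auto simp: hom)
      then show "X \<in> B.line_extension (range (\<lambda>c. \<pi> (emb_K c))) (\<pi> m) (\<pi> ` lspan ms)"
        unfolding B.line_extension_mem_iff by blast
    qed
    show "B.line_extension (range (\<lambda>c. \<pi> (emb_K c))) (\<pi> m) (\<pi> ` lspan ms) \<subseteq> \<pi> ` lspan (m # ms)"
    proof
      fix X assume "X \<in> B.line_extension (range (\<lambda>c. \<pi> (emb_K c))) (\<pi> m) (\<pi> ` lspan ms)"
      then obtain c G where "X = \<pi> (emb_K c * m + G)" "G \<in> lspan ms"
        by (auto simp: B.line_extension_mem_iff hom)
      then show "X \<in> \<pi> ` lspan (m # ms)" by auto
    qed
  qed
  moreover have "B.dimension (length ms) (range (\<lambda>c. \<pi> (emb_K c))) (\<pi> ` lspan ms)"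
    using Cons by simp
  ultimately show ?case
    using B.Suc_dim[of "\<pi> m" "\<pi> ` lspan ms" "length ms"] hom(1) by (metis length_Cons)
qed


text \<open>The iterated quotient in the definition of the Hilbert function is traded for one map
  \<open>\<pi>\<close> from \<open>R\<close> with kernel \<open>ideal_mod I (Suc t)\<close>;
  afterwards only congruences between series occur.\<close>

lemma hilbert_function_eq_length:
  assumes proper: "\<And>c. c \<noteq> 0 \<Longrightarrow> emb_K c \<notin> ideal_mod I (Suc t)"
    and ms: "set ms \<subseteq> \<MM> t" "lindep_mod (ideal_mod I (Suc t)) ms"
    and span: "\<And>F. F \<in> \<MM> t \<Longrightarrow> \<exists>G\<in>lspan ms. F - G \<in> ideal_mod I (Suc t)"
  shows "hilbert_function I t = length ms"
proof -
  let ?A = "quot_ring I" and ?N = "quot_maximal_pow I (Suc t)"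
  define B where "B = ?A Quot ?N"
  define \<pi> where "\<pi> F = ?N +>\<^bsub>?A\<^esub> coset F" for F
  have A: "ring ?A"
    unfolding quot_ring_def using I by (rule ideal.quotient_is_ring)
  have N: "ideal ?N ?A"
    unfolding quot_maximal_pow_eq unfolding quot_ring_def
    by (rule ring.ring_ideal_imp_quot_ideal[OF ring_type_ring I MM_ideal])
  have B: "ring B"
    unfolding B_def using N by (rule ideal.quotient_is_ring)
  have \<pi>: "\<pi> \<in> ring_hom type_ring B"
    using ring_hom_trans[OF ideal.rcos_ring_hom[OF I] ideal.rcos_ring_hom[OF N, unfolded quot_ring_def]]
    by (simp add: \<pi>_def[abs_def] B_def quot_ring_def o_def)
  note hom = ring_hom_memE[OF \<pi>, simplified]
  have ker: "\<pi> F = \<zero>\<^bsub>B\<^esub> \<longleftrightarrow> F \<in> ideal_mod I (Suc t)" for F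
  proof -
    have "\<pi> F = \<zero>\<^bsub>B\<^esub> \<longleftrightarrow> coset F \<in> ?N"
      unfolding \<pi>_def B_def
      by (metis (no_types, lifting) A FactRing_def N carrier_quot_ring ideal.rcos_const_imp_mem rangeI
          ring.a_rcos_zero ring_record_simps(11))
    also have "\<dots> \<longleftrightarrow> (\<exists>G\<in>\<MM> (Suc t). F - G \<in> I)"
      by (auto simp: quot_maximal_pow_eq coset_eq_iff image_iff)
    also have "\<dots> \<longleftrightarrow> F \<in> ideal_mod I (Suc t)"
      unfolding ideal_mod_def by (auto intro: bexI[of _ "F - _"])
    finally show ?thesis .
  qed
  have zero: "\<pi> 0 = \<zero>\<^bsub>B\<^esub>"
    using ring_hom_zero[OF \<pi> ring_type_ring B] by simp
  interpret B: ring B by fact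
  have "field (type_ring :: 'a ring)"
  proof (rule cring.cring_fieldI[OF cring_type_ring])
    show "Units (type_ring :: 'a ring) = carrier type_ring - {\<zero>\<^bsub>type_ring\<^esub>}"
      using right_inverse left_inverse by (auto simp: Units_def)
  qed
  then have F: "subfield UNIV (type_ring :: 'a ring)"
    using field.carrier_is_subfield by fastforce
  have "ring_hom_ring (type_ring :: 'a ring) B (\<lambda>c. \<pi> (emb_K c))"
    by (rule ring_hom_ringI2[OF ring_type_ring B]) (auto intro!: ring_hom_memI simp: hom emb_K_hom)
  then interpret h: ring_hom_ring "type_ring :: 'a ring" B "\<lambda>c. \<pi> (emb_K c)" .
  \<comment> \<open>Properness enters here: once 1 is nonzero in \<open>B\<close>, the image of
    \<open>K\<close> is a field and the dimension over it is well defined.\<close>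
  have "\<one>\<^bsub>B\<^esub> \<noteq> \<zero>\<^bsub>B\<^esub>"
    using proper[of 1] ker[of 1] hom(4) by (simp add: emb_K_hom)
  then have K: "subfield (range (\<lambda>c. \<pi> (emb_K c))) B"
    using F by (intro h.img_is_subfield)
  have mod_eq: "\<pi> F = \<pi> G" if "F - G \<in> ideal_mod I (Suc t)" for F G
    using hom(3)[of "F - G" G] ker[of "F - G"] that hom(1) by simp
  have "lspan ms' \<subseteq> \<MM> t" if "set ms' \<subseteq> \<MM> t" for ms'
    using that by (induction ms') (auto intro!: fil_add fil_mult_left)
  then have "lspan ms \<subseteq> \<MM> t" using ms(1) .
  moreover have "\<pi> ` \<MM> t \<subseteq> \<pi> ` lspan ms"
  proof
    fix X assume "X \<in> \<pi> ` \<MM> t"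
    then obtain F where "X = \<pi> F" "F \<in> \<MM> t" by blast
    moreover obtain G where "G \<in> lspan ms" "F - G \<in> ideal_mod I (Suc t)"
      using span[OF \<open>F \<in> \<MM> t\<close>] by blast
    ultimately show "X \<in> \<pi> ` lspan ms"
      using mod_eq by blast
  qed
  ultimately have "\<pi> ` lspan ms = \<pi> ` \<MM> t" by blast
  then have "B.dimension (length ms) (range (\<lambda>c. \<pi> (emb_K c))) (\<pi> ` \<MM> t)"
    using dimension_quotient[OF B \<pi> ker ms(2)] by simp
  then have "B.dim (range (\<lambda>c. \<pi> (emb_K c))) (\<pi> ` \<MM> t) = length ms"
    using B.dimI[OF K] by (simp add: over_def)
  moreover have "(\<lambda>u. ?N +>\<^bsub>?A\<^esub> u) ` quot_maximal_pow I t = \<pi> ` \<MM> t"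
    by (auto simp: quot_maximal_pow_eq[of t] \<pi>_def)
  ultimately show ?thesis
    by (simp add: hilbert_function_def Let_def \<pi>_def[abs_def] B_def)
qed

end

section \<open>Monomial bases\<close>

definition monom3 :: "nat \<times> nat \<times> nat \<Rightarrow> 'a::comm_ring_1 ps3" where
  "monom3 = (\<lambda>(i, j, k). var_x ^ i * var_y ^ j * var_z ^ k)"

lemma var_z_power_nth [simp]: "(var_z ^ m) $ i = (if i = 0 then fps_const (fps_X ^ m) else 0)"
  by (simp add: var_z_def emb_z_def fps_const_power)

lemma monom3_nth [simp]:
  "(monom3 (i, j, k) :: 'a::comm_ring_1 ps3) $ a $ b $ c = (if a = i \<and> b = j \<and> c = k then 1 else 0)"
proof -
  have "(monom3 (i, j, k) :: 'a ps3) $ a = (if a = i then fps_X ^ j * fps_const (fps_X ^ k) else 0)"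
    unfolding monom3_def var_x_def var_y_def var_z_def emb_yz_def emb_z_def
    by (simp add: fps_X_power_mult_nth fps_const_power mult.assoc flip: fps_const_mult)
  then show ?thesis
    by (simp add: fps_X_power_mult_nth fps_X_power_nth)
qed

definition supp :: "'a::comm_ring_1 ps3 \<Rightarrow> (nat \<times> nat \<times> nat) set" where
  "supp F = {(i, j, k). F $ i $ j $ k \<noteq> 0}"

lemma supp_subset_iff: "supp F \<subseteq> E \<longleftrightarrow> (\<forall>i j k. (i, j, k) \<notin> E \<longrightarrow> F $ i $ j $ k = 0)"
  by (auto simp: supp_def)

definition degs :: "nat \<Rightarrow> (nat \<times> nat \<times> nat) set" where
  "degs t = {(i, j, k). i + j + k = t}"

lemma finite_degs [simp]: "finite (degs t)"
proof (rule finite_subset)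
  show "degs t \<subseteq> {..t} \<times> {..t} \<times> {..t}"
    by (auto simp: degs_def)
qed auto

lemma monom3_MM: "e \<in> degs t \<Longrightarrow> monom3 e \<in> \<MM> t"
  by (cases e) (auto simp: degs_def fil_def)

lemma ideal_mod_props:
  assumes "ideal I type_ring"
  shows "F \<in> ideal_mod I N \<Longrightarrow> G \<in> ideal_mod I N \<Longrightarrow> F + G \<in> ideal_mod I N"
    and "F \<in> ideal_mod I N \<Longrightarrow> H * F \<in> ideal_mod I N"
    and "F \<in> ideal_mod I N \<Longrightarrow> G \<in> ideal_mod I N \<Longrightarrow> F - G \<in> ideal_mod I N"
    and "F \<in> I \<Longrightarrow> F \<in> ideal_mod I N" and "F \<in> \<MM> N \<Longrightarrow> F \<in> ideal_mod I N"
proof -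
  note I = assms[unfolded ideal_type_ring_iff]
  show *: "F + G \<in> ideal_mod I N" if FG: "F \<in> ideal_mod I N" "G \<in> ideal_mod I N" for F G
  proof -
    obtain u v where "u \<in> I" "v \<in> I" "F - u \<in> \<MM> N" "G - v \<in> \<MM> N"
      using FG by (auto simp: ideal_mod_def)
    then have "u + v \<in> I" "(F + G) - (u + v) \<in> \<MM> N"
      using I fil_add[of "F - u" _ N "G - v"] by (auto simp: algebra_simps)
    then show ?thesis by (auto simp: ideal_mod_def)
  qed
  show m: "H * F \<in> ideal_mod I N" if F: "F \<in> ideal_mod I N" for F H
  proof -
    obtain u where "u \<in> I" "F - u \<in> \<MM> N"
      using F by (auto simp: ideal_mod_def)
    then have "H * u \<in> I" "H * F - H * u \<in> \<MM> N"
      using I fil_mult_left[of "F - u" _ N H] by (auto simp: algebra_simps)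
    then show ?thesis by (auto simp: ideal_mod_def)
  qed
  show "F - G \<in> ideal_mod I N" if "F \<in> ideal_mod I N" "G \<in> ideal_mod I N"
    using *[OF that(1) m[OF that(2), of "-1"]] by simp
  show "F \<in> ideal_mod I N" if "F \<in> I"
    using that by (auto simp: ideal_mod_def intro: bexI[of _ F])
  show "F \<in> ideal_mod I N" if "F \<in> \<MM> N"
    using that I by (auto simp: ideal_mod_def intro: bexI[of _ 0])
qed

text \<open>\<open>E\<close> is meant to consist of exponents of degree \<open>t\<close>. A series
  with support in \<open>E\<close> is then a linear combination of these monomials, and the
  condition says that they span the degree \<open>t\<close> part of the associated graded ring of
  \<open>A\<close>.\<close>

definition spans_mod :: "'a::comm_ring_1 ps3 set \<Rightarrow> nat \<Rightarrow> (nat \<times> nat \<times> nat) set \<Rightarrow> bool" where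
  "spans_mod I t E \<longleftrightarrow> (\<forall>F\<in>\<MM> t. \<exists>G. supp G \<subseteq> E \<and> F - G \<in> ideal_mod I (Suc t))"

definition indep_mod :: "'a::comm_ring_1 ps3 set \<Rightarrow> nat \<Rightarrow> (nat \<times> nat \<times> nat) set \<Rightarrow> bool" where
  "indep_mod I t E \<longleftrightarrow> (\<forall>F\<in>ideal_mod I (Suc t). supp F \<subseteq> E \<longrightarrow> F = 0)"

lemma lspan_monom3:
  assumes "finite E"
  obtains ms :: "'a::field ps3 list" where "set ms \<subseteq> monom3 ` E" "length ms = card E" "lspan ms = {G. supp G \<subseteq> E}"
    "indep_mod I t E \<longrightarrow> lindep_mod (ideal_mod I (Suc t)) ms"
proof -
  have "\<exists>ms :: 'a ps3 list. set ms \<subseteq> monom3 ` E \<and> length ms = card E \<and> lspan ms = {G. supp G \<subseteq> E} \<and>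
    (indep_mod I t E \<longrightarrow> lindep_mod (ideal_mod I (Suc t)) ms)"
    using assms
  proof induction
    case empty
    have "{0} = {G :: 'a ps3. supp G \<subseteq> {}}"
      by (auto simp: supp_def ps3_eq_iff)
    then show ?case
      by (intro exI[of _ "[]"]) simp
  next
    case (insert e E)
    obtain i j k where e: "e = (i, j, k)" by (cases e)
    obtain ms :: "'a ps3 list" where ms: "set ms \<subseteq> monom3 ` E" "length ms = card E" "lspan ms = {G. supp G \<subseteq> E}"
      "indep_mod I t E \<longrightarrow> lindep_mod (ideal_mod I (Suc t)) ms"
      using insert.IH by blast
    have "lspan (monom3 e # ms) = {G. supp G \<subseteq> insert e E}"
    proof (intro equalityI subsetI)
      fix F assume "F \<in> {G :: 'a ps3. supp G \<subseteq> insert e E}"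
      then have "F - emb_K (F $ i $ j $ k) * monom3 e \<in> lspan ms"
        by (auto simp: ms(3) supp_subset_iff e)
      then show "F \<in> lspan (monom3 e # ms)"
        by (auto intro!: exI[of _ "F $ i $ j $ k"] exI[of _ "F - emb_K (F $ i $ j $ k) * monom3 e"])
    qed (auto simp: ms(3) supp_subset_iff e)
    moreover have "lindep_mod (ideal_mod I (Suc t)) (monom3 e # ms)" if ind: "indep_mod I t (insert e E)"
    proof -
      have "indep_mod I t E"
        using ind by (auto simp: indep_mod_def)
      moreover have "monom3 e - G \<notin> ideal_mod I (Suc t)" if G: "supp G \<subseteq> E" for G
      proof
        assume *: "monom3 e - G \<in> ideal_mod I (Suc t)"
        have "supp (monom3 e - G) \<subseteq> insert e E"
          using G by (auto simp: supp_subset_iff e)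
        then have "monom3 e - G = 0"
          using * ind by (auto simp: indep_mod_def)
        moreover have "(monom3 e - G) $ i $ j $ k = 1"
          using G insert.hyps by (auto simp: supp_subset_iff e)
        ultimately show False by simp
      qed
      ultimately show ?thesis using ms(3,4) by auto
    qed
    ultimately show ?case
      using ms insert.hyps by (intro exI[of _ "monom3 e # ms"]) auto
  qed
  then show ?thesis using that by blast
qed

text \<open>Lists of series rather than sets of exponents, because an automorphism need not send
  monomials to monomials.\<close>

definition hf_basis :: "'a::comm_ring_1 ps3 set \<Rightarrow> nat \<Rightarrow> 'a ps3 list \<Rightarrow> bool" where
  "hf_basis I t ms \<longleftrightarrow> set ms \<subseteq> \<MM> t \<and> lindep_mod (ideal_mod I (Suc t)) ms \<and>
     (\<forall>F\<in>\<MM> t. \<exists>G\<in>lspan ms. F - G \<in> ideal_mod I (Suc t))"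

lemma hilbert_function_hf_basis:
  assumes "ideal I type_ring" "I \<subseteq> \<MM> (Suc 0)" "hf_basis I t ms"
  shows "hilbert_function I t = length ms"
proof (rule hilbert_function_eq_length[OF assms(1)])
  show "emb_K c \<notin> ideal_mod I (Suc t)" if "c \<noteq> 0" for c
  proof
    assume "emb_K c \<in> ideal_mod I (Suc t)"
    then obtain G where "G \<in> \<MM> (Suc 0)" "emb_K c - G \<in> \<MM> (Suc 0)"
      using assms(2) fil_mono[of _ "Suc 0" "Suc t" "Suc 0"] by (auto simp: ideal_mod_def)
    then have "emb_K c \<in> \<MM> (Suc 0)" using fil_cong by blast
    then have "emb_K c $ 0 $ 0 $ 0 = 0" by (rule MMD) simp
    with that show False by simp
  qed
qed (use assms(3) in \<open>auto simp: hf_basis_def\<close>)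

lemma hf_basis_monom3:
  assumes "E \<subseteq> degs t" "spans_mod I t E" "indep_mod I t E"
  obtains ms :: "'a::field ps3 list" where "hf_basis I t ms" "length ms = card E"
proof -
  have "finite E" using assms(1) finite_subset finite_degs by blast
  then obtain ms :: "'a ps3 list" where ms: "set ms \<subseteq> monom3 ` E" "length ms = card E" "lspan ms = {G. supp G \<subseteq> E}"
    "indep_mod I t E \<longrightarrow> lindep_mod (ideal_mod I (Suc t)) ms"
    by (rule lspan_monom3[of E I t])
  have "hf_basis I t ms"
    using ms(1) ms(4)[rule_format, OF assms(3)] assms(1,2) monom3_MM
    by (fastforce simp: hf_basis_def spans_mod_def ms(3))
  then show ?thesis using ms(2) that by blast
qed

text \<open>The relation \<open>F\<close> is solved for one of its monomials, which the remaining
  ones then replace.\<close>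

lemma spans_mod_remove:
  fixes F :: "'a::field ps3"
  assumes I: "ideal I type_ring" and "spans_mod I t E" "F \<in> ideal_mod I (Suc t)" "supp F \<subseteq> E"
    "F $ i $ j $ k \<noteq> 0"
  shows "spans_mod I t (E - {(i, j, k)})"
  unfolding spans_mod_def
proof
  fix H :: "'a ps3" assume "H \<in> \<MM> t"
  then obtain G where G: "supp G \<subseteq> E" "H - G \<in> ideal_mod I (Suc t)"
    using assms(2) by (auto simp: spans_mod_def)
  define c where "c = G $ i $ j $ k / F $ i $ j $ k"
  have "supp (G - emb_K c * F) \<subseteq> E - {(i, j, k)}"
    using G(1) assms(4,5) by (auto simp: supp_subset_iff c_def)
  moreover have "H - (G - emb_K c * F) \<in> ideal_mod I (Suc t)"
    using ideal_mod_props(1)[OF I G(2) ideal_mod_props(2)[OF I assms(3), of "emb_K c"]]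
    by (simp add: algebra_simps)
  ultimately show "\<exists>G. supp G \<subseteq> E - {(i, j, k)} \<and> H - G \<in> ideal_mod I (Suc t)"
    by blast
qed

lemma spans_mod_degs:
  assumes "ideal I type_ring"
  shows "spans_mod I t (degs t)"
  unfolding spans_mod_def
proof
  fix F :: "'a ps3" assume "F \<in> \<MM> t"
  then show "\<exists>G. supp G \<subseteq> degs t \<and> F - G \<in> ideal_mod I (Suc t)"
    by (intro exI[of _ "hpart t F"]) (auto simp: supp_subset_iff degs_def intro: ideal_mod_props[OF assms] diff_hpart_MM)
qed

lemma spans_mod_contains_basis:
  fixes I :: "'a::field ps3 set"
  assumes I: "ideal I type_ring" and "finite E" "spans_mod I t E"
  obtains E' where "E' \<subseteq> E" "spans_mod I t E'" "indep_mod I t E'"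
proof -
  obtain E' where E': "E' \<subseteq> E" "spans_mod I t E'"
    and least: "\<And>E''. E'' \<subseteq> E \<Longrightarrow> spans_mod I t E'' \<Longrightarrow> card E' \<le> card E''"
    using ex_has_least_nat[of "\<lambda>E'. E' \<subseteq> E \<and> spans_mod I t E'" E card] assms by auto
  have "F = 0" if F: "F \<in> ideal_mod I (Suc t)" "supp F \<subseteq> E'" for F
  proof (rule ccontr)
    assume "F \<noteq> 0"
    then obtain i j k where nz: "F $ i $ j $ k \<noteq> 0"
      by (auto simp: ps3_eq_iff)
    then have "card E' \<le> card (E' - {(i, j, k)})"
      using E' F by (intro least spans_mod_remove[OF I]) auto
    moreover have "card (E' - {(i, j, k)}) < card E'"
      using nz F(2) finite_subset[OF E'(1) assms(2)] by (intro card_Diff1_less) (auto simp: supp_def)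
    ultimately show False by simp
  qed
  then show ?thesis
    using E' that[of E'] by (auto simp: indep_mod_def)
qed

lemma hilbert_function_eq_card:
  fixes I :: "'a::field ps3 set"
  assumes "ideal I type_ring" "I \<subseteq> \<MM> (Suc 0)" "E \<subseteq> degs t" "spans_mod I t E" "indep_mod I t E"
  shows "hilbert_function I t = card E"
  using hf_basis_monom3[OF assms(3-5)] hilbert_function_hf_basis[OF assms(1,2)] by metis

lemma hilbert_function_le_card:
  fixes I :: "'a::field ps3 set"
  assumes "ideal I type_ring" "I \<subseteq> \<MM> (Suc 0)" "E \<subseteq> degs t" "spans_mod I t E"
  shows "hilbert_function I t \<le> card E"
proof -
  have fin: "finite E" using assms(3) finite_subset finite_degs by blast
  then obtain E' where "E' \<subseteq> E" "spans_mod I t E'" "indep_mod I t E'"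
    using assms by (metis spans_mod_contains_basis)
  then show ?thesis
    using hilbert_function_eq_card[of I E' t] assms card_mono[OF fin] by auto
qed

lemma hilbert_function_relation:
  fixes I :: "'a::field ps3 set"
  assumes "ideal I type_ring" "I \<subseteq> \<MM> (Suc 0)" "E \<subseteq> degs t" "spans_mod I t E"
    "F \<in> ideal_mod I (Suc t)" "supp F \<subseteq> E" "F $ i $ j $ k \<noteq> 0"
  shows "hilbert_function I t < card E"
proof -
  have "hilbert_function I t \<le> card (E - {(i, j, k)})"
    using assms by (intro hilbert_function_le_card spans_mod_remove[of I t E F i j k]) auto
  also have "\<dots> < card E"
    using assms finite_subset[OF assms(3)] by (intro card_Diff1_less) (auto simp: supp_def)
  finally show ?thesis .
qed

text \<open>Gaussian elimination on relations: a monomial of the last one serves as pivot, is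
  cleared from the other relations and removed from \<open>E\<close>.\<close>

lemma hilbert_function_relations:
  fixes I :: "'a::field ps3 set" and v :: "nat \<Rightarrow> 'a ps3"
  assumes "ideal I type_ring" "I \<subseteq> \<MM> (Suc 0)" "E \<subseteq> degs t" "spans_mod I t E"
    and "\<And>i. i < r \<Longrightarrow> v i \<in> ideal_mod I (Suc t) \<and> supp (v i) \<subseteq> E"
    and "\<And>c i. (\<Sum>i<r. emb_K (c i) * v i) = 0 \<Longrightarrow> i < r \<Longrightarrow> c i = 0"
  shows "hilbert_function I t + r \<le> card E"
  using assms(3-)
proof (induction r arbitrary: E v)
  case 0
  then show ?case using hilbert_function_le_card[OF assms(1,2)] by simp
next
  case (Suc r)
  have "v r \<noteq> 0"
  proof
    assume "v r = 0"
    then have "(\<Sum>i<Suc r. emb_K (if i = r then 1 else 0) * v i) = 0"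
      by (auto simp: emb_K_hom intro!: sum.neutral)
    from Suc.prems(4)[OF this, of r] show False by simp
  qed
  then obtain a b c where nz: "v r $ a $ b $ c \<noteq> 0"
    by (auto simp: ps3_eq_iff)
  define k where "k i = v i $ a $ b $ c / v r $ a $ b $ c" for i
  define v' where "v' i = v i - emb_K (k i) * v r" for i
  have "hilbert_function I t + r \<le> card (E - {(a, b, c)})"
  proof (rule Suc.IH)
    show "E - {(a, b, c)} \<subseteq> degs t" using Suc.prems(1) by auto
    show "spans_mod I t (E - {(a, b, c)})"
      using Suc.prems nz by (intro spans_mod_remove[OF assms(1), of t E "v r"]) auto
    show "v' i \<in> ideal_mod I (Suc t) \<and> supp (v' i) \<subseteq> E - {(a, b, c)}" if "i < r" for i
      using Suc.prems(3)[of i] Suc.prems(3)[of r] that nz ideal_mod_props[OF assms(1)]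
      by (auto simp: v'_def k_def supp_subset_iff)
    show "d i = 0" if d: "(\<Sum>i<r. emb_K (d i) * v' i) = 0" and "i < r" for d i
    proof -
      \<comment> \<open>\<open>d'\<close> rewrites a relation among the reduced \<open>v'\<close> as
        one among the original \<open>v\<close>; its entry at \<open>r\<close> collects the
        subtracted multiples of \<open>v r\<close>.\<close>
      define d' where "d' i = (if i = r then - (\<Sum>i<r. d i * k i) else d i)" for i
      have "emb_K (\<Sum>i<r. d i * k i) = (\<Sum>i<r. emb_K (d i) * emb_K (k i))"
        by (induction r) (simp_all add: emb_K_hom)
      then have "(\<Sum>i<Suc r. emb_K (d' i) * v i) = (\<Sum>i<r. emb_K (d i) * v' i)"
        by (simp add: d'_def v'_def emb_K_hom algebra_simps sum_subtractf sum_distrib_left)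
      then have "d' i = 0"
        using Suc.prems(4)[of d' i] d \<open>i < r\<close> by simp
      then show ?thesis using \<open>i < r\<close> by (simp add: d'_def)
    qed
  qed
  moreover have "card (E - {(a, b, c)}) < card E"
    using nz Suc.prems(1) Suc.prems(3)[of r] finite_subset[OF Suc.prems(1)]
    by (intro card_Diff1_less) (auto simp: supp_def)
  ultimately show ?case by simp
qed

section \<open>Invariance under automorphisms\<close>

lemma automorphism_MM:
  assumes "K_algebra_automorphism \<phi>"
  shows "\<phi> F \<in> \<MM> N \<longleftrightarrow> F \<in> (\<MM> N :: 'a::field ps3 set)"
proof -
  \<comment> \<open>The maximal ideal consists of the nonunits, which every automorphism preserves;
    its powers follow by splitting off variables.\<close>
  have unit: "F \<notin> \<MM> (Suc 0) \<longleftrightarrow> (\<exists>G. F * G = 1)" for F :: "'a ps3"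
  proof
    assume "F \<notin> \<MM> (Suc 0)"
    then have "F $ 0 $ 0 $ 0 \<noteq> 0" by (auto simp: fil_def)
    then show "\<exists>G. F * G = 1" by (metis ps3_unit)
  next
    assume "\<exists>G. F * G = 1"
    then obtain G where "F * G = 1" by blast
    show "F \<notin> \<MM> (Suc 0)"
    proof
      assume "F \<in> \<MM> (Suc 0)"
      then have "(1 :: 'a ps3) \<in> \<MM> (Suc 0)"
        using fil_mult_right[of F _ _ G] \<open>F * G = 1\<close> by simp
      then have "(1 :: 'a ps3) $ 0 $ 0 $ 0 = 0" by (rule MMD) simp
      then show False by simp
    qed
  qed
  have *: "\<psi> F \<in> \<MM> N" if \<psi>: "K_algebra_automorphism \<psi>" and "F \<in> \<MM> N" for \<psi> :: "'a ps3 \<Rightarrow> 'a ps3" and F N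
    using that(2)
  proof (induction N arbitrary: F)
    case (Suc N)
    have h: "K_hom \<psi>" "bij \<psi>" using \<psi> by (simp_all add: K_algebra_automorphism_iff)
    have one: "\<psi> v \<in> \<MM> (Suc 0)" if "v \<in> \<MM> (Suc 0)" for v
    proof (rule ccontr)
      assume "\<psi> v \<notin> \<MM> (Suc 0)"
      then obtain G where "\<psi> v * G = 1" using unit[of "\<psi> v"] by blast
      moreover obtain H where "G = \<psi> H" using h(2) by (metis bij_pointE)
      ultimately have "\<psi> (v * H) = \<psi> 1" by (simp add: K_hom_simps[OF h(1)])
      then have "v * H = 1" using h(2) by (simp add: bij_def inj_eq)
      then show False using that unit by blast
    qed
    obtain A B C where F: "F = var_x * A + var_y * B + var_z * C" "A \<in> \<MM> N" "B \<in> \<MM> N" "C \<in> \<MM> N"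
      using MM_Suc_decomp[OF Suc.prems] by metis
    show ?case
      unfolding F(1) K_hom_simps[OF h(1)]
      using fil_mult[OF one[OF var_x_MM] Suc.IH[OF F(2)]] fil_mult[OF one[OF var_y_MM] Suc.IH[OF F(3)]]
        fil_mult[OF one[OF var_z_MM] Suc.IH[OF F(4)]] by (auto intro!: fil_add)
  qed simp
  have "inv_into UNIV \<phi> (\<phi> F) = F"
    using assms by (simp add: K_algebra_automorphism_iff bij_is_inj)
  then show ?thesis
    using *[OF assms] *[OF K_algebra_automorphism_inv[OF assms], of "\<phi> F"] by auto
qed

lemma automorphism_image_ideal_gen:
  assumes "K_algebra_automorphism \<phi>"
  shows "\<phi> ` ideal_gen {f, g} = ideal_gen {\<phi> f, \<phi> g}"
proof -
  have h: "K_hom \<phi>" "surj \<phi>" using assms by (simp_all add: K_algebra_automorphism_iff bij_is_surj)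
  show ?thesis
  proof (intro equalityI subsetI)
    fix F assume "F \<in> ideal_gen {\<phi> f, \<phi> g}"
    then obtain u v where "F = u * \<phi> f + v * \<phi> g" by (auto simp: ideal_gen_pair)
    moreover obtain u' v' where "u = \<phi> u'" "v = \<phi> v'" using h(2) by (metis surjD)
    ultimately have "F = \<phi> (u' * f + v' * g)" by (simp add: K_hom_simps[OF h(1)])
    then show "F \<in> \<phi> ` ideal_gen {f, g}" by (auto simp: ideal_gen_pair)
  next
    fix F assume "F \<in> \<phi> ` ideal_gen {f, g}"
    then obtain u v where "F = \<phi> u * \<phi> f + \<phi> v * \<phi> g"
      by (auto simp: ideal_gen_pair K_hom_simps[OF h(1)])
    then show "F \<in> ideal_gen {\<phi> f, \<phi> g}" by (auto simp: ideal_gen_pair)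
  qed
qed

text \<open>Because \<open>\<phi>\<close> preserves orders, it carries \<open>ideal_mod\<close> of
  the ideal onto \<open>ideal_mod\<close> of its image, and so a basis in degree \<open>t\<close> to
  a basis.\<close>

lemma hilbert_function_automorphism:
  fixes f g :: "'a::field ps3"
  assumes \<phi>: "K_algebra_automorphism \<phi>" and "f \<in> \<MM> (Suc 0)" "g \<in> \<MM> (Suc 0)"
  shows "hilbert_function (\<phi> ` ideal_gen {f, g}) = hilbert_function (ideal_gen {f, g})"
proof
  fix t
  let ?I = "ideal_gen {f, g}"
  have h: "K_hom \<phi>" "inj \<phi>" "surj \<phi>"
    using \<phi> by (simp_all add: K_algebra_automorphism_iff bij_def)
  note simps = K_hom_simps[OF h(1)]
  have J: "ideal (\<phi> ` ?I) type_ring"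
    unfolding automorphism_image_ideal_gen[OF \<phi>] by (rule ideal_gen_ideal)
  have sub: "?I \<subseteq> \<MM> (Suc 0)"
    using assms by (intro ideal_gen_minimal MM_ideal) auto
  then have sub': "\<phi> ` ?I \<subseteq> \<MM> (Suc 0)"
    using automorphism_MM[OF \<phi>] by auto
  obtain E where "E \<subseteq> degs t" "spans_mod ?I t E" "indep_mod ?I t E"
    using spans_mod_contains_basis[OF ideal_gen_ideal finite_degs spans_mod_degs[OF ideal_gen_ideal]] by metis
  then obtain ms where ms: "hf_basis ?I t ms"
    using hf_basis_monom3 by metis
  have im: "ideal_mod (\<phi> ` ?I) N = \<phi> ` ideal_mod ?I N" for N
  proof (intro equalityI subsetI)
    fix F assume "F \<in> ideal_mod (\<phi> ` ?I) N"
    then obtain G where G: "G \<in> ?I" "F - \<phi> G \<in> \<MM> N" by (auto simp: ideal_mod_def)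
    moreover obtain F' where "F = \<phi> F'" using h(3) by (metis surjD)
    ultimately show "F \<in> \<phi> ` ideal_mod ?I N"
      using automorphism_MM[OF \<phi>, of "F' - G" N] by (auto simp: ideal_mod_def simps)
  next
    fix F assume "F \<in> \<phi> ` ideal_mod ?I N"
    then show "F \<in> ideal_mod (\<phi> ` ?I) N"
      using automorphism_MM[OF \<phi>] by (auto simp: ideal_mod_def simp flip: simps)
  qed
  have lspan: "lspan (map \<phi> l) = \<phi> ` lspan l" for l
  proof (induction l)
    case Nil
    then show ?case by (simp add: simps)
  next
    case (Cons m l)
    have "\<phi> ` lspan (m # l) = {\<phi> (emb_K c * m + G) | c G. G \<in> lspan l}" by auto
    then show ?case using Cons by (auto simp: simps)
  qed
  have ind: "lindep_mod (\<phi> ` N) (map \<phi> l)" if "lindep_mod N l" for N l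
    using that by (induction l) (auto simp: lspan inj_image_mem_iff[OF h(2)] simp flip: simps)
  have "hf_basis (\<phi> ` ?I) t (map \<phi> ms)"
    unfolding hf_basis_def im lspan
  proof (intro conjI ballI)
    show "set (map \<phi> ms) \<subseteq> \<MM> t" using ms automorphism_MM[OF \<phi>] by (auto simp: hf_basis_def)
    show "lindep_mod (\<phi> ` ideal_mod ?I (Suc t)) (map \<phi> ms)" using ms ind by (simp add: hf_basis_def)
    fix F assume F: "F \<in> (\<MM> t :: 'a ps3 set)"
    obtain F' where F': "F = \<phi> F'" using h(3) by (metis surjD)
    then have "F' \<in> \<MM> t" using F automorphism_MM[OF \<phi>] by simp
    then obtain G where "G \<in> lspan ms" "F' - G \<in> ideal_mod ?I (Suc t)"
      using ms by (auto simp: hf_basis_def)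
    then show "\<exists>G\<in>\<phi> ` lspan ms. F - G \<in> \<phi> ` ideal_mod ?I (Suc t)"
      by (auto simp: F' inj_image_mem_iff[OF h(2)] simp flip: simps)
  qed
  then show "hilbert_function (\<phi> ` ?I) t = hilbert_function ?I t"
    using hilbert_function_hf_basis[OF J sub'] hilbert_function_hf_basis[OF ideal_gen_ideal sub ms] by simp
qed

section \<open>Normal generators\<close>

lemma monom3_mult_nth:
  "(monom3 (a, b, c) * F) $ i $ j $ k = (if i < a \<or> j < b \<or> k < c then 0 else F $ (i - a) $ (j - b) $ (k - c))"
proof -
  have "(monom3 (a, b, c) * F) $ i = (if i < a then 0 else fps_X ^ b * (fps_const (fps_X ^ c) * F $ (i - a)))"
    unfolding monom3_def var_x_def var_y_def var_z_def emb_yz_def emb_z_def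
    by (simp add: fps_X_power_mult_nth fps_const_power mult.assoc)
  then show ?thesis
    by (simp add: fps_X_power_mult_nth)
qed

lemma linear_x_MM:
  "emb_yz A * var_x + emb_yz B \<in> \<MM> (Suc N) \<longleftrightarrow> emb_yz A \<in> \<MM> N \<and> emb_yz B \<in> \<MM> (Suc N)"
proof
  assume *: "emb_yz A * var_x + emb_yz B \<in> \<MM> (Suc N)"
  have "A $ j $ k = 0" if "j + k < N" for j k
    using MMD[OF *, of 1 j k] that by simp
  moreover have "B $ j $ k = 0" if "j + k < Suc N" for j k
    using MMD[OF *, of 0 j k] that by simp
  ultimately show "emb_yz A \<in> \<MM> N \<and> emb_yz B \<in> \<MM> (Suc N)"
    by (simp add: emb_yz_MM)
next
  assume "emb_yz A \<in> \<MM> N \<and> emb_yz B \<in> \<MM> (Suc N)"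
  then show "emb_yz A * var_x + emb_yz B \<in> \<MM> (Suc N)"
    by (intro fil_add) (auto simp: mult.commute[of _ var_x])
qed

lemma initial_quadric_MM:
  assumes "f - (var_x ^ 2 + emb_K \<epsilon> * var_x * var_z) \<in> \<MM> 3"
  shows "f \<in> \<MM> 2"
proof -
  have "var_x ^ 2 + emb_K \<epsilon> * var_x * var_z \<in> \<MM> 2"
    using fil_mult[OF var_x_MM var_x_MM] fil_mult[OF fil_mult_left[OF var_x_MM] var_z_MM]
    by (auto simp: power2_eq_square numeral_2_eq_2 intro!: fil_add)
  then show ?thesis
    using fil_cong[OF fil_mono[OF assms, of 2]] by simp
qed

text \<open>The lowest form of \<open>w f\<close> is that of \<open>w\<close> times
  \<open>x^2 + \<epsilon> x z\<close>; its top power of \<open>x\<close> is at least 2 and survives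
  the addition of \<open>A x + B\<close>. Division therefore respects orders.\<close>

lemma division_order:
  fixes f :: "'a::field ps3"
  assumes f: "f - (var_x ^ 2 + emb_K \<epsilon> * var_x * var_z) \<in> \<MM> 3"
    and "w * f + emb_yz A * var_x + emb_yz B \<in> \<MM> (t + 2)"
  shows "w \<in> \<MM> t \<and> emb_yz A \<in> \<MM> (t + 1) \<and> emb_yz B \<in> \<MM> (t + 2)"
  using assms(2)
proof (induction t)
  case 0
  have "w * f \<in> \<MM> (0 + 2)"
    using initial_quadric_MM[OF f] by (simp add: fil_mult_left numeral_2_eq_2)
  from fil_diff[OF 0 this]
  have "emb_yz A * var_x + emb_yz B \<in> \<MM> (Suc (Suc 0))"
    by (simp add: numeral_2_eq_2 add.assoc)
  then show ?case unfolding linear_x_MM by (simp add: numeral_2_eq_2)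
next
  case (Suc t)
  have IH: "w \<in> \<MM> t" "emb_yz A \<in> \<MM> (t + 1)" "emb_yz B \<in> \<MM> (t + 2)"
    using Suc.IH[OF fil_mono[OF Suc.prems]] by simp_all
  have "w * (f - (var_x ^ 2 + emb_K \<epsilon> * var_x * var_z)) \<in> \<MM> (t + 3)"
    using IH f by (intro fil_mult)
  then have "(w * f + emb_yz A * var_x + emb_yz B) - w * (f - (var_x ^ 2 + emb_K \<epsilon> * var_x * var_z)) \<in> \<MM> (t + 3)"
    using Suc.prems by (intro fil_diff) (simp_all add: numeral_3_eq_3)
  then have *: "var_x * (var_x * w) + emb_K \<epsilon> * (var_x * (var_z * w)) + emb_yz A * var_x + emb_yz B \<in> \<MM> (t + 3)"
    by (simp add: algebra_simps power2_eq_square)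
  \<comment> \<open>The coefficient of \<open>x^(i+2) y^j z^k\<close> is that of \<open>w\<close> at
    \<open>(i, j, k)\<close> plus \<open>\<epsilon>\<close> times that at
    \<open>(i + 1, j, k - 1)\<close>, so the exponent of \<open>z\<close> drives an
    induction.\<close>
  have "w $ i $ j $ k = 0" if "i + j + k = t" for i j k
    using that
  proof (induction k arbitrary: i)
    case 0
    then show ?case
      using MMD[OF *, of "Suc (Suc i)" j 0] by simp
  next
    case (Suc k)
    then show ?case
      using MMD[OF *, of "Suc (Suc i)" j "Suc k"] Suc.IH[of "Suc i"] by (simp add: fps_X_mult_nth)
  qed
  then have w: "w \<in> \<MM> (Suc t)"
    using IH(1) by (auto simp: MM_Suc_iff ps3_eq_iff)
  have "f \<in> \<MM> 2"
    using f by (rule initial_quadric_MM)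
  then have "w * f \<in> \<MM> (Suc t + 2)"
    using w by (intro fil_mult)
  from fil_diff[OF Suc.prems this]
  have "emb_yz A * var_x + emb_yz B \<in> \<MM> (Suc (Suc t + 1))"
    by (simp add: add.assoc)
  then show ?case using w unfolding linear_x_MM by simp
qed

lemma ideal_mod_mult_Suc:
  assumes "ideal I type_ring" "F \<in> ideal_mod I N" "v \<in> \<MM> (Suc 0)"
  shows "v * F \<in> ideal_mod I (Suc N)"
proof -
  obtain u where u: "u \<in> I" "F - u \<in> \<MM> N"
    using assms(2) by (auto simp: ideal_mod_def)
  then have "v * u \<in> I" "v * F - v * u \<in> \<MM> (Suc N)"
    using assms(1) fil_mult[OF assms(3) u(2)] by (auto simp: ideal_type_ring_iff right_diff_distrib)
  then show ?thesis by (auto simp: ideal_mod_def)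
qed

definition std :: "nat \<Rightarrow> (nat \<Rightarrow> bool) \<Rightarrow> (nat \<times> nat \<times> nat) set" where
  "std t P = (\<lambda>j. (0, j, t - j)) ` {j. j \<le> t \<and> P j}"

lemma card_std: "card (std t P) = card {j. j \<le> t \<and> P j}"
  unfolding std_def by (rule card_image) (auto simp: inj_on_def)

lemma std_degs: "std t P \<subseteq> degs t"
  by (auto simp: std_def degs_def)

lemma finite_std [simp]: "finite (std t P)"
  by (simp add: std_def)

lemma mem_std: "(i, j, k) \<in> std t P \<longleftrightarrow> i = 0 \<and> j + k = t \<and> P j"
  by (auto simp: std_def image_iff)

text \<open>With \<open>h = g x + b g - y f\<close> and \<open>S = K[[y,z]]\<close>, the ideal \<open>(f, g)\<close> is \<open>(f) + S g + S h\<close>;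
  modulo \<open>f\<close>, both \<open>g\<close> and \<open>h\<close> lie in \<open>S + S x\<close>.\<close>

locale normal_form =
  fixes \<epsilon> :: "'a::field" and b L :: "'a fps fps" and \<gamma> :: "'a fps"
  assumes b: "emb_yz b - emb_K \<epsilon> * var_z \<in> \<MM> 2" and L: "emb_yz L \<in> \<MM> 3" and \<gamma>: "emb_z \<gamma> \<in> \<MM> 3"
begin

definition "f = var_x ^ 2 + emb_yz b * var_x + emb_yz L"
definition "g = var_x * var_y + emb_z \<gamma>"
definition "D = fps_X * L - fps_const \<gamma> * b"
definition "h = emb_z \<gamma> * var_x - emb_yz D"
text \<open>Elimination of \<open>x\<close> between \<open>g\<close> and \<open>h\<close> leaves
  this series.\<close>

definition "q = fps_const \<gamma> ^ 2 + fps_X * D"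
definition "I = ideal_gen {f, g}"

lemma emb_D: "emb_yz D = var_y * emb_yz L - emb_z \<gamma> * emb_yz b"
  by (simp add: D_def emb_yz_hom var_y_def emb_z_eq_emb_yz)

lemma emb_q: "emb_yz q = emb_z \<gamma> ^ 2 + var_y * emb_yz D"
  unfolding q_def emb_yz_hom var_y_def emb_z_eq_emb_yz by simp

lemma I_ideal: "ideal I type_ring"
  by (simp add: I_def ideal_gen_ideal)

lemmas I_closed = I_ideal[unfolded ideal_type_ring_iff]

lemma f_I: "f \<in> I" and g_I: "g \<in> I"
  using ideal_gen_superset[of "{f, g}"] by (auto simp: I_def)

lemma h_eq: "h = var_x * g + emb_yz b * g - var_y * f"
  by (simp add: h_def g_def f_def emb_D algebra_simps power2_eq_square)

lemma I_diff: "F \<in> I \<Longrightarrow> G \<in> I \<Longrightarrow> F - G \<in> I"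
  using I_closed by (metis add_uminus_conv_diff mult_minus1)

lemma h_I: "h \<in> I"
  unfolding h_eq using I_closed f_I g_I by (intro I_diff) auto

lemma q_I: "emb_yz q \<in> I"
proof -
  have "emb_yz q = emb_z \<gamma> * g - var_y * h"
    by (simp add: emb_q h_def g_def algebra_simps power2_eq_square)
  then show ?thesis using I_closed g_I h_I by (auto intro: I_diff)
qed

lemma b_MM: "emb_yz b \<in> \<MM> (Suc 0)"
proof -
  have "emb_K \<epsilon> * var_z \<in> \<MM> (Suc 0)" by (simp add: fil_mult_left)
  then show ?thesis using fil_cong[OF fil_mono[OF b, of "Suc 0"]] by simp
qed

lemma f_initial: "f - (var_x ^ 2 + emb_K \<epsilon> * var_x * var_z) \<in> \<MM> 3"
proof -
  have "(emb_yz b - emb_K \<epsilon> * var_z) * var_x \<in> \<MM> (2 + Suc 0)"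
    using b var_x_MM by (rule fil_mult)
  then have "(emb_yz b - emb_K \<epsilon> * var_z) * var_x + emb_yz L \<in> \<MM> 3"
    using L by (intro fil_add) simp_all
  then show ?thesis by (simp add: f_def algebra_simps)
qed

lemmas f_MM = initial_quadric_MM[OF f_initial]

lemma g_MM: "g \<in> \<MM> 2"
  using fil_mult[OF var_x_MM var_y_MM] fil_mono[OF \<gamma>, of 2]
  by (simp add: g_def fil_add numeral_2_eq_2)

lemma I_MM: "I \<subseteq> \<MM> 2"
  unfolding I_def using f_MM g_MM by (intro ideal_gen_minimal MM_ideal) auto

lemma I_MM1: "I \<subseteq> \<MM> (Suc 0)"
  using I_MM fil_mono[of _ _ 2 "Suc 0"] by auto

lemma f_weierstrass: "f - var_x ^ 2 \<in> fil 2 3"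
proof -
  have "b $ 0 $ 0 = 0" "\<And>j k. j + k < 3 \<Longrightarrow> L $ j $ k = 0"
    using b_MM L by (auto simp: emb_yz_MM)
  moreover have "i = 0 \<and> j + k < 3 \<or> i = 1 \<and> j = 0 \<and> k = 0 \<or> i = 2 \<and> j = 0 \<and> k = 0"
    if "i + 2 * (j + k) < 3" for i j k :: nat
    using that by arith
  ultimately show ?thesis
    by (intro filI) (fastforce simp: f_def)
qed

text \<open>Dividing the coefficient of \<open>g\<close> by \<open>f\<close> leaves
  \<open>A x + B\<close>, and \<open>x g\<close> is \<open>h - b g\<close> modulo \<open>f\<close>.
  Hence \<open>\<tau>\<close> is \<open>A\<close>, \<open>s\<close> is \<open>B - A b\<close>, and
  the two displayed terms are the expansion of \<open>s g + \<tau> h\<close>.\<close>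

lemma I_repr:
  assumes "u \<in> I"
  obtains w s \<tau> where "u = w * f + emb_yz (fps_X * s + \<tau> * fps_const \<gamma>) * var_x + emb_yz (s * fps_const \<gamma> - \<tau> * D)"
proof -
  obtain u1 u2 where u: "u = u1 * f + u2 * g"
    using assms by (auto simp: I_def ideal_gen_pair)
  obtain w A B where w: "u2 = w * f + emb_yz A * var_x + emb_yz B"
    using weierstrass_division[OF f_weierstrass] by metis
  have "u = (u1 + w * g + emb_yz A * var_y) * f + emb_yz (fps_X * (B - A * b) + A * fps_const \<gamma>) * var_x
     + emb_yz ((B - A * b) * fps_const \<gamma> - A * D)"
    unfolding u w g_def f_def by (simp add: emb_yz_hom emb_D var_y_def[symmetric] emb_z_eq_emb_yz[symmetric] algebra_simps power2_eq_square)
  then show ?thesis by (rule that)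
qed

text \<open>In a remainder \<open>A x + B\<close>, the multiples of \<open>x y\<close> in
  \<open>A x\<close> become multiples of \<open>\<gamma>\<close>, whose order 3 or more pushes them
  out of range. Of the part of \<open>A\<close> in \<open>z\<close> alone, only the lowest term
  still counts.\<close>

lemma span_basic:
  assumes "F \<in> \<MM> (t + 2)"
  obtains c B where "emb_yz B \<in> \<MM> (t + 2)"
    "F - (emb_K c * monom3 (1, 0, t + 1) + emb_yz B) \<in> ideal_mod I (t + 3)"
proof -
  note P = ideal_mod_props[OF I_ideal]
  obtain w A B where w: "F = w * f + emb_yz A * var_x + emb_yz B"
    using weierstrass_division[OF f_weierstrass] by metis
  from division_order[OF f_initial assms[unfolded w]]
  have o: "emb_yz A \<in> \<MM> (t + 1)" "emb_yz B \<in> \<MM> (t + 2)" by simp_all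
  define A' where "A' = fps_shift 1 A"
  define c where "c = A $ 0 $ (t + 1)"
  have A: "emb_yz A = emb_z (A $ 0) + var_y * emb_yz A'"
    by (auto simp: ps3_eq_iff A'_def fps_X_mult_nth)
  have "emb_yz A' \<in> \<MM> t"
    using o(1) by (auto simp: emb_yz_MM A'_def)
  then have 1: "emb_yz A' * emb_z \<gamma> \<in> \<MM> (t + 3)"
    using \<gamma> by (rule fil_mult)
  have "emb_z (A $ 0) - emb_K c * var_z ^ (t + 1) \<in> \<MM> (t + 2)"
    using o(1)[unfolded emb_yz_MM, rule_format, of 0] by (auto simp: fil_def fps_X_power_nth c_def)
  then have 2: "(emb_z (A $ 0) - emb_K c * var_z ^ (t + 1)) * var_x \<in> \<MM> (t + 3)"
    by (rule fil_mult_le[OF _ var_x_MM]) simp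
  have "F - (emb_K c * monom3 (1, 0, t + 1) + emb_yz B) =
     w * f + emb_yz A' * g - emb_yz A' * emb_z \<gamma> + (emb_z (A $ 0) - emb_K c * var_z ^ (t + 1)) * var_x"
    unfolding w A g_def monom3_def by (simp add: algebra_simps)
  also have "\<dots> \<in> ideal_mod I (t + 3)"
    using 1 2 f_I g_I by (intro P(1) P(3) P(2)[OF P(4)] P(5))
  finally show ?thesis using o(2) that by blast
qed

text \<open>For \<open>t \<ge> 1\<close> these are the monomials of degree \<open>t\<close> outside
  \<open>(x^2, x y)\<close>.\<close>

abbreviation E0 :: "nat \<Rightarrow> (nat \<times> nat \<times> nat) set" where
  "E0 t \<equiv> insert (1, 0, t - 1) (std t (\<lambda>_. True))"

lemma E0_degs: "2 \<le> t \<Longrightarrow> E0 t \<subseteq> degs t"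
  using std_degs[of t "\<lambda>_. True"] by (simp add: degs_def)

lemma card_E0: "card (E0 t) = t + 2"
proof -
  have "card {j. j \<le> t} = t + 1"
    using card_atMost[of t] by (simp add: atMost_def)
  moreover have "finite (std t (\<lambda>_. True))"
    by (rule finite_subset[OF std_degs finite_degs])
  ultimately show ?thesis
    by (simp add: card_std mem_std)
qed

lemmas E0 = E0_degs card_E0

lemma spans_E0:
  assumes "2 \<le> t"
  shows "spans_mod I t (E0 t)"
  unfolding spans_mod_def
proof
  note P = ideal_mod_props[OF I_ideal]
  fix F :: "'a ps3" assume F: "F \<in> \<MM> t"
  define t' where "t' = t - 2"
  then have t: "t = t' + 2" using assms by simp
  obtain c B where B: "emb_yz B \<in> \<MM> (t' + 2)"
    "F - (emb_K c * monom3 (1, 0, t' + 1) + emb_yz B) \<in> ideal_mod I (t' + 3)"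
    using span_basic[OF F[unfolded t]] .
  let ?G = "emb_K c * monom3 (1, 0, t' + 1) + hpart t (emb_yz B)"
  have "emb_yz B - hpart t (emb_yz B) \<in> ideal_mod I (t' + 3)"
    using diff_hpart_MM[OF B(1)] by (intro P(5)) (simp add: t numeral_3_eq_3)
  from P(1)[OF B(2) this] have "F - ?G \<in> ideal_mod I (Suc t)"
    by (simp add: t algebra_simps numeral_3_eq_3)
  moreover have "supp ?G \<subseteq> E0 t"
    by (auto simp: supp_subset_iff mem_std t)
  ultimately show "\<exists>G. supp G \<subseteq> E0 t \<and> F - G \<in> ideal_mod I (Suc t)" by blast
qed

lemma no_relation:
  assumes "2 \<le> t" "hilbert_function I t = t + 2" "F \<in> ideal_mod I (Suc t)" "supp F \<subseteq> E0 t"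
  shows "F = 0"
proof (rule ccontr)
  assume "F \<noteq> 0"
  then obtain i j k where "F $ i $ j $ k \<noteq> 0" by (auto simp: ps3_eq_iff)
  then have "hilbert_function I t < card (E0 t)"
    using assms E0 spans_E0 by (intro hilbert_function_relation[OF I_ideal I_MM1, of _ _ F i j k]) auto
  then show False using assms E0(2)[of t] by simp
qed

text \<open>While the Hilbert function equals the size of \<open>E0\<close>, the monomials in
  \<open>E0\<close> satisfy no relation. The lowest form of \<open>h = \<gamma> x - D\<close> uses
  only such monomials, so it vanishes, and the order of \<open>h\<close> rises by one with each
  degree.\<close>

lemma order_\<gamma>_D:
  assumes HF: "\<And>t. 2 \<le> t \<Longrightarrow> t \<le> n \<Longrightarrow> hilbert_function I t = t + 2" and "3 \<le> k" "k \<le> n"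
  shows "emb_z \<gamma> \<in> \<MM> k \<and> emb_yz D \<in> \<MM> (Suc k)"
  using assms(2,3)
proof (induction k rule: dec_induct)
  case base
  have "var_y * emb_yz L \<in> \<MM> 4" "emb_z \<gamma> * emb_yz b \<in> \<MM> 4"
    using fil_mult[OF var_y_MM L] fil_mult[OF \<gamma> b_MM] by simp_all
  then show ?case
    using \<gamma> by (simp add: emb_D fil_diff)
next
  case (step k)
  then have k: "emb_z \<gamma> \<in> \<MM> k" "emb_yz D \<in> \<MM> (Suc k)" by simp_all
  have h: "h = emb_yz (fps_const \<gamma>) * var_x + emb_yz (- D)"
    by (simp add: h_def emb_z_eq_emb_yz emb_yz_hom)
  then have hM: "h \<in> \<MM> (Suc k)"
    using k by (simp only: linear_x_MM) (simp add: emb_yz_hom emb_z_eq_emb_yz)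
  have "hpart (Suc k) h = 0"
  proof (rule no_relation)
    show "2 \<le> Suc k" "hilbert_function I (Suc k) = Suc k + 2"
      using step HF[of "Suc k"] by simp_all
    have "h - (h - hpart (Suc k) h) \<in> ideal_mod I (Suc (Suc k))"
      by (intro ideal_mod_props(3)[OF I_ideal] ideal_mod_props(4)[OF I_ideal h_I]
          ideal_mod_props(5)[OF I_ideal] diff_hpart_MM[OF hM])
    then show "hpart (Suc k) h \<in> ideal_mod I (Suc (Suc k))" by simp
    show "supp (hpart (Suc k) h) \<subseteq> E0 (Suc k)"
      by (auto simp: supp_subset_iff mem_std h)
  qed
  then have "h \<in> \<MM> (Suc (Suc k))"
    using hM by (simp add: MM_Suc_iff[of _ "Suc k"])
  then show ?case
    unfolding h linear_x_MM by (simp add: emb_yz_hom emb_z_eq_emb_yz)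
qed

text \<open>In degree \<open>n + 2\<close> the set \<open>E0\<close> has one element more than the
  Hilbert function allows, so there is one relation at most. A term of \<open>F\<close> free of
  \<open>x\<close> would give two independent ones, from \<open>z F\<close> and from
  \<open>y F\<close>.\<close>

lemma relation_structure:
  assumes "3 \<le> n" and HF1: "hilbert_function I (n + 2) = n + 3"
    and F: "F \<in> ideal_mod I (n + 2)" "supp F \<subseteq> E0 (n + 1)"
  shows "F $ 0 = 0"
proof (rule ccontr)
  note P = ideal_mod_props[OF I_ideal]
  assume "F $ 0 \<noteq> 0"
  \<comment> \<open>\<open>J\<close> is the least power of \<open>y\<close> among the terms free of
    \<open>x\<close>. Multiplication by \<open>z\<close> keeps it and multiplication by
    \<open>y\<close> raises it, which makes the two relations independent.\<close>
  define J where "J = subdegree (F $ 0)"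
  have "F $ 0 $ J \<noteq> 0" using \<open>F $ 0 \<noteq> 0\<close> by (simp add: J_def)
  then obtain k where k: "F $ 0 $ J $ k \<noteq> 0" by (auto simp: fps_eq_iff)
  then have Jk: "J + k = n + 1"
    using F(2)[unfolded supp_subset_iff, rule_format, of 0 J k] by (auto simp: mem_std)
  define F1 where "F1 = var_z * F"
  have F1: "F1 \<in> ideal_mod I (Suc (n + 2))"
    unfolding F1_def using F(1) by (intro ideal_mod_mult_Suc I_ideal) auto
  have supp: "F $ i $ j $ k = 0" if "\<not> (i = 0 \<and> j + k = n + 1 \<or> i = 1 \<and> j = 0 \<and> k = n)" for i j k
    using F(2) that by (auto simp: supp_subset_iff mem_std)
  have F1s: "supp F1 \<subseteq> E0 (n + 2)"
    by (auto simp: supp_subset_iff mem_std F1_def fps_X_mult_nth intro!: supp)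
  define c where "c = F $ 1 $ 0 $ n"
  \<comment> \<open>The term in \<open>x z^n\<close> is dropped before multiplying by
    \<open>y\<close>: \<open>x y z^n\<close> is outside \<open>E0\<close>, and modulo
    \<open>I\<close> it is \<open>- z^n \<gamma>\<close>, of order at least
    \<open>n + 3\<close>.\<close>
  define F' where "F' = F - emb_K c * monom3 (1, 0, n)"
  have F': "F' $ i $ j $ k = (if i = 0 \<and> j + k = n + 1 then F $ 0 $ j $ k else 0)" for i j k
    using supp[of i j k] by (auto simp: F'_def c_def)
  define F2 where "F2 = var_y * F'"
  have "F2 = var_y * F - emb_K c * (var_z ^ n * g - var_z ^ n * emb_z \<gamma>)"
    by (simp add: F2_def F'_def monom3_def g_def algebra_simps)
  moreover have "var_z ^ n * emb_z \<gamma> \<in> \<MM> (n + 3)"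
    by (intro fil_mult var_z_power_MM \<gamma>)
  moreover have "var_y * F \<in> ideal_mod I (Suc (n + 2))"
    using F(1) by (intro ideal_mod_mult_Suc I_ideal) auto
  ultimately have F2: "F2 \<in> ideal_mod I (Suc (n + 2))"
    using P(3)[OF _ P(2)[OF P(3)[OF P(2)[OF P(4)[OF g_I]] P(5)]]] by (simp add: numeral_3_eq_3)
  have below: "F $ 0 $ j = 0" if "j < J" for j
    using that by (simp add: J_def nth_less_subdegree_zero)
  have F2s: "supp F2 \<subseteq> E0 (n + 2) - {(0, J, Suc k)}"
    using Jk by (auto simp: supp_subset_iff mem_std F2_def fps_X_mult_nth F' below)
  have "spans_mod I (n + 2) (E0 (n + 2) - {(0, J, Suc k)})"
    using k F1 F1s by (intro spans_mod_remove[OF I_ideal spans_E0, of _ F1]) (auto simp: F1_def)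
  moreover have "F2 $ 0 $ Suc J $ k \<noteq> 0"
    using k Jk by (simp add: F2_def F')
  ultimately have "hilbert_function I (n + 2) < card (E0 (n + 2) - {(0, J, Suc k)})"
    using F2 F2s E0(1)[of "n + 2"]
    by (intro hilbert_function_relation[OF I_ideal I_MM1, of _ _ F2 0 "Suc J" k]) auto
  moreover have "finite (E0 (n + 2))"
    by simp
  then have "card (E0 (n + 2) - {(0, J, Suc k)}) < card (E0 (n + 2))"
    using Jk by (intro card_Diff1_less) (auto simp: mem_std)
  ultimately show False
    using HF1 E0(2)[of "n + 2"] by simp
qed

text \<open>The relation in degree \<open>n + 1\<close> is a multiple of \<open>x z^n\<close>. Its
  representation with \<open>A = y s + \<tau> \<gamma>\<close> shows that \<open>\<tau>\<close> is a
  unit and that \<open>\<gamma>\<close> has order exactly \<open>n\<close>; the bound on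
  \<open>B = s \<gamma> - \<tau> D\<close> then passes to \<open>D\<close>.\<close>

lemma hilbert_function_structure:
  assumes n: "3 \<le> n" and HF: "\<And>t. 2 \<le> t \<Longrightarrow> t \<le> n \<Longrightarrow> hilbert_function I t = t + 2"
    and HF1: "hilbert_function I (n + 1) = n + 2" and HF2: "hilbert_function I (n + 2) = n + 3"
  shows "emb_z \<gamma> \<in> \<MM> n" "\<gamma> $ n \<noteq> 0" "emb_yz D \<in> \<MM> (n + 2)" "\<epsilon> = 0"
proof -
  show \<gamma>n: "emb_z \<gamma> \<in> \<MM> n"
    using order_\<gamma>_D[OF HF n order_refl] by simp
  have "\<not> indep_mod I (n + 1) (E0 (n + 1))"
  proof
    assume "indep_mod I (n + 1) (E0 (n + 1))"
    then have "hilbert_function I (n + 1) = card (E0 (n + 1))"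
      using n by (intro hilbert_function_eq_card I_ideal I_MM1 E0 spans_E0) auto
    then show False using HF1 E0(2)[of "n + 1"] by simp
  qed
  then obtain F where F: "F \<in> ideal_mod I (n + 2)" "supp F \<subseteq> E0 (n + 1)" "F \<noteq> 0"
    by (auto simp: indep_mod_def)
  have "F $ 0 = 0" using relation_structure[OF n HF2 F(1,2)] .
  define c where "c = F $ 1 $ 0 $ n"
  have Fc: "F = emb_K c * (var_z ^ n * var_x)"
  proof -
    have "F $ i $ j $ k = (if i = 1 \<and> j = 0 \<and> k = n then c else 0)" for i j k
      using F(2)[unfolded supp_subset_iff, rule_format, of i j k] \<open>F $ 0 = 0\<close>
      by (cases "i = 0") (auto simp: mem_std c_def)
    then have "F = emb_K c * monom3 (1, 0, n)"
      by (simp add: ps3_eq_iff)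
    then show ?thesis by (simp add: monom3_def mult_ac)
  qed
  then have "c \<noteq> 0" using F(3) by (auto simp: emb_K_hom)
  obtain u where u: "u \<in> I" "F - u \<in> \<MM> (n + 2)"
    using F(1) by (auto simp: ideal_mod_def)
  obtain w s \<tau> where w: "u = w * f + emb_yz (fps_X * s + \<tau> * fps_const \<gamma>) * var_x + emb_yz (s * fps_const \<gamma> - \<tau> * D)"
    using I_repr[OF u(1)] .
  define A B where "A = fps_X * s + \<tau> * fps_const \<gamma>" and "B = s * fps_const \<gamma> - \<tau> * D"
  have "u - F = w * f + emb_yz (A - fps_const (fps_const c * fps_X ^ n)) * var_x + emb_yz B"
    unfolding w Fc A_def[symmetric] B_def[symmetric]
    by (auto simp: emb_yz_hom ps3_eq_iff algebra_simps)
  then have "w * f + emb_yz (A - fps_const (fps_const c * fps_X ^ n)) * var_x + emb_yz B \<in> \<MM> (n + 2)"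
    using fil_diff_commute[OF u(2)] by simp
  from division_order[OF f_initial this]
  have A: "emb_yz (A - fps_const (fps_const c * fps_X ^ n)) \<in> \<MM> (n + 1)" and B: "emb_yz B \<in> \<MM> (n + 2)"
    by simp_all
  have "A $ 0 $ n = c"
    using MMD[OF A, of 0 0 n] by simp
  \<comment> \<open>At \<open>y = 0\<close> only \<open>\<tau> \<gamma>\<close> is left of
    \<open>A\<close>, and \<open>\<gamma>\<close> starts in degree \<open>n\<close>.\<close>
  moreover have "A $ 0 $ n = \<tau> $ 0 $ 0 * \<gamma> $ n"
  proof -
    have "A $ 0 $ n = (\<tau> $ 0 * \<gamma>) $ n" by (simp add: A_def)
    also have "\<dots> = (\<Sum>i=0..n. if i = 0 then \<tau> $ 0 $ 0 * \<gamma> $ n else 0)"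
      unfolding fps_mult_nth using \<gamma>n by (intro sum.cong) (auto simp: emb_z_MM)
    finally show ?thesis by simp
  qed
  ultimately have nz: "\<tau> $ 0 $ 0 \<noteq> 0" and \<gamma>nz: "\<gamma> $ n \<noteq> 0" using \<open>c \<noteq> 0\<close> by auto
  show "\<gamma> $ n \<noteq> 0" by fact
  have "emb_yz (fps_const (fps_const c * fps_X ^ n)) \<in> \<MM> n"
    by (simp add: emb_yz_MM fps_X_power_nth)
  then have "emb_yz A \<in> \<MM> n"
    using fil_cong[OF fil_mono[OF A[unfolded emb_yz_hom], of n]] by simp
  moreover have "emb_yz \<tau> * emb_z \<gamma> \<in> \<MM> n"
    using \<gamma>n by (rule fil_mult_left)
  moreover have "var_y * emb_yz s = emb_yz A - emb_yz \<tau> * emb_z \<gamma>"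
    by (simp add: A_def emb_yz_hom var_y_def emb_z_eq_emb_yz)
  ultimately have "var_y * emb_yz s \<in> \<MM> (Suc (n - 1))"
    using n by (auto intro: fil_diff)
  then have "emb_yz s \<in> \<MM> (n - 1)" by simp
  \<comment> \<open>The product has order at least \<open>2 n - 1\<close>, and
    \<open>n \<ge> 3\<close> makes this at least \<open>n + 2\<close>.\<close>
  then have "emb_yz s * emb_z \<gamma> \<in> \<MM> (n + 2)"
    using \<gamma>n n by (intro fil_mult_le[of _ _ "n - 1" _ n]) auto
  moreover have "emb_yz \<tau> * emb_yz D = emb_yz s * emb_z \<gamma> - emb_yz B"
    by (simp add: B_def emb_yz_hom emb_z_eq_emb_yz)
  ultimately have "emb_yz \<tau> * emb_yz D \<in> \<MM> (n + 2)"
    using B by (auto intro: fil_diff)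
  then show D: "emb_yz D \<in> \<MM> (n + 2)"
    by (rule unit_mult_MM[rotated]) (simp add: nz)
  \<comment> \<open>At \<open>y = 0\<close> the series \<open>D\<close> is
    \<open>- \<gamma> b\<close>. Since \<open>b\<close> starts with \<open>\<epsilon> z\<close>
    there, the coefficient in degree \<open>n + 1\<close> is minus \<open>\<epsilon>\<close> times
    the leading coefficient of \<open>\<gamma>\<close>.\<close>
  have "(\<gamma> * b $ 0) $ (Suc n) = 0"
  proof -
    have "D $ 0 = - (\<gamma> * b $ 0)"
      by (simp add: D_def)
    moreover have "D $ 0 $ Suc n = 0"
      using D by (simp add: emb_yz_MM)
    ultimately show ?thesis by simp
  qed
  moreover have "(\<gamma> * b $ 0) $ (Suc n) = (\<Sum>i=0..Suc n. if i = n then \<gamma> $ n * b $ 0 $ 1 else 0)"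
    unfolding fps_mult_nth
  proof (intro sum.cong refl)
    fix i assume "i \<in> {0..Suc n}"
    then consider "i < n" | "i = n" | "i = Suc n" by force
    then show "\<gamma> $ i * b $ 0 $ (Suc n - i) = (if i = n then \<gamma> $ n * b $ 0 $ 1 else 0)"
      using \<gamma>n b_MM by cases (auto simp: emb_z_MM emb_yz_MM)
  qed
  ultimately have "b $ 0 $ 1 = 0" using \<gamma>nz by simp
  moreover have "b $ 0 $ 1 = \<epsilon>"
    using MMD[OF b, of 0 0 1] by simp
  ultimately show "\<epsilon> = 0" by simp
qed

end

section \<open>The Hilbert function of normal generators\<close>

text \<open>The minimum will count the monomials in \<open>y\<close> and \<open>z\<close> of the set
  \<open>E t\<close> below, and the second summand its monomial \<open>x z^(t-1)\<close>.\<close>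

lemma H_fun_eq:
  assumes "n + 3 \<le> e" "2 \<le> t"
  shows "H_fun n e t = min (t + 1) e + (if t \<le> n then 1 else 0)"
  using assms by (auto simp: H_fun_def min_def)

lemma card_degs_1: "card (degs 1) = 3"
proof -
  have "degs 1 = {(1, 0, 0), (0, 1, 0), (0, 0, 1)}"
    by (auto simp: degs_def)
  then show ?thesis by simp
qed

lemma card_degs_0: "card (degs 0) = 1"
proof -
  have "degs 0 = {(0, 0, 0)}"
    by (auto simp: degs_def)
  then show ?thesis by simp
qed

context normal_form
begin

lemma hilbert_function_small:
  assumes "t < 2"
  shows "hilbert_function I t = card (degs t)"
proof (rule hilbert_function_eq_card[OF I_ideal I_MM1 order_refl spans_mod_degs[OF I_ideal]])
  show "indep_mod I t (degs t)"
    unfolding indep_mod_def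
  proof (intro ballI impI)
    fix F assume F: "F \<in> ideal_mod I (Suc t)" "supp F \<subseteq> degs t"
    obtain u where u: "u \<in> I" "F - u \<in> \<MM> (Suc t)"
      using F(1) by (auto simp: ideal_mod_def)
    have "u \<in> \<MM> (Suc t)"
      using u(1) I_MM assms fil_mono[of u "Suc 0" 2 "Suc t"] by auto
    then have "F \<in> \<MM> (Suc t)"
      using fil_cong[OF u(2)] by simp
    then have "F $ i $ j $ k = 0" for i j k
      using F(2)[unfolded supp_subset_iff, rule_format, of i j k] MMD[of F "Suc t" i j k]
      by (cases "i + j + k = t") (auto simp: degs_def)
    then show "F = 0" by (simp add: ps3_eq_iff)
  qed
qed

context
  fixes n e :: nat
  assumes n: "3 \<le> n" and e: "n + 3 \<le> e" and \<gamma>n: "emb_z \<gamma> \<in> \<MM> n" and \<gamma>nz: "\<gamma> $ n \<noteq> 0"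
    and D: "emb_yz D \<in> \<MM> (n + 2)" and qe: "emb_yz q \<in> \<MM> e" "emb_yz q \<notin> \<MM> (Suc e)"
begin

text \<open>\<open>y^J z^(e-J)\<close> is the term of lowest \<open>y\<close>-degree of \<open>q*\<close>; \<open>E t\<close> consists of the monomials of
  degree \<open>t\<close> not divisible by it, nor by \<open>x^2\<close>, \<open>x y\<close>, \<open>x z^n\<close>.\<close>

definition "Q = hpart e (emb_yz q) $ 0"
definition "J = subdegree Q"
definition "P t j \<longleftrightarrow> j < J \<or> t + J < j + e"
definition "E t = std t (P t) \<union> (if t \<le> n then {(1, 0, t - 1)} else {})"

lemma Q_nz: "Q \<noteq> 0"
proof
  assume "Q = 0"
  then have "hpart e (emb_yz q) $ i $ j $ k = 0" for i j k
    by (cases "i = 0") (simp_all add: Q_def)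
  then have "hpart e (emb_yz q) = 0" by (simp only: ps3_eq_iff) simp
  then show False using qe by (simp add: MM_Suc_iff)
qed

lemma Q_nth: "Q $ j $ k = (if j + k = e then q $ j $ k else 0)"
  by (simp add: Q_def)

lemma J: "J \<le> e" "q $ J $ (e - J) \<noteq> 0" "j < J \<Longrightarrow> j + k = e \<Longrightarrow> q $ j $ k = 0"
proof -
  have "Q $ J \<noteq> 0" using Q_nz by (simp add: J_def)
  then obtain l where "Q $ J $ l \<noteq> 0" by (auto simp: fps_eq_iff)
  then have *: "J + l = e" "q $ J $ l \<noteq> 0" by (auto simp: Q_nth split: if_splits)
  then show "J \<le> e" by linarith
  have "l = e - J" using *(1) by linarith
  with *(2) show "q $ J $ (e - J) \<noteq> 0" by simp
  assume "j < J" "j + k = e"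
  then have "Q $ j = 0" by (simp add: J_def nth_less_subdegree_zero)
  then show "q $ j $ k = 0" using \<open>j + k = e\<close> Q_nth[of j k] by simp
qed

text \<open>In degree \<open>t\<close> there are no multiples of \<open>y^J z^(e-J)\<close> if
  \<open>t < e\<close>, and \<open>t - e + 1\<close> of them otherwise.\<close>

lemma card_E:
  assumes "2 \<le> t"
  shows "card (E t) = H_fun n e t"
proof -
  have "card {j. j \<le> t \<and> P t j} = min (t + 1) e"
  proof (cases "t < e")
    case True
    then have "{j. j \<le> t \<and> P t j} = {..t}"
      by (auto simp: P_def)
    then show ?thesis using True by simp
  next
    case False
    then have "{j. j \<le> t \<and> P t j} = {..t} - {J..t + J - e}"
      using J(1) by (auto simp: P_def)
    moreover have "{J..t + J - e} \<subseteq> {..t}" using J(1) by auto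
    ultimately have "card {j. j \<le> t \<and> P t j} = Suc t - (Suc (t + J - e) - J)"
      by (simp add: card_Diff_subset)
    then show ?thesis using False by simp
  qed
  moreover have "card (E t) = card (std t (P t)) + (if t \<le> n then 1 else 0)"
    by (simp add: E_def mem_std)
  ultimately show ?thesis
    using H_fun_eq[OF e assms] by (simp add: card_std)
qed

lemma E_degs:
  assumes "2 \<le> t"
  shows "E t \<subseteq> degs t"
  using std_degs[of t "P t"] assms by (simp add: E_def degs_def)

text \<open>A power of \<open>z\<close> times \<open>h\<close> has a constant times
  \<open>x z^(t-1)\<close> as lowest form: the part \<open>D\<close> of \<open>h\<close> has order
  at least \<open>n + 2\<close>, one more than the degree of \<open>x z^n\<close>.\<close>

lemma x_z_power_reduces:
  assumes "n < t"
  shows "emb_K c * monom3 (1, 0, t - 1) \<in> ideal_mod I (Suc t)"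
proof -
  note pr = ideal_mod_props[OF I_ideal]
  define z :: "'a ps3" where "z = var_z ^ (t - 1 - n)"
  have "emb_K (\<gamma> $ n) * var_z ^ n - emb_z \<gamma> \<in> \<MM> (Suc n)"
    using \<gamma>n by (auto simp: fil_def emb_z_MM fps_X_power_nth less_Suc_eq)
  then have "z * ((emb_K (\<gamma> $ n) * var_z ^ n - emb_z \<gamma>) * var_x) \<in> \<MM> ((t - 1 - n) + (Suc n + Suc 0))"
    unfolding z_def by (intro fil_mult var_z_power_MM var_x_MM)
  then have 1: "z * ((emb_K (\<gamma> $ n) * var_z ^ n - emb_z \<gamma>) * var_x) \<in> \<MM> (Suc t)"
    using assms by simp
  have "z * emb_yz D \<in> \<MM> ((t - 1 - n) + (n + 2))"
    unfolding z_def by (intro fil_mult var_z_power_MM D)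
  then have 2: "z * emb_yz D \<in> \<MM> (Suc t)"
    using assms by simp
  have zn: "z * var_z ^ n = var_z ^ (t - 1)"
    using assms by (simp add: z_def flip: power_add)
  then have mono: "monom3 (1, 0, t - 1) = var_x * (z * var_z ^ n)"
    by (simp add: monom3_def)
  have "emb_K (\<gamma> $ n) * monom3 (1, 0, t - 1) = z * h + z * emb_yz D + z * ((emb_K (\<gamma> $ n) * var_z ^ n - emb_z \<gamma>) * var_x)"
    unfolding mono by (simp add: h_def algebra_simps)
  also have "\<dots> \<in> ideal_mod I (Suc t)"
    using 1 2 by (intro pr(1) pr(2)[OF pr(4)[OF h_I]] pr(5))
  finally have "emb_K (c / \<gamma> $ n) * (emb_K (\<gamma> $ n) * monom3 (1, 0, t - 1)) \<in> ideal_mod I (Suc t)"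
    by (rule pr(2))
  moreover have "emb_K (c / \<gamma> $ n) * emb_K (\<gamma> $ n) = emb_K c"
    using \<gamma>nz by (simp flip: emb_K_hom)
  ultimately show ?thesis by (simp only: mult.assoc[symmetric])
qed

text \<open>Reduction by \<open>q\<close> in increasing powers of \<open>y\<close>. The lowest form
  of \<open>y^m z^r q\<close> starts at \<open>y^(J+m)\<close>, so coefficients cleared before are
  not disturbed.\<close>

lemma divide_by_q:
  assumes "F \<in> \<MM> t" "\<And>i. 0 < i \<Longrightarrow> F $ i = 0" "m + e \<le> t + 1"
  shows "\<exists>F'\<in>\<MM> t. (\<forall>i>0. F' $ i = 0) \<and> F - F' \<in> ideal_mod I (Suc t) \<and>
    (\<forall>j k. j + k = t \<longrightarrow> J \<le> j \<longrightarrow> j < J + m \<longrightarrow> F' $ 0 $ j $ k = 0)"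
  using assms(3)
proof (induction m)
  case 0
  have "F - F \<in> ideal_mod I (Suc t)"
    using ideal_mod_props(5)[OF I_ideal, of "F - F" "Suc t"] by simp
  then show ?case using assms(1,2) by (intro bexI[of _ F]) auto
next
  case (Suc m)
  then obtain F' where F': "F' \<in> \<MM> t" "\<And>i. i > 0 \<Longrightarrow> F' $ i = 0" "F - F' \<in> ideal_mod I (Suc t)"
    "\<And>j k. j + k = t \<Longrightarrow> J \<le> j \<Longrightarrow> j < J + m \<Longrightarrow> F' $ 0 $ j $ k = 0" by auto
  define r where "r = t - e - m"
  have r: "t = e + m + r" using Suc.prems by (simp add: r_def)
  define d where "d = F' $ 0 $ (J + m) $ (e - J + r) / q $ J $ (e - J)"
  define T where "T = emb_K d * (monom3 (0, m, r) * emb_yz q)"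
  have T_nth: "T $ i $ j $ k = (if i = 0 \<and> m \<le> j \<and> r \<le> k then d * q $ (j - m) $ (k - r) else 0)" for i j k
    by (simp add: T_def monom3_mult_nth)
  have "monom3 (0, m, r) \<in> \<MM> (m + r)"
    by (intro monom3_MM) (simp add: degs_def)
  then have "monom3 (0, m, r) * emb_yz q \<in> \<MM> (m + r + e)"
    using qe(1) by (rule fil_mult)
  then have "T \<in> \<MM> t"
    unfolding T_def by (rule fil_mult_left[OF fil_mono]) (simp add: r)
  then have 1: "F' - T \<in> \<MM> t" using F'(1) by (rule fil_diff[rotated])
  have "T \<in> ideal_mod I (Suc t)"
    unfolding T_def by (intro ideal_mod_props(2)[OF I_ideal] ideal_mod_props(4)[OF I_ideal q_I])
  from ideal_mod_props(1)[OF I_ideal F'(3) this] have 2: "F - (F' - T) \<in> ideal_mod I (Suc t)"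
    by (simp add: algebra_simps)
  have 3: "(F' - T) $ i = 0" if "i > 0" for i
    using that F'(2)[OF that] by (simp add: fps_eq_iff T_nth)
  have 4: "(F' - T) $ 0 $ j $ k = 0" if jk: "j + k = t" "J \<le> j" "j < J + Suc m" for j k
  proof (cases "j = J + m")
    case True
    then have "k = e - J + r" using jk(1) J(1) r by simp
    then show ?thesis using J(2) by (simp add: T_nth True d_def)
  next
    case False
    then have j: "j < J + m" using jk by simp
    have "T $ 0 $ j $ k = 0"
    proof (cases "m \<le> j \<and> r \<le> k")
      case True
      then have "q $ (j - m) $ (k - r) = 0"
        using j jk(1) r by (intro J(3)) auto
      then show ?thesis by (simp add: T_nth)
    qed (auto simp: T_nth)
    then show ?thesis using F'(4)[OF jk(1,2) j] by simp
  qed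
  show ?case
    using 1 2 3 4 by (intro bexI[of _ "F' - T"]) blast+
qed

lemma spans_E:
  assumes "2 \<le> t"
  shows "spans_mod I t (E t)"
  unfolding spans_mod_def
proof
  note pr = ideal_mod_props[OF I_ideal]
  fix F :: "'a ps3" assume F: "F \<in> \<MM> t"
  define t' where "t' = t - 2"
  then have t: "t = t' + 2" "t' + 1 = t - 1" "t' + 3 = Suc t" using assms by simp_all
  obtain c B where B: "emb_yz B \<in> \<MM> t"
    "F - (emb_K c * monom3 (1, 0, t - 1) + emb_yz B) \<in> ideal_mod I (Suc t)"
    using span_basic[OF F[unfolded t(1)]] unfolding t(2,3) t(1)[symmetric] .
  \<comment> \<open>\<open>t + 1 - e\<close> is the number of monomials to be cleared in degree
    \<open>t\<close>; truncated subtraction makes it zero for \<open>t < e\<close>.\<close>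
  have "\<exists>F'\<in>\<MM> t. (\<forall>i>0. F' $ i = 0) \<and> emb_yz B - F' \<in> ideal_mod I (Suc t) \<and>
    (\<forall>j k. j + k = t \<longrightarrow> J \<le> j \<longrightarrow> j < J + (t + 1 - e) \<longrightarrow> F' $ 0 $ j $ k = 0)"
  proof (cases "e \<le> t + 1")
    case True
    then show ?thesis using B(1) by (intro divide_by_q) auto
  next
    case False
    then show ?thesis using B(1) pr(5)[of "emb_yz B - emb_yz B" "Suc t"]
      by (intro bexI[of _ "emb_yz B"]) auto
  qed
  then obtain F' where F': "F' \<in> \<MM> t" "\<And>i. i > 0 \<Longrightarrow> F' $ i = 0" "emb_yz B - F' \<in> ideal_mod I (Suc t)"
    "\<And>j k. j + k = t \<Longrightarrow> J \<le> j \<Longrightarrow> j < J + (t + 1 - e) \<Longrightarrow> F' $ 0 $ j $ k = 0" by blast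
  define X where "X = (if t \<le> n then emb_K c * monom3 (1, 0, t - 1) else 0)"
  have X: "emb_K c * monom3 (1, 0, t - 1) - X \<in> ideal_mod I (Suc t)"
  proof (cases "t \<le> n")
    case True
    then show ?thesis using pr(5)[OF zero_fil, of "Suc t"] by (simp add: X_def)
  next
    case False
    then show ?thesis using x_z_power_reduces[of t c] by (simp add: X_def)
  qed
  have "F' - hpart t F' \<in> ideal_mod I (Suc t)"
    using diff_hpart_MM[OF F'(1)] by (rule pr(5))
  from pr(1)[OF pr(1)[OF B(2) X] pr(1)[OF F'(3) this]]
  have "F - (X + hpart t F') \<in> ideal_mod I (Suc t)"
    by (simp add: algebra_simps)
  moreover have "supp (X + hpart t F') \<subseteq> E t"
    unfolding supp_subset_iff
  proof (intro allI impI)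
    fix i j k assume *: "(i, j, k) \<notin> E t"
    have "X $ i $ j $ k = 0"
      using * by (auto simp: X_def E_def)
    moreover have "hpart t F' $ i $ j $ k = 0"
    proof (cases "i = 0 \<and> j + k = t")
      case True
      then have "\<not> P t j" using * by (simp add: E_def mem_std)
      then have "F' $ 0 $ j $ k = 0" using True by (intro F'(4)) (auto simp: P_def)
      then show ?thesis using True by simp
    next
      case False
      then show ?thesis using F'(2)[of i] by (cases "i = 0") auto
    qed
    ultimately show "(X + hpart t F') $ i $ j $ k = 0" by simp
  qed
  ultimately show "\<exists>G. supp G \<subseteq> E t \<and> F - G \<in> ideal_mod I (Suc t)" by blast
qed

text \<open>The term of lowest \<open>y\<close>-degree in the product of the lowest forms of
  \<open>\<tau>\<close> and \<open>q\<close> is divisible by \<open>y^J z^(e-J)\<close>. It cannot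
  occur in \<open>G\<close>, so nothing cancels it.\<close>

lemma q_multiple_not_standard:
  assumes \<tau>: "emb_yz \<tau> \<in> \<MM> m" and t: "t = m + e" and G: "\<And>j k. j + k = t \<Longrightarrow> \<not> P t j \<Longrightarrow> G $ j $ k = 0"
    and sum: "emb_yz \<tau> * emb_yz q + emb_yz G \<in> \<MM> (Suc t)"
  shows "emb_yz \<tau> \<in> \<MM> (Suc m)"
proof (rule ccontr)
  assume "emb_yz \<tau> \<notin> \<MM> (Suc m)"
  define T where "T = hpart m (emb_yz \<tau>) $ 0"
  have T_nth: "T $ j $ k = (if j + k = m then \<tau> $ j $ k else 0)" for j k
    by (simp add: T_def)
  have "T \<noteq> 0"
  proof
    assume "T = 0"
    then have "\<tau> $ j $ k = 0" if "j + k = m" for j k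
      using T_nth[of j k] that by simp
    then have "emb_yz \<tau> \<in> \<MM> (Suc m)"
      using \<tau> by (auto simp: emb_yz_MM less_Suc_eq)
    with \<open>emb_yz \<tau> \<notin> \<MM> (Suc m)\<close> show False ..
  qed
  define i where "i = subdegree T"
  have "(T * Q) $ (i + J) = T $ i * Q $ J"
    by (simp add: i_def J_def)
  moreover have "T $ i \<noteq> 0" "Q $ J \<noteq> 0"
    using \<open>T \<noteq> 0\<close> Q_nz by (simp_all add: i_def J_def)
  ultimately have "(T * Q) $ (i + J) \<noteq> 0" by simp
  then obtain k where k: "(T * Q) $ (i + J) $ k \<noteq> 0" by (auto simp: fps_eq_iff)
  have "i \<le> m"
  proof -
    obtain k' where "T $ i $ k' \<noteq> 0" using \<open>T $ i \<noteq> 0\<close> by (auto simp: fps_eq_iff)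
    then show ?thesis using T_nth[of i k'] by (auto split: if_splits)
  qed
  have "T * Q = hpart t (emb_yz \<tau> * emb_yz q) $ 0"
    unfolding t hpart_mult[OF \<tau> qe(1)] by (simp add: T_def Q_def fps_mult_nth_0)
  then have ne: "hpart t (emb_yz \<tau> * emb_yz q) $ 0 $ (i + J) $ k \<noteq> 0" using k by simp
  then have "i + J + k = t" by (simp split: if_splits)
  moreover have "\<not> P t (i + J)"
    using \<open>i \<le> m\<close> t by (simp add: P_def)
  ultimately have "G $ (i + J) $ k = 0" using G by blast
  moreover have "(emb_yz \<tau> * emb_yz q + emb_yz G) $ 0 $ (i + J) $ k = 0"
    using \<open>i + J + k = t\<close> by (intro MMD[OF sum]) simp
  ultimately show False using ne \<open>i + J + k = t\<close> by simp
qed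

text \<open>A combination \<open>c x z^(t-1) + G\<close> of monomials in \<open>E t\<close> that
  vanishes modulo \<open>I\<close> is compared with \<open>A x + B\<close> from
  \<open>I_repr\<close>. Once \<open>c = 0\<close> is known, \<open>\<gamma> A\<close> has high
  order, and so has \<open>\<tau> q + y G\<close>. The terms of \<open>\<tau>\<close> free of
  \<open>y\<close> turn out to be negligible; after cancelling \<open>y\<close> the previous lemma
  applies.\<close>

lemma indep_E:
  assumes "2 \<le> t"
  shows "indep_mod I t (E t)"
  unfolding indep_mod_def
proof (intro ballI impI)
  fix F assume F: "F \<in> ideal_mod I (Suc t)" "supp F \<subseteq> E t"
  obtain u where u: "u \<in> I" "F - u \<in> \<MM> (Suc t)"
    using F(1) by (auto simp: ideal_mod_def)
  obtain w s \<tau> where w: "u = w * f + emb_yz (fps_X * s + \<tau> * fps_const \<gamma>) * var_x + emb_yz (s * fps_const \<gamma> - \<tau> * D)"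
    using I_repr[OF u(1)] .
  define A B where "A = fps_X * s + \<tau> * fps_const \<gamma>" and "B = s * fps_const \<gamma> - \<tau> * D"
  define c where "c = F $ 1 $ 0 $ (t - 1)"
  define G where "G = F $ 0"
  have supp: "F $ i $ j $ k = 0" if "(i, j, k) \<notin> E t" for i j k
    using F(2) that by (simp add: supp_subset_iff)
  have "F $ i $ j $ k = (emb_K c * monom3 (1, 0, t - 1) + emb_yz G) $ i $ j $ k" for i j k
    using supp[of i j k] by (cases "i = 0") (auto simp: G_def c_def E_def mem_std split: if_splits)
  then have "F = emb_K c * monom3 (1, 0, t - 1) + emb_yz G"
    by (simp only: ps3_eq_iff) simp
  then have Fc: "F = emb_K c * (var_z ^ (t - 1) * var_x) + emb_yz G"
    by (simp add: monom3_def mult.commute[of var_x])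
  have c0: "c = 0" if "n < t"
    using that supp[of 1 0 "t - 1"] by (simp add: c_def E_def mem_std)
  have G: "G $ j $ k = 0" if "\<not> (j + k = t \<and> P t j)" for j k
    using that supp[of 0 j k] by (auto simp: G_def E_def mem_std)
  have "u - F = w * f + emb_yz (A - fps_const (fps_const c * fps_X ^ (t - 1))) * var_x + emb_yz (B - G)"
    unfolding w Fc A_def[symmetric] B_def[symmetric]
    by (auto simp: emb_yz_hom ps3_eq_iff algebra_simps)
  then have "w * f + emb_yz (A - fps_const (fps_const c * fps_X ^ (t - 1))) * var_x + emb_yz (B - G) \<in> \<MM> ((t - 1) + 2)"
    using fil_diff_commute[OF u(2)] assms by simp
  from division_order[OF f_initial this] assms
  have A: "emb_yz (A - fps_const (fps_const c * fps_X ^ (t - 1))) \<in> \<MM> t" and B: "emb_yz (B - G) \<in> \<MM> (Suc t)"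
    by simp_all
  have A0: "A $ 0 = \<tau> $ 0 * \<gamma>" by (simp add: A_def)
  have "A $ 0 $ (t - 1) = c"
    using MMD[OF A, of 0 0 "t - 1"] assms by simp
  moreover have "A $ 0 $ (t - 1) = 0" if "t \<le> n"
  proof -
    have "emb_z (\<tau> $ 0) * emb_z \<gamma> \<in> \<MM> n" using \<gamma>n by (rule fil_mult_left)
    then have "emb_z (A $ 0) \<in> \<MM> n"
      by (simp add: A0 emb_z_def)
    then show ?thesis using that assms by (simp add: emb_z_MM)
  qed
  \<comment> \<open>For \<open>t \<le> n\<close> the product \<open>\<tau> \<gamma>\<close> at
    \<open>y = 0\<close> has no term in \<open>z^(t-1)\<close>; for \<open>n < t\<close> the
    monomial \<open>x z^(t-1)\<close> is not in \<open>E t\<close>.\<close>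
  ultimately have c: "c = 0" using c0 by fastforce
  then have At: "emb_yz A \<in> \<MM> t" using A by simp
  have Gt: "emb_yz G \<in> \<MM> t" using G by (simp add: emb_yz_MM)
  have Bt: "emb_yz B \<in> \<MM> t"
    using fil_cong[OF fil_mono[OF B[unfolded emb_yz_hom], of t]] Gt by simp
  \<comment> \<open>Elimination of \<open>s\<close> from the formulas for \<open>A\<close> and
    \<open>B\<close>.\<close>
  have eq: "emb_yz \<tau> * emb_yz q + var_y * emb_yz B = emb_z \<gamma> * emb_yz A"
    unfolding q_def A_def B_def emb_yz_hom var_y_def emb_z_eq_emb_yz
    by (simp add: algebra_simps power2_eq_square)
  have "emb_z \<gamma> * emb_yz A \<in> \<MM> (t + 2)"
    using \<gamma>n At n by (intro fil_mult_le[of _ _ n _ t]) simp_all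
  then have sum: "emb_yz \<tau> * emb_yz q + var_y * emb_yz B \<in> \<MM> (t + 2)"
    by (simp only: eq)
  have BG: "var_y * emb_yz (B - G) \<in> \<MM> (t + 2)"
    using B by simp
  have sumG: "emb_yz \<tau> * emb_yz q + var_y * emb_yz G \<in> \<MM> (t + 2)"
    using fil_diff[OF sum BG] by (simp add: emb_yz_hom algebra_simps)
  have fin: "emb_yz G \<in> \<MM> (Suc t)" if "emb_yz \<tau> * emb_yz q \<in> \<MM> (t + 2)"
    using fil_diff[OF sumG that] by simp
  have "emb_yz G \<in> \<MM> (Suc t)"
  proof (cases "t + 2 \<le> e")
    case True
    then have "emb_yz \<tau> * emb_yz q \<in> \<MM> (t + 2)"
      using qe(1) by (intro fil_mult_left) (rule fil_mono)
    then show ?thesis by (rule fin)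
  next
    case False
    define m where "m = t + 1 - e"
    have m: "t + 1 = e + m" using False by (simp add: m_def)
    have "var_y * emb_yz G \<in> \<MM> (t + 1)" using Gt by simp
    from fil_diff[OF fil_mono[OF sumG, of "t + 1"] this]
    have "emb_yz q * emb_yz \<tau> \<in> \<MM> (e + m)" by (simp add: m[symmetric] mult.commute)
    then have \<tau>: "emb_yz \<tau> \<in> \<MM> m"
      using mult_MM_cancel[OF qe] by blast
    \<comment> \<open>At \<open>y = 0\<close> only \<open>\<tau> \<gamma>\<close> remains of
      \<open>A\<close>, so \<open>\<tau>\<close> there has order at least \<open>t - n\<close>. By
      \<open>n + 3 \<le> e\<close> this exceeds \<open>m\<close>, so \<open>\<tau>\<close> is
      divisible by \<open>y\<close> up to negligible terms.\<close>
    have "emb_z \<gamma> \<notin> \<MM> (Suc n)" using \<gamma>nz by (auto simp: emb_z_MM)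
    moreover have "emb_z \<gamma> * emb_z (\<tau> $ 0) \<in> \<MM> (n + (t - n))"
    proof -
      have "emb_z (A $ 0) \<in> \<MM> t" using At by (simp add: emb_z_MM emb_yz_MM)
      then show ?thesis using m e n by (simp add: A0 emb_z_def mult.commute)
    qed
    ultimately have "emb_z (\<tau> $ 0) \<in> \<MM> (t - n)"
      using mult_MM_cancel[OF \<gamma>n] by blast
    then have \<tau>0: "emb_z (\<tau> $ 0) \<in> \<MM> (Suc m)"
      using m e n by (elim fil_mono) simp
    define \<tau>1 where "\<tau>1 = fps_shift 1 \<tau>"
    have \<tau>eq: "emb_yz \<tau> = emb_z (\<tau> $ 0) + var_y * emb_yz \<tau>1"
      by (auto simp: ps3_eq_iff \<tau>1_def fps_X_mult_nth)
    have \<tau>0q: "emb_z (\<tau> $ 0) * emb_yz q \<in> \<MM> (t + 2)"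
      using \<tau>0 qe(1) m by (intro fil_mult_le[of _ _ "Suc m" _ e]) simp_all
    have "emb_yz \<tau> * emb_yz q + var_y * emb_yz G - emb_z (\<tau> $ 0) * emb_yz q \<in> \<MM> (t + 2)"
      using sumG \<tau>0q by (rule fil_diff)
    then have "var_y * (emb_yz \<tau>1 * emb_yz q + emb_yz G) \<in> \<MM> (Suc (Suc t))"
      by (simp add: \<tau>eq algebra_simps)
    then have sum1: "emb_yz \<tau>1 * emb_yz q + emb_yz G \<in> \<MM> (Suc t)" by (simp only: var_y_mult_MM)
    show ?thesis
    \<comment> \<open>The comparison of lowest forms needs \<open>\<tau>1\<close> of order
      \<open>m - 1\<close>. For \<open>m = 0\<close> the series \<open>y q\<close> already has order
      at least \<open>t + 2\<close>.\<close>
    proof (cases m)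
      case 0
      then have "var_y * (emb_yz \<tau>1 * emb_yz q) \<in> \<MM> (t + 2)"
        using m by (intro fil_mult_le[OF var_y_MM fil_mult_left[OF qe(1)]]) simp
      from fil_add[OF \<tau>0q this] have "emb_yz \<tau> * emb_yz q \<in> \<MM> (t + 2)"
        by (simp add: \<tau>eq algebra_simps)
      then show ?thesis by (rule fin)
    next
      case (Suc m')
      have "var_y * emb_yz \<tau>1 \<in> \<MM> (Suc m')"
        using fil_diff[OF \<tau> fil_mono[OF \<tau>0, of m]] by (simp add: \<tau>eq Suc)
      then have "emb_yz \<tau>1 \<in> \<MM> m'" by simp
      then have "emb_yz \<tau>1 \<in> \<MM> (Suc m')"
        using m Suc G sum1 by (intro q_multiple_not_standard[of _ _ t G]) auto
      then have "emb_yz \<tau>1 * emb_yz q \<in> \<MM> (Suc t)"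
        using qe(1) m Suc by (intro fil_mult_le[of _ _ "Suc m'" _ e]) simp_all
      from fil_diff[OF sum1 this] show ?thesis by simp
    qed
  qed
  then have "G = 0"
    using G by (fastforce simp: fps_eq_iff emb_yz_MM)
  then show "F = 0" using c Fc by (simp add: emb_K_hom emb_yz_hom)
qed

lemma hilbert_function_normal_form: "hilbert_function I = H_fun n e"
proof
  fix t :: nat
  consider "t = 0" | "t = 1" | "2 \<le> t" by linarith
  then show "hilbert_function I t = H_fun n e t"
  proof cases
    case 1
    then show ?thesis using hilbert_function_small[of 0] card_degs_0 by (simp add: H_fun_def)
  next
    case 2
    then show ?thesis using hilbert_function_small[of 1] card_degs_1 n by (simp add: H_fun_def)
  next
    case 3
    then show ?thesis
      using hilbert_function_eq_card[OF I_ideal I_MM1 E_degs spans_E indep_E] card_E by simp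
  qed
qed

end

end

section \<open>The order of \<open>q\<close> and the generators of the theorem\<close>

lemma MM_order_exists: "F \<notin> \<MM> N \<Longrightarrow> \<exists>m. F \<in> \<MM> m \<and> F \<notin> \<MM> (Suc m)"
  by (induction N) auto

lemma ps_order_ge_iff: "enat N \<le> ps_order F \<longleftrightarrow> F \<in> \<MM> N"
proof (cases "F = 0")
  case True
  then show ?thesis by (simp add: ps_order_def)
next
  case False
  let ?P = "\<lambda>v. \<exists>i j k. i + j + k = v \<and> F $ i $ j $ k \<noteq> 0"
  have ex: "\<exists>v. ?P v" using False by (auto simp: ps3_eq_iff)
  have "enat N \<le> ps_order F \<longleftrightarrow> N \<le> (LEAST v. ?P v)"
    using False by (simp add: ps_order_def)
  also have "\<dots> \<longleftrightarrow> (\<forall>v<N. \<not> ?P v)"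
    using LeastI_ex[OF ex] not_less_Least[of _ ?P] by (metis linorder_not_less order_less_le_trans)
  also have "\<dots> \<longleftrightarrow> F \<in> \<MM> N"
    unfolding fil_def by auto
  finally show ?thesis .
qed

lemma ps_order_eq_iff: "ps_order F = enat N \<longleftrightarrow> F \<in> \<MM> N \<and> F \<notin> \<MM> (Suc N)"
proof -
  have "ps_order F = enat N \<longleftrightarrow> enat N \<le> ps_order F \<and> \<not> enat (Suc N) \<le> ps_order F"
    by (cases "ps_order F") auto
  then show ?thesis by (simp only: ps_order_ge_iff)
qed

lemma ideal_gen_pair_eqI:
  assumes "F' = u1 * F + v1 * G" "G' = u2 * F + v2 * G" "F = u3 * F' + v3 * G'" "G = u4 * F' + v4 * G'"
  shows "ideal_gen {F, G} = ideal_gen {F', G'}"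
proof
  have "F \<in> ideal_gen {F', G'}" "G \<in> ideal_gen {F', G'}"
    unfolding ideal_gen_pair using assms(3,4) by blast+
  then show "ideal_gen {F, G} \<subseteq> ideal_gen {F', G'}"
    by (intro ideal_gen_minimal ideal_gen_ideal) auto
  have "F' \<in> ideal_gen {F, G}" "G' \<in> ideal_gen {F, G}"
    unfolding ideal_gen_pair using assms(1,2) by blast+
  then show "ideal_gen {F', G'} \<subseteq> ideal_gen {F, G}"
    by (intro ideal_gen_minimal ideal_gen_ideal) auto
qed

text \<open>Below \<open>2 n\<close> the order of \<open>q\<close> is one more than that of
  \<open>D\<close>. The term \<open>z^(2n)\<close> of \<open>\<gamma>^2\<close> has no counterpart
  in \<open>y D\<close>, so the order never exceeds \<open>2 n\<close>, and for
  \<open>e = 2 n\<close> it is attained whatever the lowest form of \<open>D\<close> is.\<close>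

lemma (in normal_form) q_order_iff:
  assumes \<gamma>n: "emb_z \<gamma> \<in> \<MM> n" and \<gamma>nz: "\<gamma> $ n \<noteq> 0" and "1 \<le> e"
  shows "emb_yz q \<in> \<MM> e \<and> emb_yz q \<notin> \<MM> (Suc e) \<longleftrightarrow>
    e \<le> 2 * n \<and> emb_yz D \<in> \<MM> (e - 1) \<and> (e < 2 * n \<longrightarrow> emb_yz D \<notin> \<MM> e)"
proof -
  have g2: "emb_z \<gamma> ^ 2 \<in> \<MM> (2 * n)"
    using \<gamma>n by (rule fil_power)
  have "(\<gamma> ^ 2) $ (n + n) = \<gamma> $ n * \<gamma> $ n"
  proof -
    have "subdegree \<gamma> = n"
      using \<gamma>n \<gamma>nz by (intro subdegreeI) (simp_all add: emb_z_MM)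
    then show ?thesis
      using nth_subdegree_mult[of \<gamma> \<gamma>] by (simp add: power2_eq_square)
  qed
  then have q2n: "q $ 0 $ (2 * n) \<noteq> 0"
    using \<gamma>nz by (simp add: q_def mult_2 fps_const_power)
  have ev: "emb_yz q \<in> \<MM> N \<longleftrightarrow> emb_yz D \<in> \<MM> (N - 1)" if "1 \<le> N" "N \<le> 2 * n" for N
  proof -
    have "emb_yz q - var_y * emb_yz D \<in> \<MM> N"
      unfolding emb_q using fil_mono[OF g2 that(2)] by simp
    from fil_cong[OF this] have "emb_yz q \<in> \<MM> N \<longleftrightarrow> var_y * emb_yz D \<in> \<MM> (Suc (N - 1))"
      using that(1) by simp
    then show ?thesis by (simp only: var_y_mult_MM)
  qed
  have le: "N \<le> 2 * n" if "emb_yz q \<in> \<MM> N" for N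
  proof (rule ccontr)
    assume "\<not> N \<le> 2 * n"
    then have "emb_yz q $ 0 $ 0 $ (2 * n) = 0"
      using that by (intro MMD) auto
    then show False using q2n by simp
  qed
  show ?thesis
    using ev[of e] ev[of "Suc e"] le[of e] le[of "Suc e"] \<open>1 \<le> e\<close> by (cases "e < 2 * n") auto
qed

lemma emb_z_mult: "emb_z (a * c) = emb_z a * emb_z c"
  by (simp add: emb_z_def)

lemma emb_z_power: "emb_z (fps_X ^ n) = var_z ^ n"
  by (simp add: emb_z_def var_z_def fps_const_power)

text \<open>The shift \<open>x \<mapsto> x - H\<close> leads to a normal form with
  \<open>b = a z^p - 2 H\<close>, where \<open>p \<ge> 2\<close> gives
  \<open>\<epsilon> = 0\<close>. Its series \<open>D\<close> is \<open>d\<close>, so the hypotheses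
  on \<open>d\<close> fix the order of \<open>q\<close>.\<close>

lemma hilbert_function_generators:
  fixes a :: "'a::field_char_0"
  assumes L: "emb_yz L \<in> \<MM> (n + 1)" and H: "emb_yz H \<in> \<MM> 2" and "2 \<le> p" "is_unit \<alpha>" "3 \<le> n" "n + 3 \<le> e" "e \<le> 2 * n"
    and d_def: "d = 2 * emb_z \<alpha> * var_z ^ n * emb_yz H - emb_K a * emb_z \<alpha> * var_z ^ (n + p) + var_y * emb_yz L"
    and d: "d \<in> \<MM> (e - 1)" and d': "e < 2 * n \<Longrightarrow> d \<notin> \<MM> e"
  shows "hilbert_function (ideal_gen
      {var_x ^ 2 + emb_K a * var_z ^ p * (var_x + emb_yz H) - emb_yz H ^ 2 + emb_yz L,
       var_x * var_y + emb_z \<alpha> * var_z ^ n + var_y * emb_yz H}) = H_fun n e"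
    (is "hilbert_function (ideal_gen {?F, ?G}) = _")
proof -
  define b where "b = fps_const (fps_const a * fps_X ^ p) - 2 * H"
  define \<gamma> where "\<gamma> = \<alpha> * fps_X ^ n"
  have emb_\<gamma>: "emb_z \<gamma> = emb_z \<alpha> * var_z ^ n"
    by (simp add: \<gamma>_def emb_z_mult emb_z_power)
  have two: "emb_yz (2 * H) = 2 * emb_yz H"
    unfolding mult_2 by (rule emb_yz_hom)
  have "emb_yz (fps_const (fps_const a * fps_X ^ p)) = emb_K a * var_z ^ p"
    by (simp only: emb_z_eq_emb_yz[symmetric] emb_z_mult emb_z_power emb_K_eq_emb_z)
  then have emb_b: "emb_yz b = emb_K a * var_z ^ p - 2 * emb_yz H"
    unfolding b_def emb_yz_hom(2) two by (simp only:)
  have \<gamma>n: "emb_z \<gamma> \<in> \<MM> n"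
    unfolding emb_\<gamma> by (intro fil_mult_left var_z_power_MM)
  have "emb_yz b \<in> \<MM> 2"
    unfolding emb_b using fil_mono[OF var_z_power_MM \<open>2 \<le> p\<close>] H by (intro fil_diff fil_mult_left)
  then interpret nf: normal_form 0 b L \<gamma>
    using fil_mono[OF L, of 3] fil_mono[OF \<gamma>n, of 3] \<open>3 \<le> n\<close>
    by unfold_locales (simp_all add: emb_K_hom)
  have D: "emb_yz nf.D = d"
    unfolding d_def nf.emb_D emb_b emb_\<gamma> by (simp add: algebra_simps power_add)
  have "\<alpha> $ 0 \<noteq> 0" using \<open>is_unit \<alpha>\<close> by (simp add: fps_is_unit_iff)
  then have "\<gamma> $ n \<noteq> 0" by (simp add: \<gamma>_def fps_X_power_mult_right_nth)
  have q: "emb_yz nf.q \<in> \<MM> e \<and> emb_yz nf.q \<notin> \<MM> (Suc e)"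
    using d d' \<open>e \<le> 2 * n\<close> \<open>n + 3 \<le> e\<close>
    by (subst nf.q_order_iff[OF \<gamma>n \<open>\<gamma> $ n \<noteq> 0\<close>]) (simp_all add: D)
  have "emb_yz nf.D \<in> \<MM> (n + 2)"
    unfolding D using \<open>n + 3 \<le> e\<close> by (intro fil_mono[OF d]) simp
  then have HF: "hilbert_function nf.I = H_fun n e"
    using q \<open>3 \<le> n\<close> \<open>n + 3 \<le> e\<close> \<gamma>n \<open>\<gamma> $ n \<noteq> 0\<close> by (intro nf.hilbert_function_normal_form) simp_all
  have "emb_yz (- H) \<in> \<MM> 2" using H by (simp add: emb_yz_hom)
  then obtain \<psi> where \<psi>: "K_algebra_automorphism \<psi>" "\<psi> var_x = var_x + emb_yz (- H)"
    "\<And>A. \<psi> (emb_yz A) = emb_yz A"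
    by (rule shift_x_automorphism) blast
  have h: "K_hom \<psi>" using \<psi>(1) by (simp add: K_algebra_automorphism_iff)
  have yz: "\<psi> var_y = var_y" "\<psi> var_z = var_z" "\<psi> (emb_z c) = emb_z c" for c
    using \<psi>(3) by (simp_all add: var_y_def var_z_eq_emb_z emb_z_eq_emb_yz)
  have "\<psi> ?F = nf.f"
    by (simp add: K_hom_simps[OF h] \<psi> yz nf.f_def emb_b emb_yz_hom algebra_simps power2_eq_square)
  moreover have "\<psi> ?G = nf.g"
    by (simp add: K_hom_simps[OF h] \<psi> yz nf.g_def emb_\<gamma> emb_yz_hom algebra_simps)
  ultimately have im: "\<psi> ` ideal_gen {?F, ?G} = nf.I"
    by (simp only: automorphism_image_ideal_gen[OF \<psi>(1)] nf.I_def)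
  have "nf.f \<in> \<MM> (Suc 0)" "nf.g \<in> \<MM> (Suc 0)"
    using nf.f_I nf.g_I nf.I_MM1 by auto
  then have "?F \<in> \<MM> (Suc 0)" "?G \<in> \<MM> (Suc 0)"
    unfolding \<open>\<psi> ?F = nf.f\<close>[symmetric] \<open>\<psi> ?G = nf.g\<close>[symmetric] automorphism_MM[OF \<psi>(1)] .
  from hilbert_function_automorphism[OF \<psi>(1) this] show ?thesis
    using HF by (simp only: im)
qed

text \<open>Both initial forms have degree 2; a dependence over \<open>K\<close> would make that of
  \<open>g\<close> a scalar multiple of that of \<open>f\<close>, hence an element of the ideal it
  generates.\<close>

lemma type_2_2_initial:
  assumes "type_2_2 (I :: 'a::field ps3 set)"
  obtains f g where "I = ideal_gen {f, g}" "f \<in> \<MM> 2" "g \<in> \<MM> 2"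
    "\<And>c d. emb_K c * hpart 2 f + emb_K d * hpart 2 g = 0 \<Longrightarrow> c = 0 \<and> d = 0"
proof -
  obtain f g where fg: "I = ideal_gen {f, g}" "ps_order f = 2" "ps_order g = 2"
    "initial_form g \<notin> ideal_gen {initial_form f}"
    using assms unfolding type_2_2_def by blast
  have two: "(2 :: enat) = enat 2" by (simp add: numeral_eq_enat)
  have M: "f \<in> \<MM> 2" "f \<notin> \<MM> (Suc 2)" "g \<in> \<MM> 2"
    using fg(2,3) unfolding two ps_order_eq_iff by simp_all
  have ind: "c = 0 \<and> d = 0" if rel: "emb_K c * hpart 2 f + emb_K d * hpart 2 g = 0" for c d
  proof -
    have coef: "c * f $ i $ j $ k + d * g $ i $ j $ k = 0" if "i + j + k = 2" for i j k
    proof -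
      have "(emb_K c * hpart 2 f + emb_K d * hpart 2 g) $ i $ j $ k = 0" by (simp add: rel)
      then show ?thesis using that by simp
    qed
    have "d = 0"
    proof (rule ccontr)
      assume "d \<noteq> 0"
      define s where "s = - c / d"
      have g: "g $ i $ j $ k = s * f $ i $ j $ k" if "i + j + k = 2" for i j k
        using coef[OF that] \<open>d \<noteq> 0\<close> by (simp add: s_def field_simps eq_neg_iff_add_eq_0)
      have "initial_form g = [:[:[:s:]:]:] * initial_form f"
        unfolding initial_form_def Let_def fg(2,3) two the_enat.simps sum_distrib_left
        by (intro sum.cong refl) (auto simp: g smult_monom)
      then have "initial_form g \<in> ideal_gen {initial_form f}"
        unfolding ideal_gen_single by blast
      with fg(4) show False ..
    qed
    moreover have "c = 0"
    proof (rule ccontr)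
      assume "c \<noteq> 0"
      then have "hpart 2 f = 0"
        using coef \<open>d = 0\<close> by (auto simp: ps3_eq_iff)
      then show False using M unfolding MM_Suc_iff[of f 2] by simp
    qed
    ultimately show ?thesis by simp
  qed
  show ?thesis using that[OF fg(1) M(1,3)] ind by blast
qed

lemma card_degs_3: "card (degs 3) \<le> 10"
proof -
  have "degs 3 \<subseteq> (\<lambda>(i, j). (i, j, 3 - i - j)) ` Sigma {..3} (\<lambda>i. {..3 - i})"
    by (force simp: degs_def image_iff)
  moreover have "finite (Sigma {..3::nat} (\<lambda>i. {..3 - i}))" by simp
  ultimately have "card (degs 3) \<le> card (Sigma {..3::nat} (\<lambda>i. {..3 - i}))"
    by (meson card_image_le card_mono finite_imageI le_trans)
  also have "\<dots> = 10"
    by (simp add: numeral_3_eq_3 atMost_Suc)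
  finally show ?thesis .
qed

section \<open>Coordinate changes\<close>

text \<open>Six products of a variable with a quadric lie in the space of cubics, of dimension 10.
  Were they independent, the Hilbert function in degree 3 would be at most 4.\<close>

lemma linear_relation:
  fixes f g :: "'a::field ps3"
  assumes f: "f \<in> \<MM> 2" and g: "g \<in> \<MM> 2" and HF: "hilbert_function (ideal_gen {f, g}) 3 = 5"
  obtains a1 a2 a3 b1 b2 b3 where "lin a1 a2 a3 * hpart 2 f + lin b1 b2 b3 * hpart 2 g = 0"
    "a1 \<noteq> 0 \<or> a2 \<noteq> 0 \<or> a3 \<noteq> 0 \<or> b1 \<noteq> 0 \<or> b2 \<noteq> 0 \<or> b3 \<noteq> 0"
proof -
  let ?I = "ideal_gen {f, g}"
  define v where "v = (!) [var_x * hpart 2 f, var_y * hpart 2 f, var_z * hpart 2 f,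
    var_x * hpart 2 g, var_y * hpart 2 g, var_z * hpart 2 g]"
  have sub: "?I \<subseteq> \<MM> (Suc 0)"
    using f g fil_mono[of _ _ 2 "Suc 0"] by (intro ideal_gen_minimal MM_ideal) auto
  have *: "u * hpart 2 F \<in> ideal_mod ?I (Suc 3) \<and> supp (u * hpart 2 F) \<subseteq> degs 3"
    if u: "u \<in> {var_x, var_y, var_z}" and F: "F \<in> {f, g}" for u F
  proof
    have uM: "u \<in> \<MM> (Suc 0)" using u by auto
    have FM: "F \<in> \<MM> 2" using F f g by auto
    have "F \<in> ?I" using F ideal_gen_superset[of "{f, g}"] by auto
    moreover have "hpart 2 F - F \<in> \<MM> (Suc 2)"
      using diff_hpart_MM[OF FM] by (rule fil_diff_commute)
    ultimately have "hpart 2 F \<in> ideal_mod ?I (Suc 2)"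
      by (auto simp: ideal_mod_def)
    then have "u * hpart 2 F \<in> ideal_mod ?I (Suc (Suc 2))"
      using uM by (intro ideal_mod_mult_Suc ideal_gen_ideal)
    then show "u * hpart 2 F \<in> ideal_mod ?I (Suc 3)" by (simp add: numeral_3_eq_3 numeral_2_eq_2)
    show "supp (u * hpart 2 F) \<subseteq> degs 3"
      using u by (auto simp: supp_subset_iff degs_def fps_X_mult_nth)
  qed
  have v: "v i \<in> ideal_mod ?I (Suc 3) \<and> supp (v i) \<subseteq> degs 3" if "i < 6" for i
  proof -
    have "\<forall>w\<in>set [var_x * hpart 2 f, var_y * hpart 2 f, var_z * hpart 2 f,
      var_x * hpart 2 g, var_y * hpart 2 g, var_z * hpart 2 g]. w \<in> ideal_mod ?I (Suc 3) \<and> supp w \<subseteq> degs 3"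
      using * by simp
    then show ?thesis
      unfolding v_def using that by (intro bspec[OF _ nth_mem]) auto
  qed
  have "\<exists>c i. (\<Sum>i<6. emb_K (c i) * v i) = 0 \<and> i < 6 \<and> c i \<noteq> 0"
  proof (rule ccontr)
    assume "\<not> ?thesis"
    then have "hilbert_function ?I 3 + 6 \<le> card (degs 3)"
      using v by (intro hilbert_function_relations[OF ideal_gen_ideal sub order_refl spans_mod_degs[OF ideal_gen_ideal]]) blast+
    then show False using HF card_degs_3 by simp
  qed
  then obtain c i where c: "(\<Sum>i<6. emb_K (c i) * v i) = 0" "i < 6" "c i \<noteq> 0" by blast
  have "lin (c 0) (c 1) (c 2) * hpart 2 f + lin (c 3) (c 4) (c 5) * hpart 2 g = (\<Sum>i<6. emb_K (c i) * v i)"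
    by (simp add: v_def lin_def eval_nat_numeral algebra_simps)
  moreover have "i \<in> {0, 1, 2, 3, 4, 5}" using c(2) by auto
  then have "c 0 \<noteq> 0 \<or> c 1 \<noteq> 0 \<or> c 2 \<noteq> 0 \<or> c 3 \<noteq> 0 \<or> c 4 \<noteq> 0 \<or> c 5 \<noteq> 0"
    using c(3) by auto
  ultimately show ?thesis
    using c(1) that[of "c 0" "c 1" "c 2" "c 3" "c 4" "c 5"] by auto
qed

lemma lin_nth:
  "lin p q r $ i $ j $ k = (if (i, j, k) = (1, 0, 0) then p else if (i, j, k) = (0, 1, 0) then q
     else if (i, j, k) = (0, 0, 1) then r else 0)"
  by (auto simp: lin_def fps_X_nth)

lemma lin_eq_0_iff: "lin p q r = 0 \<longleftrightarrow> p = 0 \<and> q = 0 \<and> r = 0"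
proof
  assume "lin p q r = 0"
  then have "lin p q r $ 1 $ 0 $ 0 = 0" "lin p q r $ 0 $ 1 $ 0 = 0" "lin p q r $ 0 $ 0 $ 1 = 0" by simp_all
  then show "p = 0 \<and> q = 0 \<and> r = 0" by (simp add: lin_nth)
qed (simp add: lin_def emb_K_hom)

lemma linear_automorphism_inv:
  fixes a1 a2 a3 b1 b2 b3 c1 c2 c3 :: "'a::field"
  assumes "a1 * (b2 * c3 - b3 * c2) - a2 * (b1 * c3 - b3 * c1) + a3 * (b1 * c2 - b2 * c1) \<noteq> 0"
  obtains \<phi> where "K_algebra_automorphism \<phi>" "\<phi> (lin a1 a2 a3) = var_x" "\<phi> (lin b1 b2 b3) = var_y"
    "\<phi> (lin c1 c2 c3) = var_z"
proof -
  obtain \<psi> where \<psi>: "K_algebra_automorphism \<psi>" "\<psi> var_x = lin a1 a2 a3" "\<psi> var_y = lin b1 b2 b3"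
    "\<psi> var_z = lin c1 c2 c3"
    using linear_automorphism[OF assms] .
  have "inv_into UNIV \<psi> (\<psi> F) = F" for F
    using \<psi>(1) by (simp add: K_algebra_automorphism_iff bij_is_inj)
  then show ?thesis
    using that[OF K_algebra_automorphism_inv[OF \<psi>(1)]] \<psi>(2-4) by metis
qed

text \<open>The relation makes \<open>(f, g)\<close> congruent to \<open>(- y l, x l)\<close> for a linear form \<open>l\<close>.\<close>

lemma common_factor_coordinates:
  fixes f g :: "'a::field ps3"
  assumes f: "f \<in> \<MM> 2" and g: "g \<in> \<MM> 2" and HF: "hilbert_function (ideal_gen {f, g}) 3 = 5"
    and ind: "\<And>c d. emb_K c * hpart 2 f + emb_K d * hpart 2 g = 0 \<Longrightarrow> c = 0 \<and> d = 0"
  obtains \<phi> l1 l2 l3 where "K_algebra_automorphism \<phi>" "lin l1 l2 l3 \<noteq> 0"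
    "\<phi> f + var_y * lin l1 l2 l3 \<in> \<MM> 3" "\<phi> g - var_x * lin l1 l2 l3 \<in> \<MM> 3"
proof -
  obtain a1 a2 a3 b1 b2 b3 where
    rel: "lin a1 a2 a3 * hpart 2 f + lin b1 b2 b3 * hpart 2 g = 0"
    and nz: "a1 \<noteq> 0 \<or> a2 \<noteq> 0 \<or> a3 \<noteq> 0 \<or> b1 \<noteq> 0 \<or> b2 \<noteq> 0 \<or> b3 \<noteq> 0"
    using linear_relation[OF f g HF] .
  let ?a = "lin a1 a2 a3" and ?b = "lin b1 b2 b3"
  \<comment> \<open>If \<open>?a\<close> and \<open>?b\<close> were proportional, cancelling a
    common linear factor would leave a dependence over \<open>K\<close> between the two initial
    forms.\<close>
  have minor: "a1 * b2 \<noteq> a2 * b1 \<or> a1 * b3 \<noteq> a3 * b1 \<or> a2 * b3 \<noteq> a3 * b2"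
  proof (rule ccontr)
    assume "\<not> ?thesis"
    then have m: "a1 * b2 = a2 * b1" "a1 * b3 = a3 * b1" "a2 * b3 = a3 * b2" by auto
    have zero: "r = 0 \<and> s = 0" if rs: "emb_K r * ?b = emb_K s * ?a" for r s
    proof -
      have "?a * (emb_K r * hpart 2 f + emb_K s * hpart 2 g) =
          emb_K r * (?a * hpart 2 f + ?b * hpart 2 g) - (emb_K r * ?b - emb_K s * ?a) * hpart 2 g"
        "?b * (emb_K r * hpart 2 f + emb_K s * hpart 2 g) =
          emb_K s * (?a * hpart 2 f + ?b * hpart 2 g) + (emb_K r * ?b - emb_K s * ?a) * hpart 2 f"
        by (simp_all add: algebra_simps)
      then have "?a * (emb_K r * hpart 2 f + emb_K s * hpart 2 g) = 0"
        "?b * (emb_K r * hpart 2 f + emb_K s * hpart 2 g) = 0"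
        using rel rs by simp_all
      moreover have "?a \<noteq> 0 \<or> ?b \<noteq> 0" using nz by (auto simp: lin_eq_0_iff)
      ultimately have "emb_K r * hpart 2 f + emb_K s * hpart 2 g = 0" by auto
      then show ?thesis by (rule ind)
    qed
    have "emb_K a1 * ?b = emb_K b1 * ?a" "emb_K a2 * ?b = emb_K b2 * ?a" "emb_K a3 * ?b = emb_K b3 * ?a"
      using m by (simp_all add: lin_linear mult.commute)
    from this[THEN zero] show False using nz by simp
  qed
  obtain c1 c2 c3 where det: "a1 * (b2 * c3 - b3 * c2) - a2 * (b1 * c3 - b3 * c1) + a3 * (b1 * c2 - b2 * c1) \<noteq> 0"
  proof -
    consider "a1 * b2 \<noteq> a2 * b1" | "a1 * b3 \<noteq> a3 * b1" | "a2 * b3 \<noteq> a3 * b2" using minor by blast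
    then show ?thesis
    proof cases
      case 1 then show ?thesis by (intro that[of 1 0 0]) simp
    next
      case 2 then show ?thesis by (intro that[of 0 1 0]) auto
    next
      case 3 then show ?thesis by (intro that[of 0 0 1]) simp
    qed
  qed
  obtain \<phi> where \<phi>: "K_algebra_automorphism \<phi>" "\<phi> ?a = var_x" "\<phi> ?b = var_y"
    using linear_automorphism_inv[OF det] by metis
  have h: "K_hom \<phi>" using \<phi>(1) by (simp add: K_algebra_automorphism_iff)
  define F where "F = hpart 2 (\<phi> f)"
  define G where "G = hpart 2 (\<phi> g)"
  have hp: "hpart 2 (\<phi> u) = hpart 2 (\<phi> (hpart 2 u))" "\<phi> (hpart 2 u) \<in> \<MM> 2" if "u \<in> \<MM> 2" for u
  proof -
    have "\<phi> (u - hpart 2 u) \<in> \<MM> (Suc 2)"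
      unfolding automorphism_MM[OF \<phi>(1)] by (rule diff_hpart_MM[OF that])
    then show "hpart 2 (\<phi> u) = hpart 2 (\<phi> (hpart 2 u))"
      by (intro hpart_eqI) (simp only: K_hom_simps[OF h])
    show "\<phi> (hpart 2 u) \<in> \<MM> 2"
      unfolding automorphism_MM[OF \<phi>(1)] by (rule hpart_MM)
  qed
  have "var_x * \<phi> (hpart 2 f) + var_y * \<phi> (hpart 2 g) = \<phi> (?a * hpart 2 f + ?b * hpart 2 g)"
    by (simp only: K_hom_simps[OF h] \<phi>)
  also have "\<dots> = 0" by (simp only: rel K_hom_simps[OF h])
  finally have "hpart (Suc 0 + 2) (var_x * \<phi> (hpart 2 f) + var_y * \<phi> (hpart 2 g)) = 0"
    by (simp only: hpart_0)
  moreover have "hpart (Suc 0) var_x = (var_x :: 'a ps3)" "hpart (Suc 0) var_y = (var_y :: 'a ps3)"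
    by (auto simp: ps3_eq_iff fps_X_nth)
  ultimately have FG: "var_x * F + var_y * G = 0"
    unfolding hpart_add hpart_mult[OF var_x_MM hp(2)[OF f]] hpart_mult[OF var_y_MM hp(2)[OF g]]
      F_def G_def hp(1)[OF f] hp(1)[OF g] by simp
  have F_deg: "F $ i $ j $ k = 0" if "i + j + k \<noteq> 2" for i j k
    using that by (simp add: F_def)
  \<comment> \<open>All monomials of \<open>x F = - y G\<close> are divisible by \<open>y\<close>,
    hence so are those of \<open>F\<close>.\<close>
  have F0: "F $ i $ 0 $ k = 0" for i k
  proof -
    have "(var_x * F + var_y * G) $ (Suc i) $ 0 $ k = 0" by (simp add: FG)
    then show ?thesis by simp
  qed
  \<comment> \<open>\<open>l\<close> is \<open>- F / y\<close>, read off from the coefficients of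
    \<open>x y\<close>, \<open>y^2\<close> and \<open>y z\<close>.\<close>
  define l where "l = lin (- F $ 1 $ 1 $ 0) (- F $ 0 $ 2 $ 0) (- F $ 0 $ 1 $ 1)"
  have "F $ i $ j $ k = (- (var_y * l)) $ i $ j $ k" for i j k
  proof (cases j)
    case 0
    then show ?thesis by (simp add: F0)
  next
    case (Suc j')
    then show ?thesis
      using F_deg[of i j k] by (auto simp: l_def lin_nth numeral_2_eq_2)
  qed
  then have F: "F = - (var_y * l)" by (simp add: ps3_eq_iff)
  then have "var_y * (G - var_x * l) = 0" using FG by (simp add: algebra_simps)
  moreover have "(var_y :: 'a ps3) \<noteq> 0"
    using arg_cong[of var_y 0 "\<lambda>F. F $ 0 $ 1 $ 0"] by auto
  ultimately have G: "G = var_x * l" by simp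
  have \<phi>M: "\<phi> f \<in> \<MM> 2" "\<phi> g \<in> \<MM> 2"
    using f g automorphism_MM[OF \<phi>(1)] by simp_all
  have "hpart 2 f \<noteq> 0"
    using ind[of 1 0] by (auto simp: emb_K_hom)
  then have "f \<notin> \<MM> (Suc 2)" by (simp only: MM_Suc_iff) simp
  then have "\<phi> f \<notin> \<MM> (Suc 2)" unfolding automorphism_MM[OF \<phi>(1)] .
  then have "F \<noteq> 0" using \<phi>M(1) unfolding F_def MM_Suc_iff[of _ 2] by simp
  then have "l \<noteq> 0" using F by auto
  moreover have "\<phi> f + var_y * l \<in> \<MM> 3"
    using diff_hpart_MM[OF \<phi>M(1)] F by (simp add: F_def numeral_3_eq_3)
  moreover have "\<phi> g - var_x * l \<in> \<MM> 3"
    using diff_hpart_MM[OF \<phi>M(2)] G by (simp add: G_def numeral_3_eq_3)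
  ultimately show ?thesis
    using that[OF \<phi>(1)] unfolding l_def by blast
qed

text \<open>The initial forms are now \<open>- y l\<close> and \<open>x l\<close>. If
  \<open>l\<close> involves \<open>z\<close>, then \<open>l\<close>, \<open>x\<close>,
  \<open>y\<close> are independent and the span becomes that of \<open>x y\<close> and
  \<open>x^2 + x z\<close>. Otherwise \<open>l\<close> is a combination of \<open>x\<close> and
  \<open>y\<close>, and \<open>\<epsilon> = 0\<close> can be reached.\<close>

lemma initial_coordinates:
  fixes f g :: "'a::field ps3"
  assumes f: "f \<in> \<MM> 2" and g: "g \<in> \<MM> 2" and HF: "hilbert_function (ideal_gen {f, g}) 3 = 5"
    and ind: "\<And>c d. emb_K c * hpart 2 f + emb_K d * hpart 2 g = 0 \<Longrightarrow> c = 0 \<and> d = 0"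
  obtains \<phi> \<epsilon> F G where "K_algebra_automorphism \<phi>" "\<phi> ` ideal_gen {f, g} = ideal_gen {F, G}"
    "F - (var_x ^ 2 + emb_K \<epsilon> * var_x * var_z) \<in> \<MM> 3" "G - var_x * var_y \<in> \<MM> 3"
proof -
  obtain \<phi> l1 l2 l3 where \<phi>: "K_algebra_automorphism \<phi>" and l: "lin l1 l2 l3 \<noteq> 0"
    and \<phi>f: "\<phi> f + var_y * lin l1 l2 l3 \<in> \<MM> 3" and \<phi>g: "\<phi> g - var_x * lin l1 l2 l3 \<in> \<MM> 3"
    using common_factor_coordinates[OF f g HF ind] by blast
  note result = that
  let ?l = "lin l1 l2 l3"
  have e: "var_x = lin 1 0 0" "var_y = lin 0 1 0" "var_z = lin 0 0 (1::'a)"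
    by (simp_all add: lin_def emb_K_hom)
  \<comment> \<open>\<open>p1\<close> to \<open>p4\<close> form an invertible matrix recombining the
    two generators after the coordinate change \<open>\<psi>\<close>.\<close>
  have fin: thesis if \<psi>: "K_algebra_automorphism \<psi>" and p: "p1 * p4 - p2 * p3 \<noteq> 0"
    and c1: "emb_K p1 * - (\<psi> var_y * \<psi> ?l) + emb_K p2 * (\<psi> var_x * \<psi> ?l) = var_x ^ 2 + emb_K \<epsilon> * var_x * var_z"
    and c2: "emb_K p3 * - (\<psi> var_y * \<psi> ?l) + emb_K p4 * (\<psi> var_x * \<psi> ?l) = var_x * var_y"
    for \<psi> p1 p2 p3 p4 \<epsilon>
  proof -
    have h: "K_hom \<psi>" using \<psi> by (simp add: K_algebra_automorphism_iff)
    define f' g' where "f' = \<psi> (\<phi> f)" and "g' = \<psi> (\<phi> g)"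
    have "\<psi> (\<phi> f + var_y * ?l) \<in> \<MM> 3" "\<psi> (\<phi> g - var_x * ?l) \<in> \<MM> 3"
      unfolding automorphism_MM[OF \<psi>] by fact+
    then have fg: "f' - - (\<psi> var_y * \<psi> ?l) \<in> \<MM> 3" "g' - \<psi> var_x * \<psi> ?l \<in> \<MM> 3"
      unfolding f'_def g'_def by (simp_all add: K_hom_simps[OF h])
    define F G where "F = emb_K p1 * f' + emb_K p2 * g'" and "G = emb_K p3 * f' + emb_K p4 * g'"
    have "F - (var_x ^ 2 + emb_K \<epsilon> * var_x * var_z) =
        emb_K p1 * (f' - - (\<psi> var_y * \<psi> ?l)) + emb_K p2 * (g' - \<psi> var_x * \<psi> ?l)"
      unfolding c1[symmetric] F_def by (simp only: right_diff_distrib) (simp add: algebra_simps)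
    then have 1: "F - (var_x ^ 2 + emb_K \<epsilon> * var_x * var_z) \<in> \<MM> 3"
      using fg by (simp only: fil_add fil_mult_left)
    have "G - var_x * var_y =
        emb_K p3 * (f' - - (\<psi> var_y * \<psi> ?l)) + emb_K p4 * (g' - \<psi> var_x * \<psi> ?l)"
      unfolding c2[symmetric] G_def by (simp only: right_diff_distrib) (simp add: algebra_simps)
    then have 2: "G - var_x * var_y \<in> \<MM> 3"
      using fg by (simp only: fil_add fil_mult_left)
    define r where "r = inverse (p1 * p4 - p2 * p3)"
    have "r * (p1 * p4 - p2 * p3) = 1" using p by (simp add: r_def)
    then have R: "emb_K r * (emb_K p1 * emb_K p4 - emb_K p2 * emb_K p3) = 1"
      by (simp flip: emb_K_hom)
    have "(emb_K r * emb_K p4) * F + (- emb_K r * emb_K p2) * G =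
        (emb_K r * (emb_K p1 * emb_K p4 - emb_K p2 * emb_K p3)) * f'"
      "(- emb_K r * emb_K p3) * F + (emb_K r * emb_K p1) * G =
        (emb_K r * (emb_K p1 * emb_K p4 - emb_K p2 * emb_K p3)) * g'"
      unfolding F_def G_def by (simp_all add: algebra_simps)
    then have "f' = (emb_K r * emb_K p4) * F + (- emb_K r * emb_K p2) * G"
      "g' = (- emb_K r * emb_K p3) * F + (emb_K r * emb_K p1) * G"
      unfolding R by simp_all
    from ideal_gen_pair_eqI[OF F_def G_def this]
    have I: "(\<psi> \<circ> \<phi>) ` ideal_gen {f, g} = ideal_gen {F, G}"
      unfolding f'_def g'_def image_comp[symmetric] automorphism_image_ideal_gen[OF \<phi>]
        automorphism_image_ideal_gen[OF \<psi>] .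
    show thesis
      by (rule result[OF K_algebra_automorphism_comp[OF \<psi> \<phi>] I 1 2])
  qed
  consider "l3 \<noteq> 0" | "l3 = 0" "l1 \<noteq> 0" | "l3 = 0" "l1 = 0" "l2 \<noteq> 0"
    using l by (auto simp: lin_eq_0_iff)
  then show thesis
  proof cases
    case 1
    \<comment> \<open>The new coordinates are \<open>l\<close>, \<open>y\<close> and
      \<open>x - l\<close>, so the old \<open>x\<close> becomes \<open>x + z\<close>.\<close>
    have "l1 * (1 * - l3 - 0 * - l2) - l2 * (0 * - l3 - 0 * (1 - l1)) + l3 * (0 * - l2 - 1 * (1 - l1)) \<noteq> 0"
      using 1 by (simp add: algebra_simps)
    then obtain \<psi> where \<psi>: "K_algebra_automorphism \<psi>" "\<psi> ?l = var_x" "\<psi> (lin 0 1 0) = var_y"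
      "\<psi> (lin (1 - l1) (- l2) (- l3)) = var_z"
      by (rule linear_automorphism_inv)
    have h: "K_hom \<psi>" using \<psi>(1) by (simp add: K_algebra_automorphism_iff)
    have "var_x = ?l + lin (1 - l1) (- l2) (- l3)"
      unfolding e lin_linear by simp
    from arg_cong[OF this, of \<psi>] have "\<psi> var_x = var_x + var_z"
      by (simp only: K_hom_simps[OF h] \<psi>)
    then show ?thesis
      using \<psi>(2,3) by (intro fin[OF \<psi>(1), of 0 0 1 "- 1" 1])
        (simp_all add: emb_K_hom algebra_simps power2_eq_square flip: e(2))
  next
    case 2
    have "l1 * (1 * 1 - 0 * 0) - l2 * (0 * 1 - 0 * 0) + 0 * (0 * 0 - 1 * 0) \<noteq> 0"
      using 2 by simp
    then obtain \<psi> where \<psi>: "K_algebra_automorphism \<psi>" "\<psi> (lin l1 l2 0) = var_x" "\<psi> (lin 0 1 0) = var_y"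
      "\<psi> (lin 0 0 1) = var_z"
      by (rule linear_automorphism_inv)
    have h: "K_hom \<psi>" using \<psi>(1) by (simp add: K_algebra_automorphism_iff)
    have "emb_K l1 * var_x = lin l1 l2 0 - emb_K l2 * lin 0 1 0"
      by (simp add: lin_def emb_K_hom)
    then have "\<psi> (emb_K l1 * var_x) = var_x - emb_K l2 * var_y"
      by (simp only: K_hom_simps[OF h] \<psi>)
    then have "emb_K l1 * \<psi> var_x = var_x - emb_K l2 * var_y"
      by (simp only: K_hom_simps[OF h])
    then have x: "emb_K l1 * (\<psi> var_x * var_x) = (var_x - emb_K l2 * var_y) * var_x"
      by (simp only: mult.assoc[symmetric])
    show ?thesis
      using \<psi>(2,3) 2 x by (intro fin[OF \<psi>(1), of "- l2" 0 l1 "- 1" 0])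
        (simp_all add: emb_K_hom algebra_simps power2_eq_square flip: e(2))
  next
    case 3
    have "0 * (0 * 1 - 0 * 0) - 1 * (1 * 1 - 0 * 0) + 0 * (1 * 0 - 0 * 0) \<noteq> (0::'a)"
      by simp
    then obtain \<psi> where \<psi>: "K_algebra_automorphism \<psi>" "\<psi> (lin (0::'a) 1 0) = var_x" "\<psi> (lin 1 0 0) = var_y"
      "\<psi> (lin 0 0 1) = var_z"
      by (rule linear_automorphism_inv)
    have h: "K_hom \<psi>" using \<psi>(1) by (simp add: K_algebra_automorphism_iff)
    have "?l = emb_K l2 * lin 0 1 0" using 3 by (simp add: lin_linear)
    then have \<psi>l: "\<psi> ?l = emb_K l2 * var_x" by (simp only: K_hom_simps[OF h] \<psi>)
    have inv: "emb_K (inverse l2) * (emb_K l2 * u) = u" for u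
      using 3 by (simp add: emb_K_hom flip: mult.assoc emb_K_hom(4))
    have "emb_K (- inverse l2) * - (var_x * (emb_K l2 * var_x)) = emb_K (inverse l2) * (emb_K l2 * var_x ^ 2)"
      "emb_K (inverse l2) * (var_y * (emb_K l2 * var_x)) = emb_K (inverse l2) * (emb_K l2 * (var_x * var_y))"
      by (simp_all add: emb_K_hom algebra_simps power2_eq_square)
    then show ?thesis
      using 3 \<psi>(2,3) \<psi>l by (intro fin[OF \<psi>(1), of "- inverse l2" "inverse l2" 0 0 0])
        (simp_all add: e(1,2)[symmetric] inv emb_K_hom(5))
  qed
qed

lemma MM_fil:
  assumes "F \<in> \<MM> N" "1 \<le> r"
  shows "F \<in> fil r N"
proof (rule filI)
  fix i j k assume *: "i + r * (j + k) < N"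
  have "j + k \<le> r * (j + k)" using mult_le_mono1[OF assms(2), of "j + k"] by simp
  then have "i + (j + k) \<le> i + r * (j + k)" by (rule add_left_mono)
  then have "i + (j + k) < N" using * by (rule le_less_trans)
  then show "F $ i $ j $ k = 0" by (intro MMD[OF assms(1)]) simp
qed

lemma K_hom_emb_yz_range:
  assumes \<phi>: "K_hom \<phi>" and "\<phi> var_y = emb_yz A" "emb_yz A \<in> \<MM> (Suc 0)" "\<phi> var_z = var_z"
  shows "\<exists>Y. \<phi> (emb_yz X) = emb_yz Y"
proof -
  have ex: "\<exists>Y. \<phi> (emb_yz X) - emb_yz Y \<in> \<MM> N" for X N
  proof (induction N arbitrary: X)
    case (Suc N)
    have X: "emb_yz X = emb_K (X $ 0 $ 0) + var_y * emb_yz (fps_shift 1 X) + var_z * emb_yz (fps_const (fps_shift 1 (X $ 0)))"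
      by (auto simp: ps3_eq_iff fps_X_mult_nth)
    obtain Y1 where Y1: "\<phi> (emb_yz (fps_shift 1 X)) - emb_yz Y1 \<in> \<MM> N"
      using Suc.IH by blast
    obtain Y2 where Y2: "\<phi> (emb_yz (fps_const (fps_shift 1 (X $ 0)))) - emb_yz Y2 \<in> \<MM> N"
      using Suc.IH by blast
    define Y where "Y = fps_const (fps_const (X $ 0 $ 0)) + A * Y1 + fps_const fps_X * Y2"
    have emb_Y: "emb_yz Y = emb_K (X $ 0 $ 0) + emb_yz A * emb_yz Y1 + var_z * emb_yz Y2"
      by (simp add: Y_def emb_yz_hom emb_K_eq_emb_z var_z_eq_emb_z emb_z_eq_emb_yz)
    have "\<phi> (emb_yz X) - emb_yz Y = emb_yz A * (\<phi> (emb_yz (fps_shift 1 X)) - emb_yz Y1) +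
        var_z * (\<phi> (emb_yz (fps_const (fps_shift 1 (X $ 0)))) - emb_yz Y2)"
      unfolding emb_Y by (subst X, unfold K_hom_simps[OF \<phi>] assms(2,4)) (simp add: algebra_simps)
    also have "\<dots> \<in> \<MM> (Suc N)"
      using fil_mult[OF assms(3) Y1] fil_mult[OF var_z_MM Y2] by (intro fil_add) simp_all
    finally show ?case ..
  qed simp
  have "\<phi> (emb_yz X) $ i $ j $ k = 0" if "0 < i" for i j k
  proof -
    obtain Y where "\<phi> (emb_yz X) - emb_yz Y \<in> \<MM> (Suc (i + j + k))" using ex by blast
    then have "(\<phi> (emb_yz X) - emb_yz Y) $ i $ j $ k = 0" by (rule MMD) simp
    then show ?thesis using that by simp
  qed
  then have "\<phi> (emb_yz X) $ i $ j $ k = emb_yz (\<phi> (emb_yz X) $ 0) $ i $ j $ k" for i j k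
    by (cases "i = 0") simp_all
  then have "\<phi> (emb_yz X) = emb_yz (\<phi> (emb_yz X) $ 0)"
    by (simp only: ps3_eq_iff) blast
  then show ?thesis ..
qed

text \<open>Division of \<open>x^2\<close> and \<open>G\<close> by \<open>F\<close> gives generators
  \<open>F1\<close>, monic quadratic in \<open>x\<close>, and \<open>G1 = A2 x + B2\<close>. With
  \<open>A2\<close> as new \<open>y\<close>, the part of the remaining term that is divisible by
  \<open>y\<close> is absorbed into \<open>x\<close>.\<close>

lemma normal_coordinates:
  fixes F G :: "'a::field ps3"
  assumes F: "F - (var_x ^ 2 + emb_K \<epsilon> * var_x * var_z) \<in> \<MM> 3" and G: "G - var_x * var_y \<in> \<MM> 3"
  obtains \<phi> b L \<gamma> where "K_algebra_automorphism \<phi>" "normal_form \<epsilon> b L \<gamma>"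
    "\<phi> ` ideal_gen {F, G} = normal_form.I b L \<gamma>"
proof -
  have "var_x \<in> fil 2 1" "var_z \<in> fil 2 2" by (auto simp: fil_def)
  then have "emb_K \<epsilon> * var_x * var_z \<in> fil 2 (1 + 2)"
    by (intro fil_mult fil_mult_left)
  then have "emb_K \<epsilon> * var_x * var_z \<in> fil 2 3" by (simp add: numeral_3_eq_3)
  from fil_add[OF MM_fil[OF F, of 2] this]
  have weier: "F - var_x ^ 2 \<in> fil 2 3" by (simp add: algebra_simps)
  obtain w A B where w: "var_x ^ 2 = w * F + emb_yz A * var_x + emb_yz B"
    using weierstrass_division[OF weier] by metis
  obtain w2 A2 B2 where w2: "G = w2 * F + emb_yz A2 * var_x + emb_yz B2"
    using weierstrass_division[OF weier] by metis
  have zeq: "var_z = emb_yz (fps_const fps_X)" by (simp add: var_z_eq_emb_z emb_z_eq_emb_yz)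
  have Keq: "emb_K \<epsilon> = emb_yz (fps_const (fps_const \<epsilon>))" by (simp add: emb_K_eq_emb_z emb_z_eq_emb_yz)
  \<comment> \<open>Read as a division of the small series
    \<open>F - (x^2 + \<epsilon> x z)\<close>, up to sign, the equation lets
    \<open>division_order\<close> bound \<open>w - 1\<close>, \<open>A + \<epsilon> z\<close> and
    \<open>B\<close>.\<close>
  have "(w - 1) * F + emb_yz (A + fps_const (fps_const \<epsilon>) * fps_const fps_X) * var_x + emb_yz B =
      - (F - (var_x ^ 2 + emb_K \<epsilon> * var_x * var_z))"
    unfolding emb_yz_hom zeq[symmetric] Keq[symmetric] using w by (simp add: algebra_simps)
  then have "(w - 1) * F + emb_yz (A + fps_const (fps_const \<epsilon>) * fps_const fps_X) * var_x + emb_yz B \<in> \<MM> (1 + 2)"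
    using fil_uminus[OF F] by (simp add: numeral_3_eq_3)
  from division_order[OF F this]
  have w1: "w - 1 \<in> \<MM> 1" and A: "emb_yz (A + fps_const (fps_const \<epsilon>) * fps_const fps_X) \<in> \<MM> 2" and B: "emb_yz B \<in> \<MM> 3"
    by (simp_all add: numeral_2_eq_2 numeral_3_eq_3)
  have "w2 * F + emb_yz (A2 - fps_X) * var_x + emb_yz B2 = G - var_x * var_y"
    unfolding emb_yz_hom var_y_def[symmetric] w2 by (simp add: algebra_simps)
  then have "w2 * F + emb_yz (A2 - fps_X) * var_x + emb_yz B2 \<in> \<MM> (1 + 2)"
    using G by (simp add: numeral_3_eq_3)
  from division_order[OF F this]
  have A2: "emb_yz (A2 - fps_X) \<in> \<MM> 2" and B2: "emb_yz B2 \<in> \<MM> 3"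
    by (simp_all add: numeral_2_eq_2 numeral_3_eq_3)
  have "(w - 1) $ 0 $ 0 $ 0 = 0" using w1 by (intro MMD[of _ 1]) simp_all
  then have "w $ 0 $ 0 $ 0 \<noteq> 0" by simp
  then obtain V where V: "w * V = 1" by (rule ps3_unit)
  define F1 where "F1 = var_x ^ 2 - emb_yz A * var_x - emb_yz B"
  define G1 where "G1 = emb_yz A2 * var_x + emb_yz B2"
  have F1: "F1 = w * F" using w by (simp add: F1_def)
  have "V * F1 = w * V * F" by (simp add: F1 mult_ac)
  then have VF: "V * F1 = F" by (simp add: V)
  have I1: "ideal_gen {F, G} = ideal_gen {F1, G1}"
  proof (rule ideal_gen_pair_eqI)
    show "F1 = w * F + 0 * G" by (simp add: F1)
    show "G1 = (- w2) * F + 1 * G" by (simp add: G1_def w2)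
    show "F = V * F1 + 0 * G1" by (simp add: VF)
    show "G = (w2 * V) * F1 + 1 * G1" by (simp add: G1_def w2 VF mult.assoc)
  qed
  have y: "emb_yz A2 - var_y \<in> \<MM> 2" using A2 by (simp add: emb_yz_hom var_y_def)
  then have A2M: "emb_yz A2 \<in> \<MM> (Suc 0)"
    using fil_cong[OF fil_mono[OF y, of "Suc 0"]] by simp
  \<comment> \<open>\<open>\<psi>\<close> sends \<open>y\<close> to \<open>A2\<close>; the change
    that is wanted is its inverse, which sends \<open>A2\<close> to \<open>y\<close>.\<close>
  define \<psi> where "\<psi> = subst var_x (emb_yz A2) var_z"
  note sv = subst_vars[OF var_x_MM A2M var_z_MM]
  have h: "K_hom \<psi>" unfolding \<psi>_def by (rule K_hom_subst[OF var_x_MM A2M var_z_MM])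
  have \<psi>v: "\<psi> var_x = var_x" "\<psi> var_y = emb_yz A2" "\<psi> var_z = var_z"
    by (simp_all add: \<psi>_def sv)
  have \<psi>: "K_algebra_automorphism \<psi>"
    using h by (rule near_id_automorphism) (simp_all add: \<psi>v y)
  define \<phi> where "\<phi> = inv_into UNIV \<psi>"
  have \<phi>: "K_algebra_automorphism \<phi>"
    unfolding \<phi>_def using \<psi> by (rule K_algebra_automorphism_inv)
  have k: "K_hom \<phi>" using \<phi> by (simp add: K_algebra_automorphism_iff)
  have \<phi>\<psi>: "\<phi> (\<psi> X) = X" and \<psi>\<phi>: "\<psi> (\<phi> X) = X" for X
    using \<psi> by (simp_all add: \<phi>_def K_algebra_automorphism_iff bij_is_inj bij_is_surj surj_f_inv_f)
  have \<phi>v: "\<phi> var_x = var_x" "\<phi> (emb_yz A2) = var_y" "\<phi> var_z = var_z"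
    using \<phi>\<psi>[of var_x] \<phi>\<psi>[of var_y] \<phi>\<psi>[of var_z] by (simp_all add: \<psi>v)
  \<comment> \<open>The inverse preserves \<open>K[[y,z]]\<close> as well: if an image had a part
    \<open>x U'\<close>, applying \<open>\<psi>\<close> would put \<open>x * \<psi> U'\<close> into
    \<open>K[[y,z]]\<close>, which forces \<open>U' = 0\<close>.\<close>
  have ex: "\<exists>Y. \<phi> (emb_yz X) = emb_yz Y" for X
  proof -
    let ?U = "\<phi> (emb_yz X)"
    define U' where "U' = fps_shift 1 ?U"
    have U: "?U = emb_yz (?U $ 0) + var_x * U'"
      by (auto simp: ps3_eq_iff U'_def)
    obtain Y where Y: "\<psi> (emb_yz (?U $ 0)) = emb_yz Y"
      using K_hom_emb_yz_range[OF h \<psi>v(2) A2M \<psi>v(3)] by blast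
    have "emb_yz X = \<psi> (emb_yz (?U $ 0) + var_x * U')"
      using U \<psi>\<phi>[of "emb_yz X"] by simp
    also have "\<dots> = emb_yz Y + var_x * \<psi> U'"
      by (simp only: K_hom_simps[OF h] Y \<psi>v)
    finally have xU: "var_x * \<psi> U' = emb_yz (X - Y)" by (simp add: emb_yz_hom)
    have "\<psi> U' $ i = 0" for i
      using arg_cong[OF xU, of "\<lambda>F. F $ Suc i"] by simp
    then have "\<psi> U' = \<psi> 0" by (simp add: fps_eq_iff K_hom_simps[OF h])
    then have "U' = 0" using \<phi>\<psi> by metis
    then have "?U = emb_yz (?U $ 0)" using U by simp
    then show ?thesis ..
  qed
  obtain A' where A': "\<phi> (emb_yz A) = emb_yz A'" using ex by blast
  obtain B' where B': "\<phi> (emb_yz B) = emb_yz B'" using ex by blast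
  obtain C where C: "\<phi> (emb_yz B2) = emb_yz C" using ex by blast
  have "\<phi> (emb_yz A + emb_K \<epsilon> * var_z) \<in> \<MM> 2"
    unfolding automorphism_MM[OF \<phi>] using A unfolding emb_yz_hom Keq[symmetric] zeq[symmetric] .
  then have A'M: "emb_yz A' + emb_K \<epsilon> * var_z \<in> \<MM> 2"
    by (simp only: K_hom_simps[OF k] A' \<phi>v)
  have B'M: "emb_yz B' \<in> \<MM> 3" and CM: "emb_yz C \<in> \<MM> 3"
    using B B2 automorphism_MM[OF \<phi>] by (simp_all flip: B' C)
  have \<phi>F1: "\<phi> F1 = var_x ^ 2 - emb_yz A' * var_x - emb_yz B'"
    unfolding F1_def by (simp only: K_hom_simps[OF k] A' B' \<phi>v)
  have \<phi>G1: "\<phi> G1 = var_y * var_x + emb_yz C"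
    unfolding G1_def by (simp only: K_hom_simps[OF k] C \<phi>v)
  \<comment> \<open>\<open>x y + C\<close> is \<open>(x + C') y + \<gamma>\<close>, hence the shift
    of \<open>x\<close> by \<open>- C'\<close>.\<close>
  define C' where "C' = fps_shift 1 C"
  define \<gamma> where "\<gamma> = C $ 0"
  have C_eq: "emb_yz C = emb_z \<gamma> + var_y * emb_yz C'"
    by (auto simp: ps3_eq_iff C'_def \<gamma>_def fps_X_mult_nth)
  have \<gamma>M: "emb_z \<gamma> \<in> \<MM> 3" and C'M: "emb_yz C' \<in> \<MM> 2"
    using CM by (auto simp: emb_z_MM emb_yz_MM \<gamma>_def C'_def)
  have "emb_yz (- C') \<in> \<MM> 2" using C'M by (simp add: emb_yz_hom)
  then obtain \<theta> where \<theta>: "K_algebra_automorphism \<theta>" "\<theta> var_x = var_x + emb_yz (- C')"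
    "\<And>A. \<theta> (emb_yz A) = emb_yz A"
    by (rule shift_x_automorphism) blast
  have l: "K_hom \<theta>" using \<theta>(1) by (simp add: K_algebra_automorphism_iff)
  have \<theta>yz: "\<theta> var_y = var_y" "\<theta> (emb_z c) = emb_z c" for c
    using \<theta>(3) by (simp_all add: var_y_def emb_z_eq_emb_yz)
  \<comment> \<open>\<open>b\<close> and \<open>L\<close> are the coefficients of
    \<open>(x - C')^2 - A' (x - C') - B'\<close> as a polynomial in \<open>x\<close>.\<close>
  define b where "b = - (C' + C') - A'"
  define L where "L = C' * C' + A' * C' - B'"
  have "emb_yz b - emb_K \<epsilon> * var_z = - (emb_yz C' + emb_yz C') - (emb_yz A' + emb_K \<epsilon> * var_z)"
    unfolding b_def emb_yz_hom by simp
  also have "\<dots> \<in> \<MM> 2"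
    by (intro fil_diff fil_uminus fil_add C'M A'M)
  finally have bM: "emb_yz b - emb_K \<epsilon> * var_z \<in> \<MM> 2" .
  have "emb_K \<epsilon> * var_z \<in> \<MM> (Suc 0)" by (simp add: fil_mult_left)
  from fil_diff[OF fil_mono[OF A'M, of "Suc 0"] this] have A'1: "emb_yz A' \<in> \<MM> (Suc 0)" by simp
  have "emb_yz C' * emb_yz C' \<in> \<MM> 3" "emb_yz A' * emb_yz C' \<in> \<MM> 3"
    by (rule fil_mult_le[OF C'M C'M], simp, rule fil_mult_le[OF A'1 C'M], simp)
  then have LM: "emb_yz L \<in> \<MM> 3"
    unfolding L_def emb_yz_hom using B'M by (intro fil_diff fil_add)
  have nf: "normal_form \<epsilon> b L \<gamma>"
    using bM LM \<gamma>M by unfold_locales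
  have "\<theta> (\<phi> F1) = (var_x + emb_yz (- C')) ^ 2 - emb_yz A' * (var_x + emb_yz (- C')) - emb_yz B'"
    unfolding \<phi>F1 by (simp only: K_hom_simps[OF l] \<theta>)
  also have "\<dots> = normal_form.f b L"
    unfolding normal_form.f_def[OF nf] unfolding b_def L_def emb_yz_hom by (simp add: algebra_simps power2_eq_square)
  finally have f: "\<theta> (\<phi> F1) = normal_form.f b L" .
  have "\<theta> (\<phi> G1) = var_y * (var_x + emb_yz (- C')) + (emb_z \<gamma> + var_y * emb_yz C')"
    unfolding \<phi>G1 C_eq by (simp only: K_hom_simps[OF l] \<theta> \<theta>yz)
  also have "\<dots> = normal_form.g \<gamma>"
    unfolding normal_form.g_def[OF nf] emb_yz_hom by (simp add: algebra_simps)
  finally have g: "\<theta> (\<phi> G1) = normal_form.g \<gamma>" .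
  have "(\<theta> \<circ> \<phi>) ` ideal_gen {F, G} = normal_form.I b L \<gamma>"
    unfolding image_comp[symmetric] I1 automorphism_image_ideal_gen[OF \<phi>]
      automorphism_image_ideal_gen[OF \<theta>(1)] f g normal_form.I_def[OF nf] ..
  with K_algebra_automorphism_comp[OF \<theta>(1) \<phi>] nf show ?thesis
    by (rule that)
qed

section \<open>The classification\<close>

lemma generators_exist:
  fixes I :: "'a::field_char_0 ps3 set"
  assumes "type_2_2 I" and n: "3 \<le> n" and e: "n + 3 \<le> e" and HF: "hilbert_function I = H_fun n e"
  obtains \<phi> \<alpha> H L where "K_algebra_automorphism \<phi>"
    "\<phi> ` I = ideal_gen {var_x ^ 2 - emb_yz H ^ 2 + emb_yz L,
       var_x * var_y + emb_z \<alpha> * var_z ^ n + var_y * emb_yz H}"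
    "is_unit \<alpha>" "emb_yz L \<in> \<MM> (n + 1)" "emb_yz H \<in> \<MM> 2" "e \<le> 2 * n"
    "2 * emb_z \<alpha> * var_z ^ n * emb_yz H + var_y * emb_yz L \<in> \<MM> (e - 1)"
    "e < 2 * n \<longrightarrow> 2 * emb_z \<alpha> * var_z ^ n * emb_yz H + var_y * emb_yz L \<notin> \<MM> e"
proof -
  obtain f g where I: "I = ideal_gen {f, g}" and f: "f \<in> \<MM> 2" and g: "g \<in> \<MM> 2"
    and ind: "\<And>c d. emb_K c * hpart 2 f + emb_K d * hpart 2 g = 0 \<Longrightarrow> c = 0 \<and> d = 0"
    using type_2_2_initial[OF assms(1)] by blast
  have "hilbert_function (ideal_gen {f, g}) 3 = 5"
    using HF n by (simp add: I[symmetric] H_fun_def)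
  then obtain \<phi>1 \<epsilon> F G where \<phi>1: "K_algebra_automorphism \<phi>1" "\<phi>1 ` I = ideal_gen {F, G}"
    and FG: "F - (var_x ^ 2 + emb_K \<epsilon> * var_x * var_z) \<in> \<MM> 3" "G - var_x * var_y \<in> \<MM> 3"
    using initial_coordinates[OF f g _ ind] unfolding I by metis
  obtain \<phi>2 b L \<gamma> where \<phi>2: "K_algebra_automorphism \<phi>2" "\<phi>2 ` ideal_gen {F, G} = normal_form.I b L \<gamma>"
    and nf: "normal_form \<epsilon> b L \<gamma>"
    using normal_coordinates[OF FG] by metis
  interpret nf: normal_form \<epsilon> b L \<gamma> by (rule nf)
  define \<phi> where "\<phi> = \<phi>2 \<circ> \<phi>1"
  have \<phi>: "K_algebra_automorphism \<phi>"
    unfolding \<phi>_def by (rule K_algebra_automorphism_comp[OF \<phi>2(1) \<phi>1(1)])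
  have \<phi>I: "\<phi> ` I = nf.I"
    unfolding \<phi>_def image_comp[symmetric] \<phi>1(2) \<phi>2(2) ..
  have "hilbert_function (\<phi> ` ideal_gen {f, g}) = hilbert_function (ideal_gen {f, g})"
    by (rule hilbert_function_automorphism[OF \<phi>]) (rule fil_mono[OF f] fil_mono[OF g], simp)+
  then have HF': "hilbert_function nf.I = H_fun n e"
    unfolding I[symmetric] \<phi>I HF .
  have HF_n: "2 \<le> t \<Longrightarrow> t \<le> n \<Longrightarrow> hilbert_function nf.I t = t + 2"
    "hilbert_function nf.I (n + 1) = n + 2" "hilbert_function nf.I (n + 2) = n + 3" for t
    unfolding HF' H_fun_def using e by auto
  have struct: "emb_z \<gamma> \<in> \<MM> n" "\<gamma> $ n \<noteq> 0" "emb_yz nf.D \<in> \<MM> (n + 2)" "\<epsilon> = 0"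
    using nf.hilbert_function_structure[OF n HF_n] by blast+
  have g2: "subdegree \<gamma> = n"
    using struct(1,2) by (intro subdegreeI) (simp_all add: emb_z_MM)
  have qM: "emb_yz nf.q \<in> \<MM> (n + 3)"
  proof -
    have "emb_z \<gamma> ^ 2 \<in> \<MM> (n + 3)"
      using fil_mono[OF fil_power[OF struct(1), of 2], of "n + 3"] n by simp
    moreover have "var_y * emb_yz nf.D \<in> \<MM> (n + 3)"
      using fil_mult[OF var_y_MM struct(3)] by (simp add: numeral_3_eq_3)
    ultimately show ?thesis
      unfolding nf.emb_q by (rule fil_add)
  qed
  have "(\<gamma> ^ 2) $ (n + n) = \<gamma> $ n * \<gamma> $ n"
    using nth_subdegree_mult[of \<gamma> \<gamma>] by (simp add: power2_eq_square g2)
  then have "nf.q $ 0 $ (n + n) \<noteq> 0"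
    using struct(2) by (simp add: nf.q_def fps_const_power)
  then have "emb_yz nf.q \<notin> \<MM> (Suc (n + n))"
    unfolding emb_yz_MM by (metis add_0 lessI)
  then obtain e' where q: "emb_yz nf.q \<in> \<MM> e'" "emb_yz nf.q \<notin> \<MM> (Suc e')"
    using MM_order_exists by blast
  have e': "n + 3 \<le> e'"
  proof (rule ccontr)
    assume "\<not> n + 3 \<le> e'"
    then have "emb_yz nf.q \<in> \<MM> (Suc e')" by (intro fil_mono[OF qM]) simp
    with q(2) show False ..
  qed
  have "hilbert_function nf.I = H_fun n e'"
    by (rule nf.hilbert_function_normal_form[OF n e' struct(1,2,3) q])
  \<comment> \<open>In this degree both functions have reached their final values, so the order
    \<open>e'\<close> of \<open>q\<close> must be \<open>e\<close>.\<close>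
  then have "H_fun n e (n + e + e') = H_fun n e' (n + e + e')"
    using HF' by simp
  moreover have "H_fun n c T = c" if "n + 3 \<le> c" "n + c \<le> T" for c T
    unfolding H_fun_def using that by auto
  ultimately have "e' = e" using e e' by simp
  with q have q: "emb_yz nf.q \<in> \<MM> e \<and> emb_yz nf.q \<notin> \<MM> (Suc e)" by simp
  have "1 \<le> e" using e by simp
  from q[unfolded nf.q_order_iff[OF struct(1,2) this]]
  have De: "e \<le> 2 * n" "emb_yz nf.D \<in> \<MM> (e - 1)" "e < 2 * n \<longrightarrow> emb_yz nf.D \<notin> \<MM> e" by simp_all
  define \<alpha> where "\<alpha> = fps_shift n \<gamma>"
  have "\<gamma> = \<alpha> * fps_X ^ n"
    using g2 by (simp add: \<alpha>_def fps_shift_times_fps_X_power)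
  then have emb_\<gamma>: "emb_z \<gamma> = emb_z \<alpha> * var_z ^ n"
    by (simp only: emb_z_mult emb_z_power)
  have unit: "is_unit \<alpha>"
    using struct(2) by (simp add: \<alpha>_def fps_is_unit_iff)
  \<comment> \<open>Completing the square removes the linear term in \<open>x\<close>; this needs 2
    to be invertible.\<close>
  define H where "H = fps_const (fps_const (- 1 / 2)) * b"
  have "H + H = fps_const (fps_const (- 1 / 2 + - 1 / 2)) * b"
    unfolding H_def fps_const_add[symmetric] by (simp only: distrib_right)
  also have "- 1 / 2 + - 1 / 2 = (- 1 :: 'a)"
    unfolding add_divide_distrib[symmetric] by simp
  also have "fps_const (fps_const (- 1)) * b = - b"
    by (simp flip: fps_const_neg)
  finally have "b = - (H + H)" by simp
  then have emb_b: "emb_yz b = - (emb_yz H + emb_yz H)"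
    by (simp only: emb_yz_hom)
  have bM: "emb_yz b \<in> \<MM> 2"
    using nf.b struct(4) by (simp add: emb_K_hom)
  then have HM: "emb_yz H \<in> \<MM> 2"
    unfolding H_def emb_yz_hom by (rule fil_mult_left)
  \<comment> \<open>The sum is \<open>y L\<close>, and both summands have order at least
    \<open>n + 2\<close>.\<close>
  have "emb_yz nf.D + emb_z \<gamma> * emb_yz b \<in> \<MM> (n + 2)"
    by (intro fil_add struct fil_mult bM)
  then have "var_y * emb_yz L \<in> \<MM> (Suc (n + 1))"
    by (simp add: nf.emb_D)
  then have LM: "emb_yz L \<in> \<MM> (n + 1)"
    by (simp only: var_y_mult_MM)
  obtain \<theta> where \<theta>: "K_algebra_automorphism \<theta>" "\<theta> var_x = var_x + emb_yz H"
    "\<And>A. \<theta> (emb_yz A) = emb_yz A"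
    using shift_x_automorphism[OF HM] by metis
  have l: "K_hom \<theta>" using \<theta>(1) by (simp add: K_algebra_automorphism_iff)
  have \<theta>yz: "\<theta> var_y = var_y" "\<theta> (emb_z c) = emb_z c" for c
    using \<theta>(3) by (simp_all add: var_y_def emb_z_eq_emb_yz)
  have "\<theta> nf.f = (var_x + emb_yz H) ^ 2 + emb_yz b * (var_x + emb_yz H) + emb_yz L"
    unfolding nf.f_def by (simp only: K_hom_simps[OF l] \<theta>)
  then have \<theta>f: "\<theta> nf.f = var_x ^ 2 - emb_yz H ^ 2 + emb_yz L"
    by (simp add: emb_b algebra_simps power2_eq_square)
  have "\<theta> nf.g = (var_x + emb_yz H) * var_y + emb_z \<gamma>"
    unfolding nf.g_def by (simp only: K_hom_simps[OF l] \<theta> \<theta>yz)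
  then have \<theta>g: "\<theta> nf.g = var_x * var_y + emb_z \<alpha> * var_z ^ n + var_y * emb_yz H"
    by (simp add: emb_\<gamma> algebra_simps)
  have "(\<theta> \<circ> \<phi>) ` I = ideal_gen {var_x ^ 2 - emb_yz H ^ 2 + emb_yz L,
       var_x * var_y + emb_z \<alpha> * var_z ^ n + var_y * emb_yz H}"
    unfolding image_comp[symmetric] \<phi>I unfolding nf.I_def automorphism_image_ideal_gen[OF \<theta>(1)] \<theta>f \<theta>g ..
  moreover have "emb_yz nf.D = 2 * emb_z \<alpha> * var_z ^ n * emb_yz H + var_y * emb_yz L"
    unfolding nf.emb_D emb_b emb_\<gamma> by (simp add: algebra_simps)
  ultimately show ?thesis
    using that[OF K_algebra_automorphism_comp[OF \<theta>(1) \<phi>]] unit LM HM De by metis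
qed

theorem theorem4p1:
  fixes I :: "'a::{alg_closed_field, field_char_0} ps3 set" and e n :: nat
  assumes "type_2_2 I" and "has_multiplicity I e" and "n \<ge> 3"
  shows "(n + 3 \<le> e \<and> hilbert_function I = H_fun n e) \<longleftrightarrow>
    (\<exists>\<phi> (a :: 'a) (p :: nat) (\<alpha> :: 'a fps) (H :: 'a fps fps) (L :: 'a fps fps).
       K_algebra_automorphism \<phi> \<and>
       \<phi> ` I = ideal_gen
         {var_x ^ 2 + emb_K a * var_z ^ p * (var_x + emb_yz H) - emb_yz H ^ 2 + emb_yz L,
          var_x * var_y + emb_z \<alpha> * var_z ^ n + var_y * emb_yz H} \<and>
       a \<in> {0, 1} \<and> p \<ge> 2 \<and> is_unit \<alpha> \<and>
       ps_order (emb_yz L) \<ge> enat (n + 1) \<and> ps_order (emb_yz H) \<ge> 2 \<and>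
       n + 3 \<le> e \<and> e \<le> 2 * n \<and>
       (let d = ps_order (2 * emb_z \<alpha> * var_z ^ n * emb_yz H
                          - emb_K a * emb_z \<alpha> * var_z ^ (n + p) + var_y * emb_yz L)
        in d \<ge> enat (e - 1) \<and> (e < 2 * n \<longrightarrow> d = enat (e - 1))))"
    (is "?lhs \<longleftrightarrow> ?rhs")
proof
  assume ?lhs
  then have e: "n + 3 \<le> e" and HF: "hilbert_function I = H_fun n e" by simp_all
  obtain \<phi> \<alpha> H L where *: "K_algebra_automorphism \<phi>"
    "\<phi> ` I = ideal_gen {var_x ^ 2 - emb_yz H ^ 2 + emb_yz L,
       var_x * var_y + emb_z \<alpha> * var_z ^ n + var_y * emb_yz H}"
    "is_unit \<alpha>" "emb_yz L \<in> \<MM> (n + 1)" "emb_yz H \<in> \<MM> 2" "e \<le> 2 * n"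
    and d: "2 * emb_z \<alpha> * var_z ^ n * emb_yz H + var_y * emb_yz L \<in> \<MM> (e - 1)"
    "e < 2 * n \<longrightarrow> 2 * emb_z \<alpha> * var_z ^ n * emb_yz H + var_y * emb_yz L \<notin> \<MM> e"
    by (rule generators_exist[OF assms(1,3) e HF]) (rule that)
  have zero: "var_x ^ 2 + emb_K 0 * var_z ^ 2 * (var_x + emb_yz H) - emb_yz H ^ 2 + emb_yz L =
      var_x ^ 2 - emb_yz H ^ 2 + emb_yz L"
    "2 * emb_z \<alpha> * var_z ^ n * emb_yz H - emb_K 0 * emb_z \<alpha> * var_z ^ (n + 2) + var_y * emb_yz L =
      2 * emb_z \<alpha> * var_z ^ n * emb_yz H + var_y * emb_yz L"
    by (simp_all add: emb_K_hom)
  have e1: "Suc (e - 1) = e" using e by simp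
  have two: "(2 :: enat) = enat 2" by (simp add: numeral_eq_enat)
  show ?rhs
    unfolding Let_def
  \<comment> \<open>With \<open>a = 0\<close> the term in \<open>z^p\<close> is absent, and
    \<open>p = 2\<close> is the least exponent allowed.\<close>
  proof (rule exI[of _ \<phi>], rule exI[of _ 0], rule exI[of _ 2], rule exI[of _ \<alpha>],
      rule exI[of _ H], rule exI[of _ L], intro conjI)
    show "\<phi> ` I = ideal_gen
        {var_x ^ 2 + emb_K 0 * var_z ^ 2 * (var_x + emb_yz H) - emb_yz H ^ 2 + emb_yz L,
         var_x * var_y + emb_z \<alpha> * var_z ^ n + var_y * emb_yz H}"
      unfolding zero by (rule *(2))
    show "is_unit \<alpha>" by (rule *)
    show "enat (n + 1) \<le> ps_order (emb_yz L)" "2 \<le> ps_order (emb_yz H)"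
      unfolding two ps_order_ge_iff by (rule *)+
    show "enat (e - 1) \<le> ps_order (2 * emb_z \<alpha> * var_z ^ n * emb_yz H
        - emb_K 0 * emb_z \<alpha> * var_z ^ (n + 2) + var_y * emb_yz L)"
      unfolding zero ps_order_ge_iff by (rule d)
    show "e < 2 * n \<longrightarrow> ps_order (2 * emb_z \<alpha> * var_z ^ n * emb_yz H
        - emb_K 0 * emb_z \<alpha> * var_z ^ (n + 2) + var_y * emb_yz L) = enat (e - 1)"
      unfolding zero ps_order_eq_iff e1 using d by blast
  qed (simp_all add: * e)
next
  assume ?rhs
  then obtain \<phi> a p \<alpha> H L where \<phi>: "K_algebra_automorphism \<phi>"
    and I: "\<phi> ` I = ideal_gen
         {var_x ^ 2 + emb_K a * var_z ^ p * (var_x + emb_yz H) - emb_yz H ^ 2 + emb_yz L,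
          var_x * var_y + emb_z \<alpha> * var_z ^ n + var_y * emb_yz H}"
    and p: "2 \<le> p" and \<alpha>: "is_unit \<alpha>"
    and L: "enat (n + 1) \<le> ps_order (emb_yz L)" and H: "2 \<le> ps_order (emb_yz H)"
    and e: "n + 3 \<le> e" "e \<le> 2 * n"
    and d: "enat (e - 1) \<le> ps_order (2 * emb_z \<alpha> * var_z ^ n * emb_yz H
                          - emb_K a * emb_z \<alpha> * var_z ^ (n + p) + var_y * emb_yz L)"
      "e < 2 * n \<longrightarrow> ps_order (2 * emb_z \<alpha> * var_z ^ n * emb_yz H
                          - emb_K a * emb_z \<alpha> * var_z ^ (n + p) + var_y * emb_yz L) = enat (e - 1)"
    unfolding Let_def by (elim exE conjE) (rule that)
  have e1: "Suc (e - 1) = e" using e by simp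
  have two: "(2 :: enat) = enat 2" by (simp add: numeral_eq_enat)
  have "hilbert_function (\<phi> ` I) = H_fun n e"
    unfolding I using L H d unfolding two ps_order_ge_iff ps_order_eq_iff e1
    by (intro hilbert_function_generators[OF _ _ p \<alpha> \<open>3 \<le> n\<close> e refl]) blast+
  moreover obtain f g where fg: "I = ideal_gen {f, g}" "f \<in> \<MM> 2" "g \<in> \<MM> 2"
    using type_2_2_initial[OF assms(1)] by blast
  have "hilbert_function (\<phi> ` ideal_gen {f, g}) = hilbert_function (ideal_gen {f, g})"
    by (rule hilbert_function_automorphism[OF \<phi>]) (rule fil_mono[OF fg(2)] fil_mono[OF fg(3)], simp)+
  ultimately show ?lhs using e by (simp add: fg(1))
qed

end
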